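(* Let $\mu^*$ denote the optimal policy for the problem of minimizing $C_\mu(s)$ over $\mu\in\Pi$, with strictly convex stage cost $g$. There exists a unique kernel function $\phi:[-B,\bar s]\to\mathbb R$ such that $$\mu^*(s,w)=\big[w-\phi(s-w)\big]^+\qquad\text{for all }(s,w)\in[0,\bar s]\times[0,B],$$ where $$\phi(p)=\arg\min_x\big\{g(x)+C(x+p)\;:\;\max\{0,-p\}\le x\le\min\{B,\bar s-p\}\big\}.$$ Moreover, if $Q\,\mathbf E[W]\le r$, the kernel function can be represented as $$\phi(p)=\begin{cases}-p,& -B\le p\le b_0,\\ \phi^\circ(p),& b_0\le p\le b_1,\\ 0,& b_1\le p\le\bar s,\end{cases}$$ where $\phi^\circ(p)$ is the unique solution $x$ of $$g'(x)+C'(x+p)=0,$$ and $b_0$ and $b_1$ are the break-points, where $$b_0=-(g')^{(-1)}\big(-C'(0)\big)\;\ge\;-(g')^{(-1)}\Big(\frac{Q}{r}\mathbf E[g(W)]\Big)\;\ge\;-B,\qquad b_1=(C')^{(-1)}\big(-g'(0)\big)\le\bar s.$$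
   Context: Model. Fix constants $r>0$ (storage ramp rate), $Q>0$ (Poisson arrival rate), $\theta>0$ (discount rate), $\bar s\in(0,\infty)$ (storage capacity), $B\in(0,\infty)$. Shocks arrive at the arrival times $0<t_1<t_2<\cdots$ of a Poisson process of rate $Q$; the shock sizes $W_1,W_2,\dots$ are i.i.d. with a distribution $f_W$ supported in $[0,B]$ and independent of the arrival times; $W$ denotes a generic random variable with distribution $f_W$. A (stationary Markov) policy is a measurable function $\mu:[0,\bar s]\times[0,B]\to\mathbb R$ with $0\le\mu(s,w)\le\min\{s,w\}$; the set of all policies is $\Pi$. Under policy $\mu$ from initial state $s_0=s\in[0,\bar s]$, the storage level $s_t\in[0,\bar s]$ increases at rate $r$ between arrivals until it reaches $\bar s$, where it stays until the next arrival, and at each arrival time $t_k$ it jumps down: $s_{t_k}=s_{t_k^-}-\mu(s_{t_k^-},W_k)$. The stage cost $g:[0,B]\to\mathbb R$ is bounded, strictly increasing, continuously differentiable, with $g(0)=0$ and $\mathbf E[g(W)]>0$. The cost of policy $\mu$ is $$C_\mu(s)=\mathbf E\Big[\sum_{k=1}^\infty e^{-\theta t_k}\,g\big(W_k-\mu(s_{t_k^-},W_k)\big)\,\Big|\,s_0=s\Big],$$ and the value function is $C(s)=\min_{\mu\in\Pi}C_\mu(s)$, $0\le s\le\bar s$. A policy $\mu^*\in\Pi$ is optimal if $\mu^*\in\arg\min_{\mu\in\Pi}C_\mu(s)$. Standing assumption: $C$ is continuously differentiable on $[0,\bar s]$. Notation: $[x]^+=\max\{0,x\}$; $g'$ and $C'$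 are the derivatives of $g$ and $C$, and $(g')^{(-1)}$, $(C')^{(-1)}$ denote the inverse functions of $g'$ and $C'$.
   Formalization: The policy [w-φ(s-w)]^+ is shown optimal; any other optimal policy equals it only for a.e. s (and s=s̄) and f_W-a.e. w, not for all (s,w). The break-point form is stated when g'(0) ≤ -C'(0), since otherwise b_0, b_1 are undefined; in that case φ(p)=max{0,-p}. *)

theory Defs
  imports "HOL-Probability.Probability"
begin

definition strictly_convex_on :: "real set \<Rightarrow> (real \<Rightarrow> real) \<Rightarrow> bool" where
  "strictly_convex_on S f \<longleftrightarrow> convex S \<and>
    (\<forall>x\<in>S. \<forall>y\<in>S. \<forall>u>0. \<forall>v>0. x \<noteq> y \<longrightarrow> u + v = 1 \<longrightarrow> f (u * x + v * y) < u * f x + v * f y)"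

(* A Poisson process of rate Q is given by its arrival times t 1 < t 2 < ..., with independent
   exponential(Q) interarrival times; t 0 = 0 is the starting time, not an arrival. *)
definition poisson_arrivals :: "'a measure \<Rightarrow> real \<Rightarrow> (nat \<Rightarrow> 'a \<Rightarrow> real) \<Rightarrow> bool" where
  "poisson_arrivals M Q t \<longleftrightarrow>
    (\<forall>\<omega>\<in>space M. t 0 \<omega> = 0 \<and> (\<forall>k. t k \<omega> < t (Suc k) \<omega>)) \<and>
    prob_space.indep_vars M (\<lambda>_. borel) (\<lambda>k \<omega>. t (Suc k) \<omega> - t k \<omega>) UNIV \<and>
    (\<forall>k. distributed M lborel (\<lambda>\<omega>. t (Suc k) \<omega> - t k \<omega>) (exponential_density Q))"

(* The shock at time t (Suc k) has size W (Suc k); W 0 is never used. *)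
definition iid_shocks :: "'a measure \<Rightarrow> real \<Rightarrow> real measure \<Rightarrow> (nat \<Rightarrow> 'a \<Rightarrow> real) \<Rightarrow> bool" where
  "iid_shocks M B f\<^sub>W W \<longleftrightarrow>
    (\<forall>\<omega>\<in>space M. \<forall>k. W (Suc k) \<omega> \<in> {0..B}) \<and>
    prob_space.indep_vars M (\<lambda>_. borel) (\<lambda>k. W (Suc k)) UNIV \<and>
    (\<forall>k. distr M borel (W (Suc k)) = f\<^sub>W)"

definition shock_model ::
  "'a measure \<Rightarrow> real \<Rightarrow> real \<Rightarrow> real measure \<Rightarrow> (nat \<Rightarrow> 'a \<Rightarrow> real) \<Rightarrow> (nat \<Rightarrow> 'a \<Rightarrow> real) \<Rightarrow> bool" where
  "shock_model M Q B f\<^sub>W t W \<longleftrightarrow>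
    prob_space M \<and> poisson_arrivals M Q t \<and> iid_shocks M B f\<^sub>W W \<and>
    prob_space.indep_var M
      (PiM UNIV (\<lambda>_. borel)) (\<lambda>\<omega> k. t (Suc k) \<omega>)
      (PiM UNIV (\<lambda>_. borel)) (\<lambda>\<omega> k. W (Suc k) \<omega>)"

(* Elements of the set are functions on the whole plane, but only their values on the rectangle
   [0,sbar] x [0,B] are constrained and used. *)
definition policies :: "real \<Rightarrow> real \<Rightarrow> (real \<Rightarrow> real \<Rightarrow> real) set" where
  "policies sbar B = {\<mu>.
    case_prod \<mu> \<in> borel_measurable (restrict_space borel ({0..sbar} \<times> {0..B})) \<and>
    (\<forall>s\<in>{0..sbar}. \<forall>w\<in>{0..B}. 0 \<le> \<mu> s w \<and> \<mu> s w \<le> min s w)}"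

(* Level reached from x after refilling at rate r for a duration d without arrivals. *)
definition refill :: "real \<Rightarrow> real \<Rightarrow> real \<Rightarrow> real \<Rightarrow> real" where
  "refill r sbar x d = min sbar (x + r * d)"

(* For sample paths t and w, the storage level immediately after the k-th arrival
   (for k = 0: the initial level). *)
primrec level_after ::
  "real \<Rightarrow> real \<Rightarrow> (nat \<Rightarrow> real) \<Rightarrow> (nat \<Rightarrow> real) \<Rightarrow> (real \<Rightarrow> real \<Rightarrow> real) \<Rightarrow> real \<Rightarrow> nat \<Rightarrow> real" where
  "level_after r sbar t w \<mu> s 0 = s"
| "level_after r sbar t w \<mu> s (Suc k) =
    (let x = refill r sbar (level_after r sbar t w \<mu> s k) (t (Suc k) - t k)
     in x - \<mu> x (w (Suc k)))"

(* The left limit of the storage level at the arrival time t (Suc k). *)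
definition level_before ::
  "real \<Rightarrow> real \<Rightarrow> (nat \<Rightarrow> real) \<Rightarrow> (nat \<Rightarrow> real) \<Rightarrow> (real \<Rightarrow> real \<Rightarrow> real) \<Rightarrow> real \<Rightarrow> nat \<Rightarrow> real" where
  "level_before r sbar t w \<mu> s k =
    refill r sbar (level_after r sbar t w \<mu> s k) (t (Suc k) - t k)"

definition cost ::
  "'a measure \<Rightarrow> real \<Rightarrow> real \<Rightarrow> real \<Rightarrow> (nat \<Rightarrow> 'a \<Rightarrow> real) \<Rightarrow> (nat \<Rightarrow> 'a \<Rightarrow> real) \<Rightarrow>
    (real \<Rightarrow> real) \<Rightarrow> (real \<Rightarrow> real \<Rightarrow> real) \<Rightarrow> real \<Rightarrow> real" where
  "cost M r \<theta> sbar t W g \<mu> s =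
    (\<integral>\<omega>. (\<Sum>k. exp (- \<theta> * t (Suc k) \<omega>) *
        g (W (Suc k) \<omega>
           - \<mu> (level_before r sbar (\<lambda>i. t i \<omega>) (\<lambda>i. W i \<omega>) \<mu> s k) (W (Suc k) \<omega>))) \<partial>M)"

definition value_function ::
  "'a measure \<Rightarrow> real \<Rightarrow> real \<Rightarrow> real \<Rightarrow> real \<Rightarrow> (nat \<Rightarrow> 'a \<Rightarrow> real) \<Rightarrow> (nat \<Rightarrow> 'a \<Rightarrow> real) \<Rightarrow>
    (real \<Rightarrow> real) \<Rightarrow> real \<Rightarrow> real" where
  "value_function M r \<theta> sbar B t W g s = (INF \<mu>\<in>policies sbar B. cost M r \<theta> sbar t W g \<mu> s)"

(* Optimal means simultaneously optimal from every initial level. *)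
definition optimal_policy ::
  "'a measure \<Rightarrow> real \<Rightarrow> real \<Rightarrow> real \<Rightarrow> real \<Rightarrow> (nat \<Rightarrow> 'a \<Rightarrow> real) \<Rightarrow> (nat \<Rightarrow> 'a \<Rightarrow> real) \<Rightarrow>
    (real \<Rightarrow> real) \<Rightarrow> (real \<Rightarrow> real \<Rightarrow> real) \<Rightarrow> bool" where
  "optimal_policy M r \<theta> sbar B t W g \<mu> \<longleftrightarrow>
    (\<forall>s\<in>{0..sbar}. is_arg_min (\<lambda>\<nu>. cost M r \<theta> sbar t W g \<nu> s) (\<lambda>\<nu>. \<nu> \<in> policies sbar B) \<mu>)"

(* Being extensional makes a function on [-B,sbar] unique as a total function. *)
definition kernel_function ::
  "real \<Rightarrow> real \<Rightarrow> (real \<Rightarrow> real) \<Rightarrow> (real \<Rightarrow> real) \<Rightarrow> (real \<Rightarrow> real) \<Rightarrow> bool" where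
  "kernel_function sbar B g C \<phi> \<longleftrightarrow>
    \<phi> \<in> extensional {-B..sbar} \<and>
    (\<forall>p\<in>{-B..sbar}.
      {x. is_arg_min (\<lambda>x. g x + C (x + p)) (\<lambda>x. max 0 (-p) \<le> x \<and> x \<le> min B (sbar - p)) x} = {\<phi> p})"

end

theory Submission
  imports Defs
begin

text \<open>
  Nothing is decided between arrivals, so the controlled storage is a discounted decision process
  observed at the arrival times. Write \<open>y = w - \<mu>\<close> for the part of a shock that is not met from
  storage. From level \<open>s\<close> and demand \<open>w\<close> the cost of choosing \<open>y\<close> is \<open>g y + V (y + (s - w))\<close>, where
  \<open>V\<close> is the cost from the level that remains. Apart from the constraint \<open>y \<le> w\<close> this problem depends
  on \<open>(s, w)\<close> only through \<open>p = s - w\<close>; its minimiser is the kernel \<open>\<phi> p\<close>. If \<open>V\<close> is convex, the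
  objective is strictly convex in \<open>y\<close>, and putting the constraint back truncates the minimiser to
  \<open>min w (\<phi> (s - w))\<close>, which is the policy of the theorem.

  Convexity of the value function is obtained by value iteration. One period multiplies later costs by
  \<open>exp (- \<theta> * \<tau>)\<close> with \<open>\<tau>\<close> exponential, so by \<open>Q / (Q + \<theta>) < 1\<close> in the mean, and the Bellman operator
  is a contraction. It preserves convex nonincreasing functions: the objective is jointly convex in
  \<open>(s, y)\<close>, so partial minimisation keeps convexity in \<open>s\<close>, and the refilled level is a concave
  function of the previous level, which a nonincreasing convex function turns into a convex one.
  Banach's theorem yields a convex fixed point (\<open>bellman_solution\<close>), and comparing it with the costs
  of finitely many periods shows that it bounds the cost of every policy from below and is attained by
  the kernel policy (\<open>policy_cost_ge_V\<close>, \<open>policy_cost_kernel_policy\<close>). What links this recursion to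
  the cost, which is an integral over sample paths, is the invariance of independent sequences under
  the shift that removes the first period (\<open>cost_eq_policy_cost\<close>).

  An optimal policy has the value function as its cost, so its excess over the minimum in the first
  period has integral zero. Strict convexity then forces it to agree with the kernel policy at almost
  every level reached at the first arrival. From an empty storage this level has a positive density
  below capacity; from a full storage it is the capacity itself (\<open>optimal_policy_cost_unique\<close>).

  For the break-points, conditioning on the first arrival time gives the differential equation
  \<open>r * V' = (Q + \<theta>) * V - Q * H\<close>, where \<open>H s\<close> is the minimal cost from a shock
  at level \<open>s\<close> onwards, averaged over the shock size. At the two ends of the interval it reads \<open>V' sbar = 0\<close> and
  \<open>- V' 0 \<le> Q / r * E (g W)\<close>. Since \<open>g w \<le> g' B * w\<close>, the assumption \<open>Q * E W \<le> r\<close> makes this last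
  bound at most \<open>g' B\<close>. The shape of the kernel follows from first-order conditions and the
  intermediate value theorem (\<open>kernel_structure\<close>).

  These conditions determine the upper break-point only if \<open>V'\<close> is injective, that is, if \<open>V\<close> is strictly
  convex. Suppose that \<open>V'\<close> is constant, say \<open>c\<close>, on an interval. By the differential equation \<open>H\<close>
  is affine there with slope \<open>(1 + \<theta> / Q) * c\<close>. A mean of convex functions is affine only if almost
  all of them are, and by strict convexity of \<open>g\<close> the minimal cost after a shock is affine
  only if the same demand stays unmet at both ends; then \<open>V\<close> is affine on the interval shifted
  down by the amount that was served (\<open>flat_step\<close>). If \<open>c < 0\<close>, some of these shifted intervals have a
  slope below \<open>c\<close>, hence lie below the first interval, and repeating the argument produces arbitrarily
  many disjoint intervals of the same length inside \<open>{0..sbar}\<close> (\<open>no_descending_flat\<close>). If \<open>c = 0\<close>,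
  the lowest interval of this kind cannot be shifted, so a full storage never serves anything, which
  would be suboptimal as soon as a positive shock occurs (\<open>V'_neg\<close>).
\<close>

section \<open>Convex functions and their derivatives\<close>

text \<open>Both inner points are convex combinations of the outer ones with complementary weights. This exchange
  inequality drives the monotonicity of the kernel.\<close>

lemma convex_on_spread:
  fixes f :: "real \<Rightarrow> real"
  assumes f: "convex_on S f" and S: "a \<in> S" "d \<in> S" and b: "a \<le> b" "b \<le> d" and c: "b + c = a + d"
  shows "f b + f c \<le> f a + f d"
proof (cases "a = d")
  case True
  with b c show ?thesis by (auto simp: algebra_simps)
next
  case False
  with b have ad: "a < d" by simp
  define l where "l = (b - a) / (d - a)"
  have l: "0 \<le> l" "l \<le> 1" using ad b by (auto simp: l_def)
  have "l * (d - a) = b - a" using ad by (simp add: l_def)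
  then have lb: "b = (1 - l) * a + l * d" and lc: "c = l * a + (1 - l) * d"
    using c by (simp_all add: algebra_simps)
  have "f b \<le> (1 - l) * f a + l * f d" "f c \<le> l * f a + (1 - l) * f d"
    using f l S unfolding lb lc convex_on_def by auto
  then show ?thesis by (simp add: algebra_simps)
qed

lemma strictly_convex_on_imp_convex_on:
  assumes "strictly_convex_on S f"
  shows "convex_on S f"
  unfolding convex_on_def
proof (intro conjI ballI allI impI)
  show "convex S" using assms by (simp add: strictly_convex_on_def)
  fix x y u v :: real
  assume xy: "x \<in> S" "y \<in> S" and uv: "0 \<le> u" "0 \<le> v" "u + v = 1"
  show "f (u *\<^sub>R x + v *\<^sub>R y) \<le> u * f x + v * f y"
  proof (cases "x = y \<or> u = 0 \<or> v = 0")
    case True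
    then show ?thesis using uv by (auto simp flip: distrib_right)
  next
    case False
    then show ?thesis using assms xy uv unfolding strictly_convex_on_def by (force intro: less_imp_le)
  qed
qed

text \<open>The two monotonicity conditions together say that the function is Lipschitz with constant 1.\<close>

lemma continuous_on_if_antimono_and_mono_add:
  fixes \<phi> :: "real \<Rightarrow> real"
  assumes anti: "\<And>p q. p \<in> S \<Longrightarrow> q \<in> S \<Longrightarrow> p < q \<Longrightarrow> \<phi> q \<le> \<phi> p"
    and mono: "\<And>p q. p \<in> S \<Longrightarrow> q \<in> S \<Longrightarrow> p < q \<Longrightarrow> p + \<phi> p \<le> q + \<phi> q"
  shows "continuous_on S \<phi>"
proof (rule continuous_onI)
  fix p e :: real assume p: "p \<in> S" and e: "0 < e"
  have "dist (\<phi> q) (\<phi> p) \<le> dist q p" if q: "q \<in> S" for q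
    using anti[OF p q] anti[OF q p] mono[OF p q] mono[OF q p]
    by (cases q p rule: linorder_cases) (auto simp: dist_real_def)
  then show "\<exists>d>0. \<forall>q\<in>S. dist q p < d \<longrightarrow> dist (\<phi> q) (\<phi> p) \<le> e"
    using e by (intro exI[of _ e]) force
qed

lemma has_real_derivative_unique_within_interval:
  fixes f :: "real \<Rightarrow> real"
  assumes "(f has_real_derivative D) (at x within {a..b})" "(f has_real_derivative D') (at x within {a..b})"
    and "a < b" "x \<in> {a..b}"
  shows "D = D'"
  using vector_derivative_unique_within_closed_interval[of a b x f D D'] assms
  by (simp add: has_real_derivative_iff_has_vector_derivative)

text \<open>The difference quotients of a convex function towards a point are bounded by the full slope, and the
  derivative is their limit. The derivative is one-sided at the ends of an interval, where the
  break-points and the boundary conditions of the value function live.\<close>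

lemma convex_on_tangent_le:
  fixes f :: "real \<Rightarrow> real"
  assumes f: "convex_on S f" and D: "(f has_real_derivative D) (at x within S)" and x: "x \<in> S" and y: "y \<in> S"
  shows "D * (y - x) \<le> f y - f x"
proof -
  have S: "convex S" using f by (simp add: convex_on_def)
  define p where "p = (\<lambda>h. x + h * (y - x))"
  have p_in: "p h \<in> S" if "h \<in> {0..1}" for h
  proof -
    have "(1 - h) *\<^sub>R x + h *\<^sub>R y \<in> S" using convexD_alt[OF S x y] that by simp
    then show ?thesis by (simp add: p_def algebra_simps)
  qed
  have "(p has_real_derivative (y - x)) (at 0 within {0..1})"
    unfolding p_def by (auto intro!: derivative_eq_intros)
  moreover have "(f has_real_derivative D) (at (p 0) within p ` {0..1})"
  proof -
    have p0: "p 0 = x" by (simp add: p_def)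
    show ?thesis unfolding p0 by (rule DERIV_subset[OF D]) (use p_in in auto)
  qed
  ultimately have "((f \<circ> p) has_real_derivative D * (y - x)) (at 0 within {0..1})"
    by (intro DERIV_image_chain) 
  then have lim: "((\<lambda>h. (f (p h) - f (p 0)) / (h - 0)) \<longlongrightarrow> D * (y - x)) (at 0 within {0..1})"
    by (simp add: has_field_derivative_iff)
  have bound: "(f (p h) - f (p 0)) / (h - 0) \<le> f y - f x" if h: "h \<in> {0..1}" "h \<noteq> 0" for h
  proof -
    have "f (p h) \<le> (1 - h) * f x + h * f y"
      using convex_onD[OF f, of h x y] x y h by (simp add: p_def algebra_simps)
    then have "f (p h) - f (p 0) \<le> h * (f y - f x)" by (simp add: p_def algebra_simps)
    then show ?thesis using h by (simp add: divide_le_eq mult.commute)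
  qed
  show ?thesis
  proof (rule tendsto_upperbound[OF lim])
    show "eventually (\<lambda>h. (f (p h) - f (p 0)) / (h - 0) \<le> f y - f x) (at 0 within {0..1})"
      unfolding eventually_at_filter using bound by (auto intro: always_eventually)
    show "at (0::real) within {0..1} \<noteq> bot"
      unfolding trivial_limit_within by (intro notI) (simp add: islimpt_Icc)
  qed
qed

lemma convex_on_deriv_mono:
  fixes f f' :: "real \<Rightarrow> real"
  assumes f: "convex_on {a..b} f"
    and D: "\<And>x. x \<in> {a..b} \<Longrightarrow> (f has_real_derivative f' x) (at x within {a..b})"
    and xy: "x \<in> {a..b}" "y \<in> {a..b}" "x \<le> y"
  shows "f' x \<le> f' y"
proof (cases "x = y")
  case False
  have "f' x * (y - x) \<le> f' y * (y - x)"
    using convex_on_tangent_le[OF f D xy(1,2)] convex_on_tangent_le[OF f D xy(2,1)] xy(1,2)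
    by (simp add: algebra_simps)
  then show ?thesis using False xy(3) by simp
qed simp

lemma strictly_convex_on_deriv_strict_mono:
  fixes f f' :: "real \<Rightarrow> real"
  assumes f: "strictly_convex_on {a..b} f"
    and D: "\<And>x. x \<in> {a..b} \<Longrightarrow> (f has_real_derivative f' x) (at x within {a..b})"
    and xy: "x \<in> {a..b}" "y \<in> {a..b}" "x < y"
  shows "f' x < f' y"
proof -
  have conv: "convex_on {a..b} f" using f by (rule strictly_convex_on_imp_convex_on)
  let ?m = "(1/2) * x + (1/2) * y"
  have m: "?m \<in> {a..b}" using xy by auto
  have "f (u * x + v * y) < u * f x + v * f y" if "u > 0" "v > 0" "u + v = 1" for u v
    using f xy that unfolding strictly_convex_on_def by simp
  from this[of "1/2" "1/2"] have "f ?m < (1/2) * f x + (1/2) * f y" by simp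
  moreover have "f' x * (?m - x) \<le> f ?m - f x" "f' y * (?m - y) \<le> f ?m - f y"
    using xy m by (intro convex_on_tangent_le[OF conv D]; simp)+
  moreover have h: "?m - x = (y - x) / 2" "?m - y = - ((y - x) / 2)" by (simp_all add: field_simps)
  ultimately have "f' x * ((y - x) / 2) < f' y * ((y - x) / 2)" unfolding h by linarith
  then show ?thesis using xy(3) by (simp add: mult_less_cancel_right)
qed

text \<open>A convex function whose midpoint lies on the chord coincides with the chord, because the tangent at the
  midpoint has the slope of the chord and supports the graph from below. So one numerical equality is
  enough to recognise an affine piece.\<close>

lemma convex_on_midpoint_chord_deriv:
  fixes f f' :: "real \<Rightarrow> real"
  assumes f: "convex_on {l..u} f"
    and D: "\<And>x. x \<in> {l..u} \<Longrightarrow> (f has_real_derivative f' x) (at x within {l..u})"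
    and ab: "l \<le> a" "a < b" "b \<le> u"
    and mid: "f ((a + b) / 2) = (f a + f b) / 2"
  shows "f' a = (f b - f a) / (b - a)" "f' b = (f b - f a) / (b - a)"
proof -
  define c where "c = (f b - f a) / (b - a)"
  define m where "m = (a + b) / 2"
  have cb: "f b = f a + c * (b - a)" using ab by (simp add: c_def)
  have fm: "f m = f a + c * (m - a)" 
  proof -
    have ma: "m - a = (b - a) / 2" by (simp add: m_def field_simps)
    show ?thesis using mid unfolding m_def[symmetric] cb ma by (simp add: field_simps)
  qed
  have in_lu: "x \<in> {l..u}" if "x \<in> {a..b}" for x using that ab by auto
  have m: "m \<in> {a..b}" using ab by (simp add: m_def)
  have half: "b - m = (b - a) / 2" "a - m = - ((b - a) / 2)" by (simp_all add: m_def field_simps)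
  have "f' m * (b - m) \<le> f b - f m" "f' m * (a - m) \<le> f a - f m"
    using m ab by (intro convex_on_tangent_le[OF f D] in_lu; simp)+
  moreover have "f b - f m = c * (b - m)" "f a - f m = c * (a - m)" by (simp_all add: cb fm algebra_simps)
  ultimately have "f' m * ((b - a) / 2) = c * ((b - a) / 2)" unfolding half by linarith
  then have fm': "f' m = c" using ab by auto
  have aff: "f x = f a + c * (x - a)" if x: "x \<in> {a..b}" for x
  proof (rule antisym)
    define h where "h = (x - a) / (b - a)"
    have h: "0 \<le> h" "h \<le> 1" using x ab by (auto simp: h_def)
    have hx: "h * (b - a) = x - a" using ab by (simp add: h_def)
    have "f ((1 - h) * a + h * b) \<le> (1 - h) * f a + h * f b"
      using convex_onD[OF f h, of a b] ab by simp
    moreover have "(1 - h) * a + h * b = a + h * (b - a)" by (simp add: algebra_simps)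
    moreover have "(1 - h) * f a + h * f b = f a + c * (h * (b - a))" unfolding cb by (simp add: algebra_simps)
    ultimately show "f x \<le> f a + c * (x - a)" unfolding hx by simp
    have "c * (x - m) \<le> f x - f m"
      using convex_on_tangent_le[OF f D[OF in_lu[OF m]] in_lu[OF m] in_lu[OF x]] by (simp add: fm')
    then show "f a + c * (x - a) \<le> f x" unfolding fm by (simp add: algebra_simps)
  qed
  have "f' x = c" if x: "x \<in> {a..b}" for x
  proof (rule has_real_derivative_unique_within_interval[OF _ _ ab(2) x])
    show "(f has_real_derivative f' x) (at x within {a..b})"
      using ab by (intro DERIV_subset[OF D[OF in_lu[OF x]]]) auto
    have "((\<lambda>x. f a + c * (x - a)) has_real_derivative c) (at x within {a..b})"
      by (auto intro!: derivative_eq_intros)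
    then show "(f has_real_derivative c) (at x within {a..b})"
    proof (rule has_field_derivative_transform_within[of _ _ _ _ 1])
      show "f a + c * (y - a) = f y" if "y \<in> {a..b}" for y using aff[OF that] by (rule sym)
    qed (use x in simp_all)
  qed
  then show "f' a = (f b - f a) / (b - a)" "f' b = (f b - f a) / (b - a)"
    using ab by (auto simp: c_def)
qed

lemma deriv_const_imp_affine:
  fixes f f' :: "real \<Rightarrow> real"
  assumes f: "convex_on {l..u} f"
    and D: "\<And>x. x \<in> {l..u} \<Longrightarrow> (f has_real_derivative f' x) (at x within {l..u})"
    and ab: "l \<le> a" "b \<le> u" and c: "f' a = c" "f' b = c" and x: "x \<in> {a..b}"
  shows "f' x = c" "f x = f a + c * (x - a)"
proof -
  have in_lu: "a \<in> {l..u}" "b \<in> {l..u}" "x \<in> {l..u}" using x ab by auto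
  show fx: "f' x = c"
    using convex_on_deriv_mono[OF f D, of a x] convex_on_deriv_mono[OF f D, of x b] in_lu x c by auto
  have "c * (x - a) \<le> f x - f a" "c * (a - x) \<le> f a - f x"
    using convex_on_tangent_le[OF f D[OF in_lu(1)] in_lu(1,3)]
      convex_on_tangent_le[OF f D[OF in_lu(3)] in_lu(3,1)] c fx by simp_all
  then show "f x = f a + c * (x - a)" by (simp add: algebra_simps)
qed

section \<open>The kernel\<close>

text \<open>Restricting the domain makes the function extensional, as \<^const>\<open>kernel_function\<close> demands.\<close>

definition cost_kernel :: "real \<Rightarrow> real \<Rightarrow> (real \<Rightarrow> real) \<Rightarrow> (real \<Rightarrow> real) \<Rightarrow> real \<Rightarrow> real" where
  "cost_kernel sbar B g f = (\<lambda>p\<in>{-B..sbar}.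
     THE x. is_arg_min (\<lambda>x. g x + f (x + p)) (\<lambda>x. max 0 (-p) \<le> x \<and> x \<le> min B (sbar - p)) x)"

lemma kernel_function_unique:
  assumes "kernel_function sbar B g f \<phi>" "kernel_function sbar B g f \<psi>"
  shows "\<phi> = \<psi>"
  using assms unfolding kernel_function_def
  by (intro extensionalityI[where A="{-B..sbar}"]) auto

lemma kernel_function_cong:
  assumes "\<And>x. x \<in> {0..sbar} \<Longrightarrow> f x = f' x"
  shows "kernel_function sbar B g f = kernel_function sbar B g f'"
proof -
  have "is_arg_min (\<lambda>x. g x + f (x + p)) (\<lambda>x. max 0 (-p) \<le> x \<and> x \<le> min B (sbar - p)) x
    = is_arg_min (\<lambda>x. g x + f' (x + p)) (\<lambda>x. max 0 (-p) \<le> x \<and> x \<le> min B (sbar - p)) x" for p x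
  proof -
    have "f (y + p) = f' (y + p)" if "max 0 (-p) \<le> y \<and> y \<le> min B (sbar - p)" for y
      using that by (intro assms) auto
    then show ?thesis unfolding is_arg_min_def by (intro conj_cong) auto
  qed
  then show ?thesis by (intro ext) (simp add: kernel_function_def)
qed

lemma kernel_feasible:
  assumes "kernel_function sbar B g f \<phi>" "p \<in> {-B..sbar}"
  shows "0 \<le> \<phi> p" "- p \<le> \<phi> p" "\<phi> p \<le> B" "\<phi> p + p \<le> sbar"
proof -
  have "\<phi> p \<in> {x. is_arg_min (\<lambda>x. g x + f (x + p)) (\<lambda>x. max 0 (-p) \<le> x \<and> x \<le> min B (sbar - p)) x}"
    using assms unfolding kernel_function_def by auto
  then show "0 \<le> \<phi> p" "- p \<le> \<phi> p" "\<phi> p \<le> B" "\<phi> p + p \<le> sbar"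
    by (auto simp: is_arg_min_def)
qed

lemma kernel_strict_min:
  assumes "kernel_function sbar B g f \<phi>" "p \<in> {-B..sbar}"
    and x: "0 \<le> x" "- p \<le> x" "x \<le> B" "x + p \<le> sbar" "x \<noteq> \<phi> p"
  shows "g (\<phi> p) + f (\<phi> p + p) < g x + f (x + p)"
proof -
  let ?m = "is_arg_min (\<lambda>x. g x + f (x + p)) (\<lambda>x. max 0 (-p) \<le> x \<and> x \<le> min B (sbar - p))"
  have eq: "{x. ?m x} = {\<phi> p}"
    using assms unfolding kernel_function_def by auto
  then have 1: "?m (\<phi> p)" by blast
  have "\<not> ?m x" using eq x(5) by blast
  then obtain y where "0 \<le> y" "- p \<le> y" "y \<le> B" "y + p \<le> sbar" "g y + f (y + p) < g x + f (x + p)"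
    using x by (auto simp: is_arg_min_def)
  moreover from this 1 have "g (\<phi> p) + f (\<phi> p + p) \<le> g y + f (y + p)"
    unfolding is_arg_min_linorder by auto
  ultimately show ?thesis by simp
qed

lemma kernel_min:
  assumes "kernel_function sbar B g f \<phi>" "p \<in> {-B..sbar}"
    and "0 \<le> x" "- p \<le> x" "x \<le> B" "x + p \<le> sbar"
  shows "g (\<phi> p) + f (\<phi> p + p) \<le> g x + f (x + p)"
  using kernel_strict_min[OF assms] by (cases "x = \<phi> p") auto

locale kernel_problem =
  fixes sbar B :: real and g f :: "real \<Rightarrow> real"
  assumes sbar: "0 < sbar" and B: "0 < B"
    and g_cont: "continuous_on {0..B} g"
    and g_convex: "strictly_convex_on {0..B} g"
    and f_cont: "continuous_on {0..sbar} f"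
    and f_convex: "convex_on {0..sbar} f"
begin

lemma objective_strict:
  assumes "0 \<le> x" "x \<le> B" "0 \<le> y" "y \<le> B" "x \<noteq> y"
    and "0 \<le> x + p" "x + p \<le> sbar" "0 \<le> y + q" "y + q \<le> sbar" and u: "u > 0" "v > 0" "u + v = 1"
  shows "g (u * x + v * y) + f (u * (x + p) + v * (y + q))
    < u * (g x + f (x + p)) + v * (g y + f (y + q))"
proof -
  have "g (u * x + v * y) < u * g x + v * g y"
    using g_convex assms unfolding strictly_convex_on_def by auto
  moreover have "f (u * (x + p) + v * (y + q)) \<le> u * f (x + p) + v * f (y + q)"
    using f_convex assms unfolding convex_on_def by auto
  ultimately show ?thesis by (simp add: algebra_simps)
qed

lemma kernel_function_cost_kernel: "kernel_function sbar B g f (cost_kernel sbar B g f)"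
proof -
  let ?m = "\<lambda>p. is_arg_min (\<lambda>x. g x + f (x + p)) (\<lambda>x. max 0 (-p) \<le> x \<and> x \<le> min B (sbar - p))"
  have ex1: "\<exists>a. \<forall>x. ?m p x \<longleftrightarrow> x = a" if p: "p \<in> {-B..sbar}" for p
  proof -
    let ?I = "{max 0 (-p)..min B (sbar - p)}"
    let ?F = "\<lambda>x. g x + f (x + p)"
    have "continuous_on ?I g" by (rule continuous_on_subset[OF g_cont]) auto
    moreover have "continuous_on ?I (\<lambda>x. f (x + p))"
      by (rule continuous_on_compose2[OF f_cont]) (auto intro!: continuous_intros)
    ultimately have "continuous_on ?I ?F" by (intro continuous_intros)
    moreover have "?I \<noteq> {}" using p sbar B by auto
    ultimately obtain x where x: "x \<in> ?I" "\<And>y. y \<in> ?I \<Longrightarrow> ?F x \<le> ?F y"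
      using continuous_attains_inf[of ?I ?F] by auto
    have uniq: "y = x" if y: "y \<in> ?I" "?F y \<le> ?F x" for y
    proof (rule ccontr)
      assume "y \<noteq> x"
      have "g ((1/2) * x + (1/2) * y) + f ((1/2) * (x + p) + (1/2) * (y + p))
          < (1/2) * ?F x + (1/2) * ?F y"
        using x(1) y(1) \<open>y \<noteq> x\<close> by (intro objective_strict) auto
      also have "(1/2) * (x + p) + (1/2) * (y + p) = ((1/2) * x + (1/2) * y) + p"
        by (simp add: field_simps)
      finally have "?F ((1/2) * x + (1/2) * y) < (1/2) * ?F x + (1/2) * ?F y" .
      moreover have "(1/2) * x + (1/2) * y \<in> ?I" using x(1) y(1) by auto
      ultimately show False
        using x(2)[of y] y(2) x(2)[of "(1/2) * x + (1/2) * y"] x(1) y(1) by auto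
    qed
    have "is_arg_min ?F (\<lambda>x. max 0 (-p) \<le> x \<and> x \<le> min B (sbar - p)) y \<longleftrightarrow> y = x" for y
      unfolding is_arg_min_linorder atLeastAtMost_iff[symmetric]
    proof
      assume "y \<in> ?I \<and> (\<forall>z. z \<in> ?I \<longrightarrow> ?F y \<le> ?F z)"
      then show "y = x" using x(1) by (intro uniq) simp_all
    next
      assume "y = x"
      then show "y \<in> ?I \<and> (\<forall>z. z \<in> ?I \<longrightarrow> ?F y \<le> ?F z)" using x by simp
    qed
    then show ?thesis by blast
  qed
  show ?thesis unfolding kernel_function_def
  proof (intro conjI ballI)
    show "cost_kernel sbar B g f \<in> extensional {-B..sbar}" by (simp add: cost_kernel_def)
    fix p assume p: "p \<in> {-B..sbar}"
    show "{x. is_arg_min (\<lambda>x. g x + f (x + p)) (\<lambda>x. max 0 (-p) \<le> x \<and> x \<le> min B (sbar - p)) x}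
      = {cost_kernel sbar B g f p}"
    proof -
      obtain a where a: "\<And>x. ?m p x \<longleftrightarrow> x = a" using ex1[OF p] by blast
      have "cost_kernel sbar B g f p = a" unfolding cost_kernel_def restrict_apply'[OF p] a by simp
      then show ?thesis unfolding a by simp
    qed
  qed
qed

abbreviation "\<phi> \<equiv> cost_kernel sbar B g f"

lemmas feasible = kernel_feasible[OF kernel_function_cost_kernel]
  and strict_min = kernel_strict_min[OF kernel_function_cost_kernel]
  and least = kernel_min[OF kernel_function_cost_kernel]

text \<open>Exchange argument: if more were left unmet at the larger \<open>q\<close>, the strict optimality of both choices
  would contradict the spread inequality for the convex continuation cost.\<close>

lemma kernel_antimono:
  assumes pq: "p \<in> {-B..sbar}" "q \<in> {-B..sbar}" "p < q"
  shows "\<phi> q \<le> \<phi> p"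
proof (rule ccontr)
  assume less: "\<not> ?thesis"
  note feas = feasible[OF pq(1)] feasible[OF pq(2)]
  have "g (\<phi> p) + f (\<phi> p + p) < g (\<phi> q) + f (\<phi> q + p)"
    using feas less pq by (intro strict_min) auto
  moreover have "g (\<phi> q) + f (\<phi> q + q) < g (\<phi> p) + f (\<phi> p + q)"
    using feas less pq by (intro strict_min) auto
  moreover have "f (\<phi> q + p) + f (\<phi> p + q) \<le> f (\<phi> p + p) + f (\<phi> q + q)"
    by (rule convex_on_spread[OF f_convex]) (use feas less pq in auto)
  ultimately show False by simp
qed

text \<open>The same exchange, now between the levels left in storage; this time the stage cost provides the
  convexity.\<close>

lemma kernel_mono_add:
  assumes pq: "p \<in> {-B..sbar}" "q \<in> {-B..sbar}" "p < q"
  shows "p + \<phi> p \<le> q + \<phi> q"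
proof (rule ccontr)
  assume less: "\<not> ?thesis"
  note feas = feasible[OF pq(1)] feasible[OF pq(2)]
  from less have lt: "q + \<phi> q < p + \<phi> p" "p < q" using pq(3) by simp_all
  have "g (\<phi> p) + f (\<phi> p + p) < g (q + \<phi> q - p) + f ((q + \<phi> q - p) + p)"
    by (rule strict_min[OF pq(1)]) (use feas lt in linarith)+
  moreover have "g (\<phi> q) + f (\<phi> q + q) < g (p + \<phi> p - q) + f ((p + \<phi> p - q) + q)"
    by (rule strict_min[OF pq(2)]) (use feas lt in linarith)+
  moreover have "g (q + \<phi> q - p) + g (p + \<phi> p - q) \<le> g (\<phi> q) + g (\<phi> p)"
    by (rule convex_on_spread[OF strictly_convex_on_imp_convex_on[OF g_convex]])
      (use feas lt in auto)
  ultimately show False by (simp add: algebra_simps)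
qed

lemma kernel_cont: "continuous_on {-B..sbar} \<phi>"
  by (rule continuous_on_if_antimono_and_mono_add) (fact kernel_antimono kernel_mono_add)+

definition unmet :: "real \<Rightarrow> real \<Rightarrow> real" where
  "unmet s w = min w (\<phi> (s - w))"

lemma unmet_feasible:
  assumes "s \<in> {0..sbar}" "w \<in> {0..B}"
  shows "0 \<le> unmet s w" "w - s \<le> unmet s w" "unmet s w \<le> w"
  using feasible[of "s - w"] assms by (auto simp: unmet_def)

text \<open>The kernel minimises without the bound \<open>y \<le> w\<close>. If it exceeds \<open>w\<close>, then \<open>w\<close> lies between any smaller
  \<open>y\<close> and the unconstrained minimiser, so by convexity the objective at \<open>w\<close> is already below the one
  at \<open>y\<close>.\<close>

lemma unmet_strict_min:
  assumes s: "s \<in> {0..sbar}" and w: "w \<in> {0..B}"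
    and y: "0 \<le> y" "w - s \<le> y" "y \<le> w" "y \<noteq> unmet s w"
  shows "g (unmet s w) + f (unmet s w + (s - w)) < g y + f (y + (s - w))"
proof (cases "\<phi> (s - w) \<le> w")
  case True
  then have [simp]: "unmet s w = \<phi> (s - w)" by (simp add: unmet_def)
  show ?thesis using strict_min[of "s - w" y] s w y by auto
next
  case False
  then have u: "unmet s w = w" by (simp add: unmet_def)
  define p where "p = s - w"
  have feas: "0 \<le> \<phi> p" "- p \<le> \<phi> p" "\<phi> p \<le> B" "\<phi> p + p \<le> sbar"
    using feasible[of p] s w by (auto simp: p_def)
  have lt: "y < w" "w < \<phi> p" using False u y by (auto simp: p_def)
  \<comment> \<open>the weight that makes \<open>w\<close> a mixture of \<open>y\<close> and \<open>\<phi> p\<close>\<close>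
  define l where "l = (\<phi> p - w) / (\<phi> p - y)"
  have l: "0 < l" "l < 1" using lt by (auto simp: l_def)
  have "l * (\<phi> p - y) = \<phi> p - w" using lt by (simp add: l_def)
  then have w_eq: "l * y + (1 - l) * \<phi> p = w" by (simp add: algebra_simps)
  then have p_eq: "l * (y + p) + (1 - l) * (\<phi> p + p) = w + p" by (simp add: algebra_simps)
  have "g (l * y + (1 - l) * \<phi> p) + f (l * (y + p) + (1 - l) * (\<phi> p + p))
      < l * (g y + f (y + p)) + (1 - l) * (g (\<phi> p) + f (\<phi> p + p))"
    using feas lt l s w y by (intro objective_strict) (auto simp: p_def)
  then have "g w + f (w + p) < l * (g y + f (y + p)) + (1 - l) * (g (\<phi> p) + f (\<phi> p + p))"
    unfolding w_eq p_eq .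
  also have "\<dots> \<le> l * (g y + f (y + p)) + (1 - l) * (g y + f (y + p))"
    using l s w y lt feas by (intro add_left_mono mult_left_mono least) (auto simp: p_def)
  finally show ?thesis unfolding u p_def by (simp add: algebra_simps)
qed

lemma unmet_min:
  assumes "s \<in> {0..sbar}" "w \<in> {0..B}" "0 \<le> y" "w - s \<le> y" "y \<le> w"
  shows "g (unmet s w) + f (unmet s w + (s - w)) \<le> g y + f (y + (s - w))"
  using unmet_strict_min[OF assms] by (cases "y = unmet s w") auto

lemma unmet_cont: "continuous_on ({0..sbar} \<times> {0..B}) (\<lambda>(s, w). unmet s w)"
proof -
  have "continuous_on ({0..sbar} \<times> {0..B}) (\<lambda>x. \<phi> (fst x - snd x))"
    by (rule continuous_on_compose2[OF kernel_cont]) (auto intro!: continuous_intros)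
  then show ?thesis unfolding unmet_def case_prod_beta
    by (intro continuous_intros)
qed

definition shock_cost :: "real \<Rightarrow> real \<Rightarrow> real" where
  "shock_cost s w = g (unmet s w) + f (unmet s w + (s - w))"

lemma shock_cost_cont: "continuous_on ({0..sbar} \<times> {0..B}) (\<lambda>(s, w). shock_cost s w)"
proof -
  note u = unmet_cont[unfolded case_prod_beta]
  have feas: "unmet (fst x) (snd x) \<in> {0..B}" "unmet (fst x) (snd x) + (fst x - snd x) \<in> {0..sbar}"
    if "x \<in> {0..sbar} \<times> {0..B}" for x
    using unmet_feasible[of "fst x" "snd x"] that by auto
  have "continuous_on ({0..sbar} \<times> {0..B}) (\<lambda>x. g (unmet (fst x) (snd x)))"
    by (rule continuous_on_compose2[OF g_cont u]) (use feas in blast)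
  moreover have "continuous_on ({0..sbar} \<times> {0..B}) (\<lambda>x. f (unmet (fst x) (snd x) + (fst x - snd x)))"
  proof (rule continuous_on_compose2[OF f_cont])
    show "continuous_on ({0..sbar} \<times> {0..B}) (\<lambda>x. unmet (fst x) (snd x) + (fst x - snd x))"
      by (intro continuous_intros u)
  qed (use feas in blast)
  ultimately show ?thesis unfolding shock_cost_def case_prod_beta
    by (intro continuous_intros)
qed

lemma shock_cost_le:
  assumes "s \<in> {0..sbar}" "w \<in> {0..B}" "0 \<le> u" "u \<le> min s w"
  shows "shock_cost s w \<le> g (w - u) + f (s - u)"
  using unmet_min[of s w "w - u"] assms by (auto simp: shock_cost_def algebra_simps)

text \<open>Partial minimisation of a jointly convex objective over a convex set of pairs \<open>(s, y)\<close>: a mixture of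
  the optimal choices at two levels is feasible at the mixed level.\<close>

lemma shock_cost_convex:
  assumes w: "w \<in> {0..B}"
  shows "convex_on {0..sbar} (\<lambda>s. shock_cost s w)"
  unfolding convex_on_def
proof (intro conjI ballI allI impI)
  fix x y u v :: real
  assume x: "x \<in> {0..sbar}" and y: "y \<in> {0..sbar}" and uv: "0 \<le> u" "0 \<le> v" "u + v = 1"
  define m where "m = u * unmet x w + v * unmet y w"
  note feas = unmet_feasible[OF x w] unmet_feasible[OF y w]
  have conv: "u * x + v * y \<in> {0..sbar}"
    using convex_real_interval(5)[of 0 sbar] x y uv unfolding convex_def by auto
  have w_eq: "w = u * w + v * w" using uv by (simp flip: distrib_right)
  have "m \<le> u * w + v * w" unfolding m_def using feas uv by (intro add_mono mult_left_mono) auto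
  then have mw: "m \<le> w" using w_eq by simp
  have "u * (w - x) + v * (w - y) \<le> m" unfolding m_def using feas uv by (intro add_mono mult_left_mono) auto
  then have mwx: "w - (u * x + v * y) \<le> m" using w_eq by (simp add: algebra_simps)
  have m0: "0 \<le> m" unfolding m_def using feas uv by auto
  have "shock_cost (u * x + v * y) w \<le> g m + f (m + ((u * x + v * y) - w))"
    unfolding shock_cost_def using conv w m0 mwx mw by (rule unmet_min)
  also have "m + ((u * x + v * y) - w) = u * (unmet x w + (x - w)) + v * (unmet y w + (y - w))"
    using w_eq by (simp add: m_def algebra_simps)
  also have "f \<dots> \<le> u * f (unmet x w + (x - w)) + v * f (unmet y w + (y - w))"
    using f_convex feas x y w uv unfolding convex_on_def by auto
  also have "g m \<le> u * g (unmet x w) + v * g (unmet y w)"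
    using strictly_convex_on_imp_convex_on[OF g_convex] feas w uv
    unfolding convex_on_def m_def by auto
  finally show "shock_cost (u *\<^sub>R x + v *\<^sub>R y) w \<le> u * shock_cost x w + v * shock_cost y w"
    by (simp add: shock_cost_def algebra_simps)
qed simp

text \<open>Keeping the unmet demand of the lower level remains feasible at the higher one and leaves
  more in storage.\<close>

lemma shock_cost_antimono:
  assumes f: "antimono_on {0..sbar} f"
    and "w \<in> {0..B}" "x \<in> {0..sbar}" "y \<in> {0..sbar}" "x \<le> y"
  shows "shock_cost y w \<le> shock_cost x w"
proof -
  note feas = unmet_feasible[of x w]
  have anti: "f v \<le> f u" if "u \<in> {0..sbar}" "v \<in> {0..sbar}" "u \<le> v" for u v
    using f that by (auto simp: monotone_on_def)
  have "shock_cost y w \<le> g (unmet x w) + f (unmet x w + (y - w))"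
    unfolding shock_cost_def using assms feas by (intro unmet_min) auto
  also have "f (unmet x w + (y - w)) \<le> f (unmet x w + (x - w))"
    using assms feas by (intro anti) auto
  finally show ?thesis by (simp add: shock_cost_def)
qed

text \<open>If the minimal shock cost has no convexity gap between two levels, then both levels leave
  the same demand unmet (strict convexity of the stage cost), and the continuation cost is affine
  between the two levels that remain.\<close>
text \<open>Equality in the midpoint inequality propagates in two ways. Strict convexity of the stage cost forces
  the same unmet demand at both levels, and then all the slack must vanish in the continuation cost,
  which becomes affine between the two levels that remain.\<close>

lemma shock_cost_midpoint_eqD:
  assumes w: "w \<in> {0..B}" and a: "a \<in> {0..sbar}" and b: "b \<in> {0..sbar}"
    and eq: "2 * shock_cost ((a + b) / 2) w \<ge> shock_cost a w + shock_cost b w"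
  shows "unmet a w = unmet b w"
    and "shock_cost b w - shock_cost a w = f (unmet a w + (b - w)) - f (unmet a w + (a - w))"
    and "f (unmet a w + ((a + b) / 2 - w)) = (f (unmet a w + (a - w)) + f (unmet a w + (b - w))) / 2"
proof -
  note feas = unmet_feasible[OF a w] unmet_feasible[OF b w]
  define m where "m = (1/2) * unmet a w + (1/2) * unmet b w"
  have mid: "(a + b) / 2 \<in> {0..sbar}" using a b by auto
  have le: "shock_cost ((a + b) / 2) w \<le> g m + f (m + ((a + b) / 2 - w))"
    unfolding shock_cost_def using feas w mid by (intro unmet_min) (auto simp: m_def field_simps)
  have arg: "m + ((a + b) / 2 - w) = (1/2) * (unmet a w + (a - w)) + (1/2) * (unmet b w + (b - w))"
    by (simp add: m_def field_simps)
  show u: "unmet a w = unmet b w"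
  proof (rule ccontr)
    assume "unmet a w \<noteq> unmet b w"
    then have "g m + f (m + ((a + b) / 2 - w)) < (1/2) * shock_cost a w + (1/2) * shock_cost b w"
      unfolding arg unfolding m_def shock_cost_def using feas a b w by (intro objective_strict) auto
    then show False using le eq by simp
  qed
  then show "shock_cost b w - shock_cost a w = f (unmet a w + (b - w)) - f (unmet a w + (a - w))"
    by (simp add: shock_cost_def)
  have m: "m = unmet a w" using u by (simp add: m_def)
  have "f ((1/2) * (unmet a w + (a - w)) + (1/2) * (unmet b w + (b - w)))
      \<le> (1/2) * f (unmet a w + (a - w)) + (1/2) * f (unmet b w + (b - w))"
    using convex_onD[OF f_convex, of "1/2" "unmet a w + (a - w)" "unmet b w + (b - w)"] feas a b w
    by simp
  then show "f (unmet a w + ((a + b) / 2 - w)) = (f (unmet a w + (a - w)) + f (unmet a w + (b - w))) / 2"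
    using le eq u unfolding arg[symmetric] m by (simp add: shock_cost_def)
qed

end

lemma shock_cost_close:
  assumes 1: "kernel_problem sbar B g f" and 2: "kernel_problem sbar B g h"
    and d: "\<And>x. x \<in> {0..sbar} \<Longrightarrow> \<bar>f x - h x\<bar> \<le> d"
    and s: "s \<in> {0..sbar}" and w: "w \<in> {0..B}"
  shows "\<bar>kernel_problem.shock_cost sbar B g f s w - kernel_problem.shock_cost sbar B g h s w\<bar> \<le> d"
proof -
  have *: "kernel_problem.shock_cost sbar B g f s w \<le> kernel_problem.shock_cost sbar B g h s w + d"
    if f: "kernel_problem sbar B g f" and h: "kernel_problem sbar B g h"
      and d: "\<And>x. x \<in> {0..sbar} \<Longrightarrow> f x \<le> h x + d" for f h
  proof -
    interpret f: kernel_problem sbar B g f by fact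
    interpret h: kernel_problem sbar B g h by fact
    note feas = h.unmet_feasible[OF s w]
    have "f.shock_cost s w \<le> g (h.unmet s w) + f (h.unmet s w + (s - w))"
      unfolding f.shock_cost_def using s w feas by (intro f.unmet_min) auto
    also have "f (h.unmet s w + (s - w)) \<le> h (h.unmet s w + (s - w)) + d"
      using s w feas by (intro d) auto
    finally show ?thesis by (simp add: h.shock_cost_def)
  qed
  have "f x \<le> h x + d" "h x \<le> f x + d" if "x \<in> {0..sbar}" for x using d[OF that] by auto
  then show ?thesis using *[OF 1 2] *[OF 2 1] by fastforce
qed

section \<open>Discounted expectation over one period\<close>

text \<open>Policies and costs are constrained only on the rectangle of admissible levels and shocks. Composing
  with this projection turns them into functions that are measurable on the whole plane, without
  changing them where they are used.\<close>

definition clip :: "real \<Rightarrow> real \<Rightarrow> real" where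
  "clip b x = max 0 (min b x)"

lemma clip_in [simp]: "0 \<le> b \<Longrightarrow> clip b x \<in> {0..b}"
  by (auto simp: clip_def)

lemma clip_id [simp]: "x \<in> {0..b} \<Longrightarrow> clip b x = x"
  by (auto simp: clip_def)

lemma clip_cont [continuous_intros]: "continuous_on S f \<Longrightarrow> continuous_on S (\<lambda>x. clip b (f x))"
  unfolding clip_def by (intro continuous_intros)

lemma clip_measurable [measurable (raw)]:
  "f \<in> borel_measurable M \<Longrightarrow> (\<lambda>x. clip b (f x)) \<in> borel_measurable M"
  unfolding clip_def by (intro borel_measurable_max borel_measurable_min borel_measurable_const)

locale storage_problem =
  fixes r Q \<theta> sbar B :: real and g :: "real \<Rightarrow> real" and F :: "real measure"
  assumes r: "0 < r" and Q: "0 < Q" and \<theta>: "0 < \<theta>" and sbar: "0 < sbar" and B: "0 < B"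
    and g_cont: "continuous_on {0..B} g"
    and g_mono: "strict_mono_on {0..B} g"
    and g_zero: "g 0 = 0"
    and g_convex: "strictly_convex_on {0..B} g"
    and prob_F: "prob_space F" and sets_F [measurable_cong]: "sets F = sets borel"
    and F_support: "AE w in F. w \<in> {0..B}"
begin

definition interarrival_law :: "real measure" where
  "interarrival_law = density lborel (exponential_density Q)"

definition period_law :: "(real \<times> real) measure" where
  "period_law = interarrival_law \<Otimes>\<^sub>M F"

definition next_level :: "real \<Rightarrow> real \<Rightarrow> real" where
  "next_level s \<tau> = clip sbar (s + r * \<tau>)"

text \<open>The expected discounted value of a quantity \<open>k\<close> of the level and the shock met at the next arrival,
  seen from the present level \<open>s\<close>. Evaluating a policy and minimising over policies are both of this
  form, so monotonicity, contraction and continuity need to be proved only once.\<close>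

definition expect :: "(real \<Rightarrow> real \<Rightarrow> real) \<Rightarrow> real \<Rightarrow> real" where
  "expect k s = (\<integral>z. exp (- \<theta> * fst z) * k (next_level s (fst z)) (clip B (snd z)) \<partial>period_law)"

definition \<beta> :: real where
  "\<beta> = Q / (Q + \<theta>)"

lemma \<beta>: "0 < \<beta>" "\<beta> < 1"
  using Q \<theta> by (auto simp: \<beta>_def)

lemma sets_E [measurable_cong]: "sets interarrival_law = sets borel"
  by (simp add: interarrival_law_def)

lemma prob_E: "prob_space interarrival_law"
  unfolding interarrival_law_def by (rule prob_space_exponential_density[OF Q])

interpretation E: prob_space interarrival_law by (rule prob_E)
interpretation F: prob_space F by (rule prob_F)
interpretation EF: pair_sigma_finite interarrival_law F ..
interpretation N: prob_space period_law unfolding period_law_def by (intro prob_space_pair prob_E prob_F)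

lemma sets_N [measurable_cong]: "sets period_law = sets (borel \<Otimes>\<^sub>M borel)"
  unfolding period_law_def by (intro sets_pair_measure_cong sets_E sets_F)

lemma E_pos: "AE \<tau> in interarrival_law. 0 < \<tau>"
proof -
  have "AE \<tau> in lborel. \<tau> \<noteq> (0::real)" by (rule AE_lborel_singleton)
  then have "AE \<tau> in lborel. 0 < ennreal (exponential_density Q \<tau>) \<longrightarrow> 0 < \<tau>"
    by eventually_elim (auto simp: exponential_density_def)
  then show ?thesis unfolding interarrival_law_def by (subst AE_density) auto
qed

lemma N_pos: "AE z in period_law. 0 < fst z"
  unfolding period_law_def
proof (rule EF.AE_pair_measure)
  show "{x \<in> space (interarrival_law \<Otimes>\<^sub>M F). 0 < fst x} \<in> sets (interarrival_law \<Otimes>\<^sub>M F)" by measurable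
  show "AE x in interarrival_law. AE y in F. 0 < fst (x, y)" using E_pos by auto
qed

lemma N_support: "AE z in period_law. snd z \<in> {0..B}"
  unfolding period_law_def
proof (rule EF.AE_pair_measure)
  show "{x \<in> space (interarrival_law \<Otimes>\<^sub>M F). snd x \<in> {0..B}} \<in> sets (interarrival_law \<Otimes>\<^sub>M F)" by measurable
  show "AE x in interarrival_law. AE y in F. snd (x, y) \<in> {0..B}" using F_support by auto
qed

lemma next_level_in [simp]: "next_level s \<tau> \<in> {0..sbar}"
  using sbar by (simp add: next_level_def del: atLeastAtMost_iff)

text \<open>The discounted exponential density is \<open>\<beta>\<close> times the exponential density of rate \<open>Q + \<theta>\<close>.\<close>

lemma discount_E: "(\<integral>\<tau>. exp (- \<theta> * \<tau>) \<partial>interarrival_law) = \<beta>"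
proof -
  have Q\<theta>: "0 < Q + \<theta>" using Q \<theta> by simp
  interpret E': prob_space "density lborel (exponential_density (Q + \<theta>))"
    by (rule prob_space_exponential_density[OF Q\<theta>])
  have "(1::real) = (\<integral>\<tau>. 1 \<partial>density lborel (exponential_density (Q + \<theta>)))"
    using E'.prob_space by (simp del: space_density)
  also have "\<dots> = (\<integral>\<tau>. exponential_density (Q + \<theta>) \<tau> \<partial>lborel)"
    using Q\<theta> by (subst integral_density) (auto simp: exponential_density_nonneg)
  finally have 1: "(\<integral>\<tau>. exponential_density (Q + \<theta>) \<tau> \<partial>lborel) = 1" by simp
  have "(\<integral>\<tau>. exp (- \<theta> * \<tau>) \<partial>interarrival_law) = (\<integral>\<tau>. exponential_density Q \<tau> * exp (- \<theta> * \<tau>) \<partial>lborel)"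
    unfolding interarrival_law_def using Q by (subst integral_density) (auto simp: exponential_density_nonneg)
  also have "\<dots> = (\<integral>\<tau>. \<beta> * exponential_density (Q + \<theta>) \<tau> \<partial>lborel)"
  proof (rule Bochner_Integration.integral_cong)
    fix \<tau> :: real
    have "Q * (exp (- \<tau> * Q) * exp (- \<theta> * \<tau>)) = Q * exp (- \<tau> * (Q + \<theta>))"
      unfolding exp_add[symmetric] by (simp add: algebra_simps)
    then show "exponential_density Q \<tau> * exp (- \<theta> * \<tau>) = \<beta> * exponential_density (Q + \<theta>) \<tau>"
      using Q\<theta> by (auto simp: exponential_density_def \<beta>_def)
  qed simp
  finally show ?thesis using 1 by simp
qed

lemma discount_N_integrable: "integrable period_law (\<lambda>z. exp (- \<theta> * fst z))"
proof (rule N.integrable_const_bound[where B=1])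
  show "AE z in period_law. norm (exp (- \<theta> * fst z)) \<le> 1"
    using N_pos by eventually_elim (use \<theta> in auto)
qed measurable

lemma discount_N: "(\<integral>z. exp (- \<theta> * fst z) \<partial>period_law) = \<beta>"
proof -
  have "(\<integral>z. exp (- \<theta> * fst z) \<partial>period_law) = (\<integral>x. \<integral>y. exp (- \<theta> * fst (x, y)) \<partial>F \<partial>interarrival_law)"
    using discount_N_integrable unfolding period_law_def by (rule EF.integral_fst'[symmetric])
  then show ?thesis using F.prob_space discount_E by simp
qed

definition stage_fn :: "(real \<Rightarrow> real \<Rightarrow> real) \<Rightarrow> bool" where
  "stage_fn k \<longleftrightarrow> (\<lambda>z. k (clip sbar (fst z)) (clip B (snd z))) \<in> borel_measurable (borel \<Otimes>\<^sub>M borel) \<and>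
    (\<exists>K. \<forall>x\<in>{0..sbar}. \<forall>w\<in>{0..B}. \<bar>k x w\<bar> \<le> K)"

lemma stage_fn_measurable2:
  assumes "stage_fn k"
  shows "(\<lambda>x. k (next_level (fst x) (fst (snd x))) (clip B (snd (snd x)))) \<in> borel_measurable (borel \<Otimes>\<^sub>M (borel \<Otimes>\<^sub>M borel))"
proof -
  have "(\<lambda>z. k (clip sbar (fst z)) (clip B (snd z))) \<in> borel_measurable (borel \<Otimes>\<^sub>M borel)"
    using assms by (simp add: stage_fn_def)
  from measurable_compose[OF _ this, of "\<lambda>x. (fst x + r * fst (snd x), snd (snd x))" "borel \<Otimes>\<^sub>M (borel \<Otimes>\<^sub>M borel)"]
  show ?thesis unfolding next_level_def by simp
qed

lemma stage_fn_measurable: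
  assumes "stage_fn k"
  shows "(\<lambda>z. k (next_level s (fst z)) (clip B (snd z))) \<in> borel_measurable period_law"
  using measurable_compose[OF _ stage_fn_measurable2[OF assms], of "\<lambda>z. (s, z)" period_law] by simp

lemma expect_integrable:
  assumes k: "stage_fn k"
  shows "integrable period_law (\<lambda>z. exp (- \<theta> * fst z) * k (next_level s (fst z)) (clip B (snd z)))"
proof -
  obtain K where K: "\<And>x w. x \<in> {0..sbar} \<Longrightarrow> w \<in> {0..B} \<Longrightarrow> \<bar>k x w\<bar> \<le> K"
    using k unfolding stage_fn_def by blast
  note [measurable] = stage_fn_measurable[OF k]
  show ?thesis
  proof (rule N.integrable_const_bound[where B="1 * K"])
    show "AE z in period_law. norm (exp (- \<theta> * fst z) * k (next_level s (fst z)) (clip B (snd z))) \<le> 1 * K"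
      using N_pos
    proof eventually_elim
      case (elim z)
      have "\<bar>exp (- \<theta> * fst z)\<bar> * \<bar>k (next_level s (fst z)) (clip B (snd z))\<bar> \<le> 1 * K"
        using elim \<theta> B by (intro mult_mono K next_level_in clip_in) auto
      then show ?case by (simp add: abs_mult)
    qed
  qed measurable
qed

text \<open>The combined form of monotonicity and discounting: with \<open>d = 0\<close> it is monotonicity, and used
  in both directions it is the contraction estimate.\<close>

lemma expect_le:
  assumes k: "stage_fn k" and h: "stage_fn h"
    and le: "\<And>x w. x \<in> {0..sbar} \<Longrightarrow> w \<in> {0..B} \<Longrightarrow> k x w \<le> h x w + d"
  shows "expect k s \<le> expect h s + \<beta> * d"
proof -
  have "expect k s \<le> (\<integral>z. exp (- \<theta> * fst z) * h (next_level s (fst z)) (clip B (snd z)) + exp (- \<theta> * fst z) * d \<partial>period_law)"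
    unfolding expect_def
  proof (rule integral_mono)
    show "integrable period_law (\<lambda>z. exp (- \<theta> * fst z) * k (next_level s (fst z)) (clip B (snd z)))"
      by (rule expect_integrable[OF k])
    show "integrable period_law (\<lambda>z. exp (- \<theta> * fst z) * h (next_level s (fst z)) (clip B (snd z)) + exp (- \<theta> * fst z) * d)"
      by (intro Bochner_Integration.integrable_add expect_integrable[OF h]
        integrable_mult_left discount_N_integrable)
    fix z
    show "exp (- \<theta> * fst z) * k (next_level s (fst z)) (clip B (snd z))
      \<le> exp (- \<theta> * fst z) * h (next_level s (fst z)) (clip B (snd z)) + exp (- \<theta> * fst z) * d"
      unfolding distrib_left[symmetric] using B
      by (intro mult_left_mono le next_level_in clip_in) auto
  qed
  also have "\<dots> = expect h s + \<beta> * d"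
    unfolding expect_def
    by (subst Bochner_Integration.integral_add[OF expect_integrable[OF h]
          integrable_mult_left[OF discount_N_integrable]]) (simp add: discount_N[simplified])
  finally show ?thesis .
qed

lemma expect_mono:
  assumes "stage_fn k" "stage_fn h" "\<And>x w. x \<in> {0..sbar} \<Longrightarrow> w \<in> {0..B} \<Longrightarrow> k x w \<le> h x w"
  shows "expect k s \<le> expect h s"
  using expect_le[of k h 0] assms by simp

lemma expect_close:
  assumes k: "stage_fn k" and h: "stage_fn h"
    and close: "\<And>x w. x \<in> {0..sbar} \<Longrightarrow> w \<in> {0..B} \<Longrightarrow> \<bar>k x w - h x w\<bar> \<le> d"
  shows "\<bar>expect k s - expect h s\<bar> \<le> \<beta> * d"
proof -
  have "expect k s \<le> expect h s + \<beta> * d"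
    by (rule expect_le[OF k h]) (use close in \<open>fastforce simp: abs_le_iff\<close>)
  moreover have "expect h s \<le> expect k s + \<beta> * d"
    by (rule expect_le[OF h k]) (use close in \<open>fastforce simp: abs_le_iff\<close>)
  ultimately show ?thesis by linarith
qed

lemma expect_cong:
  assumes "\<And>x w. x \<in> {0..sbar} \<Longrightarrow> w \<in> {0..B} \<Longrightarrow> k x w = h x w"
  shows "expect k s = expect h s"
proof -
  have "k (next_level s (fst z)) (clip B (snd z)) = h (next_level s (fst z)) (clip B (snd z))" for z
    using B by (intro assms next_level_in clip_in) auto
  then show ?thesis by (simp add: expect_def)
qed

lemma stage_fn_const: "stage_fn (\<lambda>_ _. c)"
  by (auto simp: stage_fn_def)

lemma expect_0 [simp]: "expect (\<lambda>_ _. 0) s = 0"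
  by (simp add: expect_def)

lemma expect_eq_AE:
  assumes k: "stage_fn k" and h: "stage_fn h"
    and le: "\<And>x w. x \<in> {0..sbar} \<Longrightarrow> w \<in> {0..B} \<Longrightarrow> h x w \<le> k x w"
    and eq: "expect k s = expect h s"
  shows "AE z in period_law. k (next_level s (fst z)) (clip B (snd z)) = h (next_level s (fst z)) (clip B (snd z))"
proof -
  let ?d = "\<lambda>z. exp (- \<theta> * fst z) * k (next_level s (fst z)) (clip B (snd z)) -
    exp (- \<theta> * fst z) * h (next_level s (fst z)) (clip B (snd z))"
  have le': "h (next_level s (fst z)) (clip B (snd z)) \<le> k (next_level s (fst z)) (clip B (snd z))" for z
    using B by (intro le next_level_in clip_in) auto
  have "integrable period_law ?d"
    by (intro Bochner_Integration.integrable_diff expect_integrable k h)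
  moreover have "integral\<^sup>L period_law ?d = 0"
    using eq unfolding expect_def
    by (subst Bochner_Integration.integral_diff) (auto intro: expect_integrable[OF k, simplified] expect_integrable[OF h, simplified])
  ultimately have "AE z in period_law. ?d z = 0"
    by (subst (asm) integral_nonneg_eq_0_iff_AE) (auto intro!: AE_I2 mult_left_mono le')
  then show ?thesis by simp
qed

lemma expect_tendsto:
  assumes k: "\<And>n. stage_fn (k n)"
    and K: "\<And>n x w. x \<in> {0..sbar} \<Longrightarrow> w \<in> {0..B} \<Longrightarrow> \<bar>k n x w\<bar> \<le> K"
    and lim: "\<And>x w. x \<in> {0..sbar} \<Longrightarrow> w \<in> {0..B} \<Longrightarrow> (\<lambda>n. k n x w) \<longlonglongrightarrow> h x w"
  shows "stage_fn h" and "(\<lambda>n. expect (k n) s) \<longlonglongrightarrow> expect h s"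
proof -
  have "(\<lambda>z. h (clip sbar (fst z)) (clip B (snd z))) \<in> borel_measurable (borel \<Otimes>\<^sub>M borel)"
  proof (rule borel_measurable_LIMSEQ_real)
    fix z :: "real \<times> real"
    show "(\<lambda>n. k n (clip sbar (fst z)) (clip B (snd z))) \<longlonglongrightarrow> h (clip sbar (fst z)) (clip B (snd z))"
      using sbar B by (intro lim clip_in) auto
  qed (use k in \<open>simp add: stage_fn_def\<close>)
  moreover have "\<bar>h x w\<bar> \<le> K" if "x \<in> {0..sbar}" "w \<in> {0..B}" for x w
    by (rule LIMSEQ_le_const2[OF tendsto_rabs[OF lim[OF that]]]) (use K that in blast)
  ultimately show h: "stage_fn h" unfolding stage_fn_def by blast
  show "(\<lambda>n. expect (k n) s) \<longlonglongrightarrow> expect h s"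
    unfolding expect_def
  proof (rule integral_dominated_convergence[where w="\<lambda>_. 1 * K"])
    show "AE z in period_law. (\<lambda>n. exp (- \<theta> * fst z) * k n (next_level s (fst z)) (clip B (snd z)))
        \<longlonglongrightarrow> exp (- \<theta> * fst z) * h (next_level s (fst z)) (clip B (snd z))"
      using B by (intro AE_I2 tendsto_mult_left lim next_level_in clip_in) auto
    show "AE z in period_law. norm (exp (- \<theta> * fst z) * k n (next_level s (fst z)) (clip B (snd z))) \<le> 1 * K" for n
      using N_pos
    proof eventually_elim
      case (elim z)
      have "\<bar>exp (- \<theta> * fst z)\<bar> * \<bar>k n (next_level s (fst z)) (clip B (snd z))\<bar> \<le> 1 * K"
        using elim \<theta> B by (intro mult_mono K next_level_in clip_in) auto
      then show ?case by (simp add: abs_mult)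
    qed
  qed (use expect_integrable[OF h] expect_integrable[OF k] in \<open>simp_all add: borel_measurable_integrable\<close>)
qed

lemma expect_measurable:
  assumes k: "stage_fn k"
  shows "expect k \<in> borel_measurable borel"
  unfolding expect_def
proof (rule N.borel_measurable_lebesgue_integral)
  have "sets (borel \<Otimes>\<^sub>M period_law) = sets (borel \<Otimes>\<^sub>M (borel \<Otimes>\<^sub>M borel) :: (real \<times> real \<times> real) measure)"
    by (intro sets_pair_measure_cong sets_N refl)
  note [measurable_cong] = this and [measurable] = stage_fn_measurable2[OF k]
  show "(\<lambda>(s, z). exp (- \<theta> * fst z) * k (next_level s (fst z)) (clip B (snd z))) \<in> borel_measurable (borel \<Otimes>\<^sub>M period_law)"
    unfolding case_prod_beta by measurable
qed

lemma stage_fn_cont: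
  assumes k: "continuous_on ({0..sbar} \<times> {0..B}) (\<lambda>(x, w). k x w)"
  shows "stage_fn k"
proof -
  have 1: "continuous_on UNIV (\<lambda>z. (clip sbar (fst z), clip B (snd z)))"
    by (intro continuous_intros)
  have "continuous_on UNIV (\<lambda>z. (\<lambda>(x, w). k x w) (clip sbar (fst z), clip B (snd z)))"
    by (rule continuous_on_compose2[OF k 1]) (use sbar B clip_in in auto)
  then have "(\<lambda>z. k (clip sbar (fst z)) (clip B (snd z))) \<in> borel_measurable (borel \<Otimes>\<^sub>M borel)"
    unfolding borel_prod by (intro borel_measurable_continuous_onI) simp
  moreover have "compact ((\<lambda>(x, w). k x w) ` ({0..sbar} \<times> {0..B}))"
    by (intro compact_continuous_image[OF k] compact_Times) auto
  then obtain K where "\<forall>y\<in>(\<lambda>(x, w). k x w) ` ({0..sbar} \<times> {0..B}). norm y \<le> K"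
    using compact_imp_bounded bounded_iff by metis
  then have "\<forall>x\<in>{0..sbar}. \<forall>w\<in>{0..B}. \<bar>k x w\<bar> \<le> K" by auto
  ultimately show ?thesis unfolding stage_fn_def by blast
qed

lemma expect_bounded:
  assumes "stage_fn k" "\<And>x w. x \<in> {0..sbar} \<Longrightarrow> w \<in> {0..B} \<Longrightarrow> \<bar>k x w\<bar> \<le> K"
  shows "\<bar>expect k s\<bar> \<le> \<beta> * K"
  using expect_close[OF assms(1) stage_fn_const[of 0], of K s] assms(2) by simp

lemma expect_cont:
  assumes k: "continuous_on ({0..sbar} \<times> {0..B}) (\<lambda>(x, w). k x w)"
  shows "continuous_on UNIV (expect k)"
proof (rule continuous_on_sequentiallyI)
  note st = stage_fn_cont[OF k]
  then obtain K where K: "\<And>x w. x \<in> {0..sbar} \<Longrightarrow> w \<in> {0..B} \<Longrightarrow> \<bar>k x w\<bar> \<le> K"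
    unfolding stage_fn_def by blast
  fix u :: "nat \<Rightarrow> real" and a assume u: "u \<longlonglongrightarrow> a"
  show "(\<lambda>n. expect k (u n)) \<longlonglongrightarrow> expect k a"
    unfolding expect_def
  proof (rule integral_dominated_convergence[where w="\<lambda>_. 1 * K"])
    have "(\<lambda>n. k (next_level (u n) (fst z)) (clip B (snd z))) \<longlonglongrightarrow> k (next_level a (fst z)) (clip B (snd z))" for z :: "real \<times> real"
    proof -
      have "continuous_on UNIV (\<lambda>s. (next_level s (fst z), clip B (snd z)))"
        unfolding next_level_def by (intro continuous_intros)
      then have "continuous_on UNIV (\<lambda>s. (\<lambda>(x, w). k x w) (next_level s (fst z), clip B (snd z)))"
        by (rule continuous_on_compose2[OF k]) (use B clip_in next_level_in in \<open>auto simp del: atLeastAtMost_iff\<close>)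
      from continuous_on_tendsto_compose[OF this u] show ?thesis by simp
    qed
    then show "AE z in period_law. (\<lambda>n. exp (- \<theta> * fst z) * k (next_level (u n) (fst z)) (clip B (snd z)))
        \<longlonglongrightarrow> exp (- \<theta> * fst z) * k (next_level a (fst z)) (clip B (snd z))"
      by (intro AE_I2 tendsto_mult_left)
    show "AE z in period_law. norm (exp (- \<theta> * fst z) * k (next_level (u n) (fst z)) (clip B (snd z))) \<le> 1 * K" for n
      using N_pos
    proof eventually_elim
      case (elim z)
      have "\<bar>exp (- \<theta> * fst z)\<bar> * \<bar>k (next_level (u n) (fst z)) (clip B (snd z))\<bar> \<le> 1 * K"
        using elim \<theta> B by (intro mult_mono K next_level_in clip_in) auto
      then show ?case by (simp add: abs_mult)
    qed
  qed (use expect_integrable[OF st] in \<open>simp_all add: borel_measurable_integrable\<close>)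
qed

text \<open>Refilling is linear up to the capacity, where it is truncated from above.\<close>

lemma next_level_concave:
  assumes "x \<in> {0..sbar}" "y \<in> {0..sbar}" "0 \<le> u" "0 \<le> v" "u + v = 1" "0 \<le> \<tau>"
  shows "u * next_level x \<tau> + v * next_level y \<tau> \<le> next_level (u * x + v * y) \<tau>"
proof -
  have eq: "next_level z \<tau> = min sbar (z + r * \<tau>)" if "0 \<le> z" for z
    using that assms r sbar by (simp add: next_level_def clip_def)
  have "u * min sbar (x + r * \<tau>) + v * min sbar (y + r * \<tau>) \<le> u * sbar + v * sbar"
    using assms by (intro add_mono mult_left_mono) auto
  moreover have "u * sbar + v * sbar = sbar" using assms by (simp flip: distrib_right)
  moreover have "u * min sbar (x + r * \<tau>) + v * min sbar (y + r * \<tau>) \<le> u * (x + r * \<tau>) + v * (y + r * \<tau>)"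
    using assms by (intro add_mono mult_left_mono) auto
  moreover have "u * (x + r * \<tau>) + v * (y + r * \<tau>) = u * x + v * y + r * \<tau> * (u + v)" by (simp add: algebra_simps)
  ultimately show ?thesis using assms by (simp add: eq)
qed

text \<open>A nonincreasing convex function of a concave function is convex. This is why monotonicity has to be
  carried along with convexity through value iteration.\<close>

lemma expect_convex:
  assumes k: "stage_fn k"
    and conv: "\<And>w. w \<in> {0..B} \<Longrightarrow> convex_on {0..sbar} (\<lambda>x. k x w)"
    and anti: "\<And>w. w \<in> {0..B} \<Longrightarrow> antimono_on {0..sbar} (\<lambda>x. k x w)"
  shows "convex_on {0..sbar} (expect k)"
  unfolding convex_on_def
proof (intro conjI ballI allI impI)
  fix x y u v :: real
  assume x: "x \<in> {0..sbar}" and y: "y \<in> {0..sbar}" and uv: "0 \<le> u" "0 \<le> v" "u + v = 1"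
  let ?f = "\<lambda>s z. exp (- \<theta> * fst z) * k (next_level s (fst z)) (clip B (snd z))"
  note int = expect_integrable[OF k]
  have "expect k (u * x + v * y) \<le> (\<integral>z. u * ?f x z + v * ?f y z \<partial>period_law)"
    unfolding expect_def
  proof (rule integral_mono_AE)
    show "AE z in period_law. ?f (u * x + v * y) z \<le> u * ?f x z + v * ?f y z"
      using N_pos
    proof eventually_elim
      case (elim z)
      define w where "w = clip B (snd z)"
      have w: "w \<in> {0..B}" using B by (simp add: w_def del: atLeastAtMost_iff)
      let ?x = "next_level x (fst z)" and ?y = "next_level y (fst z)"
      have mix: "u * ?x + v * ?y \<in> {0..sbar}"
        using convex_real_interval(5)[of 0 sbar] next_level_in[of x "fst z"] next_level_in[of y "fst z"] uv
        unfolding convex_def by (simp del: next_level_in atLeastAtMost_iff)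
      have "k (next_level (u * x + v * y) (fst z)) w \<le> k (u * ?x + v * ?y) w"
        using anti[OF w] mix next_level_in[of "u * x + v * y" "fst z"] next_level_concave[OF x y uv, of "fst z"] elim
        by (auto simp: monotone_on_def)
      also have "\<dots> \<le> u * k ?x w + v * k ?y w"
        using conv[OF w] uv next_level_in[of x "fst z"] next_level_in[of y "fst z"]
        unfolding convex_on_def by (simp del: next_level_in atLeastAtMost_iff)
      finally have "exp (- \<theta> * fst z) * k (next_level (u * x + v * y) (fst z)) w
          \<le> exp (- \<theta> * fst z) * (u * k ?x w + v * k ?y w)"
        by (intro mult_left_mono) auto
      then show ?case unfolding w_def by (simp add: algebra_simps)
    qed
  qed (intro int Bochner_Integration.integrable_add integrable_mult_right)+
  also have "\<dots> = u * expect k x + v * expect k y"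
    unfolding expect_def
    by (subst Bochner_Integration.integral_add) (auto intro!: integrable_mult_right int[simplified])
  finally show "expect k (u *\<^sub>R x + v *\<^sub>R y) \<le> u * expect k x + v * expect k y" by simp
qed simp

lemma expect_antimono:
  assumes k: "stage_fn k" and anti: "\<And>w. w \<in> {0..B} \<Longrightarrow> antimono_on {0..sbar} (\<lambda>x. k x w)"
  shows "antimono_on S (expect k)"
proof (rule monotone_onI)
  fix x y :: real assume "x \<le> y"
  show "expect k y \<le> expect k x"
    unfolding expect_def
  proof (rule integral_mono)
    fix z :: "real \<times> real"
    have "next_level x (fst z) \<le> next_level y (fst z)" using \<open>x \<le> y\<close> by (auto simp: next_level_def clip_def)
    moreover have "clip B (snd z) \<in> {0..B}" using B by (simp del: atLeastAtMost_iff)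
    ultimately have "k (next_level y (fst z)) (clip B (snd z)) \<le> k (next_level x (fst z)) (clip B (snd z))"
      using anti next_level_in[of x "fst z"] next_level_in[of y "fst z"] unfolding monotone_on_def by blast
    then show "exp (- \<theta> * fst z) * k (next_level y (fst z)) (clip B (snd z))
      \<le> exp (- \<theta> * fst z) * k (next_level x (fst z)) (clip B (snd z))"
      by (intro mult_left_mono) auto
  qed (rule expect_integrable[OF k])+
qed

end

section \<open>Policy evaluation and the Bellman equation\<close>

context storage_problem
begin

lemma g_range:
  assumes "x \<in> {0..B}"
  shows "0 \<le> g x" "g x \<le> g B"
  using strict_mono_on_leD[OF g_mono, of 0 x] strict_mono_on_leD[OF g_mono, of x B] assms g_zero by auto

lemma g_measurable: "(\<lambda>x. g (clip B x)) \<in> borel_measurable borel"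
proof (rule borel_measurable_continuous_onI)
  show "continuous_on UNIV (\<lambda>x. g (clip B x))"
    by (rule continuous_on_compose2[OF g_cont]) (use B clip_in in \<open>auto intro!: continuous_intros\<close>)
qed

lemma policy_bounds:
  assumes "\<mu> \<in> policies sbar B" "x \<in> {0..sbar}" "w \<in> {0..B}"
  shows "0 \<le> \<mu> x w" "\<mu> x w \<le> x" "\<mu> x w \<le> w"
  using assms unfolding policies_def by force+

lemma policy_measurable:
  assumes "\<mu> \<in> policies sbar B"
  shows "(\<lambda>z. \<mu> (clip sbar (fst z)) (clip B (snd z))) \<in> borel_measurable (borel \<Otimes>\<^sub>M borel)"
proof -
  have "(\<lambda>z. (clip sbar (fst z), clip B (snd z))) \<in> borel_measurable (borel \<Otimes>\<^sub>M borel)"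
    unfolding borel_prod[symmetric] by measurable
  then have "(\<lambda>z. (clip sbar (fst z), clip B (snd z)))
      \<in> measurable (borel \<Otimes>\<^sub>M borel) (restrict_space borel ({0..sbar} \<times> {0..B}))"
    using sbar B by (intro measurable_restrict_space2) (auto simp del: atLeastAtMost_iff)
  from measurable_compose[OF this, of "case_prod \<mu>" borel] show ?thesis
    using assms by (simp add: policies_def)
qed

definition level_fn :: "(real \<Rightarrow> real) \<Rightarrow> bool" where
  "level_fn V \<longleftrightarrow> (\<lambda>s. V (clip sbar s)) \<in> borel_measurable borel \<and> (\<exists>K. \<forall>x\<in>{0..sbar}. \<bar>V x\<bar> \<le> K)"

definition play :: "(real \<Rightarrow> real \<Rightarrow> real) \<Rightarrow> (real \<Rightarrow> real) \<Rightarrow> real \<Rightarrow> real \<Rightarrow> real" where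
  "play \<mu> V x w = g (w - \<mu> x w) + V (x - \<mu> x w)"

lemma stage_fn_play:
  assumes \<mu>: "\<mu> \<in> policies sbar B" and V: "level_fn V"
  shows "stage_fn (play \<mu> V)"
  unfolding stage_fn_def
proof
  let ?m = "\<lambda>z. \<mu> (clip sbar (fst z)) (clip B (snd z))"
  note [measurable] = policy_measurable[OF \<mu>]
  have V': "(\<lambda>s. V (clip sbar s)) \<in> borel_measurable borel" using V by (simp add: level_fn_def)
  have "(\<lambda>z. g (clip B (clip B (snd z) - ?m z)) + V (clip sbar (clip sbar (fst z) - ?m z)))
      \<in> borel_measurable (borel \<Otimes>\<^sub>M borel)"
    by (intro borel_measurable_add measurable_compose[OF _ g_measurable] measurable_compose[OF _ V']) measurable
  also have "(\<lambda>z. g (clip B (clip B (snd z) - ?m z)) + V (clip sbar (clip sbar (fst z) - ?m z)))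
    = (\<lambda>z. play \<mu> V (clip sbar (fst z)) (clip B (snd z)))"
  proof
    fix z :: "real \<times> real"
    have x: "clip sbar (fst z) \<in> {0..sbar}" and w: "clip B (snd z) \<in> {0..B}"
      using sbar B by (simp_all del: atLeastAtMost_iff)
    have "clip B (snd z) - ?m z \<in> {0..B}" "clip sbar (fst z) - ?m z \<in> {0..sbar}"
      using policy_bounds[OF \<mu> x w] x w by auto
    then show "g (clip B (clip B (snd z) - ?m z)) + V (clip sbar (clip sbar (fst z) - ?m z))
      = play \<mu> V (clip sbar (fst z)) (clip B (snd z))"
      by (simp only: clip_id play_def)
  qed
  finally show "(\<lambda>z. play \<mu> V (clip sbar (fst z)) (clip B (snd z))) \<in> borel_measurable (borel \<Otimes>\<^sub>M borel)" .
  obtain K where K: "\<And>x. x \<in> {0..sbar} \<Longrightarrow> \<bar>V x\<bar> \<le> K" using V unfolding level_fn_def by blast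
  have "\<bar>play \<mu> V x w\<bar> \<le> g B + K" if x: "x \<in> {0..sbar}" and w: "w \<in> {0..B}" for x w
    using policy_bounds[OF \<mu> x w] x w g_range[of "w - \<mu> x w"] K[of "x - \<mu> x w"] unfolding play_def by auto
  then show "\<exists>K. \<forall>x\<in>{0..sbar}. \<forall>w\<in>{0..B}. \<bar>play \<mu> V x w\<bar> \<le> K" by blast
qed

lemma level_fn_expect:
  assumes k: "stage_fn k"
  shows "level_fn (expect k)"
proof -
  note [measurable] = expect_measurable[OF k]
  obtain K where "\<And>x w. x \<in> {0..sbar} \<Longrightarrow> w \<in> {0..B} \<Longrightarrow> \<bar>k x w\<bar> \<le> K"
    using k unfolding stage_fn_def by blast
  from expect_bounded[OF k this] show ?thesis unfolding level_fn_def by auto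
qed

text \<open>The expected cost of the first \<open>n\<close> arrivals.\<close>

primrec finite_cost :: "(real \<Rightarrow> real \<Rightarrow> real) \<Rightarrow> nat \<Rightarrow> real \<Rightarrow> real" where
  "finite_cost \<mu> 0 = (\<lambda>_. 0)"
| "finite_cost \<mu> (Suc n) = expect (play \<mu> (finite_cost \<mu> n))"

definition policy_cost :: "(real \<Rightarrow> real \<Rightarrow> real) \<Rightarrow> real \<Rightarrow> real" where
  "policy_cost \<mu> s = lim (\<lambda>n. finite_cost \<mu> n s)"

lemma level_fn_finite_cost:
  assumes "\<mu> \<in> policies sbar B"
  shows "level_fn (finite_cost \<mu> n)"
proof (induction n)
  case 0
  show ?case by (auto simp: level_fn_def)
next
  case (Suc n)
  then show ?case using assms by (simp add: level_fn_expect stage_fn_play)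
qed

text \<open>The fixed point of \<open>K \<mapsto> \<beta> * (g B + K)\<close>, that is, the discounted cost of leaving a shock of
  size \<open>B\<close> unmet at every arrival.\<close>

definition cost_bound :: real where
  "cost_bound = g B * Q / \<theta>"

lemma cost_bound: "0 \<le> cost_bound" "\<beta> * (g B + cost_bound) = cost_bound"
proof -
  show "0 \<le> cost_bound" using g_range[of B] Q \<theta> B by (simp add: cost_bound_def)
  have "g B + cost_bound = (Q + \<theta>) * (g B / \<theta>)"
    using \<theta> by (simp add: cost_bound_def field_simps)
  then show "\<beta> * (g B + cost_bound) = cost_bound"
    using Q \<theta> by (simp add: \<beta>_def cost_bound_def)
qed

lemma finite_cost_nonneg_le:
  assumes \<mu>: "\<mu> \<in> policies sbar B"
  shows "0 \<le> finite_cost \<mu> n s \<and> finite_cost \<mu> n s \<le> cost_bound"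
proof (induction n arbitrary: s)
  case 0
  show ?case using cost_bound by simp
next
  case (Suc n)
  note st = stage_fn_play[OF \<mu> level_fn_finite_cost[OF \<mu>], of n]
  have rng: "0 \<le> play \<mu> (finite_cost \<mu> n) x w \<and> play \<mu> (finite_cost \<mu> n) x w \<le> g B + cost_bound"
    if x: "x \<in> {0..sbar}" and w: "w \<in> {0..B}" for x w
    using policy_bounds[OF \<mu> x w] w g_range[of "w - \<mu> x w"] Suc.IH[of "x - \<mu> x w"]
    by (auto simp: play_def)
  have "expect (\<lambda>_ _. 0) s \<le> expect (play \<mu> (finite_cost \<mu> n)) s"
    using rng by (intro expect_mono stage_fn_const st) auto
  moreover have "expect (play \<mu> (finite_cost \<mu> n)) s \<le> expect (\<lambda>_ _. 0) s + \<beta> * (g B + cost_bound)"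
    using rng by (intro expect_le stage_fn_const st) auto
  ultimately show ?case using cost_bound by simp
qed

lemma finite_cost_Suc_mono:
  assumes \<mu>: "\<mu> \<in> policies sbar B"
  shows "finite_cost \<mu> n s \<le> finite_cost \<mu> (Suc n) s"
proof (induction n arbitrary: s)
  case 0
  show ?case using finite_cost_nonneg_le[OF \<mu>, of "Suc 0" s] by simp
next
  case (Suc n)
  have "expect (play \<mu> (finite_cost \<mu> n)) s \<le> expect (play \<mu> (finite_cost \<mu> (Suc n))) s"
  proof (intro expect_mono stage_fn_play \<mu> level_fn_finite_cost)
    show "play \<mu> (finite_cost \<mu> n) x w \<le> play \<mu> (finite_cost \<mu> (Suc n)) x w" for x w
      unfolding play_def using Suc.IH by (rule add_left_mono)
  qed
  then show ?case by simp
qed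

lemma finite_cost_tendsto:
  assumes \<mu>: "\<mu> \<in> policies sbar B"
  shows "(\<lambda>n. finite_cost \<mu> n s) \<longlonglongrightarrow> policy_cost \<mu> s"
proof -
  have "convergent (\<lambda>n. finite_cost \<mu> n s)"
  proof (rule Bseq_mono_convergent)
    show "Bseq (\<lambda>n. finite_cost \<mu> n s)"
      by (rule BseqI'[of _ cost_bound]) (use finite_cost_nonneg_le[OF \<mu>] in \<open>simp add: abs_le_iff order_trans[of _ 0]\<close>)
    show "\<forall>m n. m \<le> n \<longrightarrow> finite_cost \<mu> m s \<le> finite_cost \<mu> n s"
      using lift_Suc_mono_le[of "\<lambda>n. finite_cost \<mu> n s"] finite_cost_Suc_mono[OF \<mu>] by blast
  qed
  then show ?thesis unfolding policy_cost_def by (simp add: convergent_LIMSEQ_iff)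
qed

lemma policy_cost_nonneg:
  assumes \<mu>: "\<mu> \<in> policies sbar B"
  shows "0 \<le> policy_cost \<mu> s"
  by (rule LIMSEQ_le_const[OF finite_cost_tendsto[OF \<mu>]]) (use finite_cost_nonneg_le[OF \<mu>] in blast)

lemma policy_cost_fixpoint:
  assumes \<mu>: "\<mu> \<in> policies sbar B"
  shows "policy_cost \<mu> s = expect (play \<mu> (policy_cost \<mu>)) s"
proof -
  note st = stage_fn_play[OF \<mu> level_fn_finite_cost[OF \<mu>]]
  have "(\<lambda>n. expect (play \<mu> (finite_cost \<mu> n)) s) \<longlonglongrightarrow> expect (play \<mu> (policy_cost \<mu>)) s"
  proof (rule expect_tendsto(2)[OF st, where K="g B + cost_bound"])
    fix n x w assume x: "x \<in> {0..sbar}" and w: "w \<in> {0..B}"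
    show "\<bar>play \<mu> (finite_cost \<mu> n) x w\<bar> \<le> g B + cost_bound"
      using policy_bounds[OF \<mu> x w] w g_range[of "w - \<mu> x w"] finite_cost_nonneg_le[OF \<mu>, of n "x - \<mu> x w"]
      by (auto simp: play_def)
    show "(\<lambda>n. play \<mu> (finite_cost \<mu> n) x w) \<longlonglongrightarrow> play \<mu> (policy_cost \<mu>) x w"
      unfolding play_def by (intro tendsto_intros finite_cost_tendsto \<mu>)
  qed
  then have "(\<lambda>n. finite_cost \<mu> (Suc n) s) \<longlonglongrightarrow> expect (play \<mu> (policy_cost \<mu>)) s" by simp
  from LIMSEQ_unique[OF LIMSEQ_Suc[OF finite_cost_tendsto[OF \<mu>]] this] show ?thesis .
qed

text \<open>Iterating the inequality \<open>n\<close> times leaves an error of at most \<open>\<beta> ^ n\<close> times a bound of \<open>V\<close>.\<close>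

lemma policy_cost_ge:
  assumes \<mu>: "\<mu> \<in> policies sbar B" and V: "level_fn V"
    and sub: "\<And>s. s \<in> {0..sbar} \<Longrightarrow> V s \<le> expect (play \<mu> V) s" and s: "s \<in> {0..sbar}"
  shows "V s \<le> policy_cost \<mu> s"
proof -
  obtain K where K: "\<And>x. x \<in> {0..sbar} \<Longrightarrow> \<bar>V x\<bar> \<le> K" using V unfolding level_fn_def by blast
  have bound: "V s \<le> finite_cost \<mu> n s + \<beta> ^ n * K" if "s \<in> {0..sbar}" for n s
    using that
  proof (induction n arbitrary: s)
    case 0
    then show ?case using K[of s] by (simp add: abs_le_iff)
  next
    case (Suc n)
    have "expect (play \<mu> V) s \<le> expect (play \<mu> (finite_cost \<mu> n)) s + \<beta> * (\<beta> ^ n * K)"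
    proof (intro expect_le stage_fn_play \<mu> V level_fn_finite_cost)
      fix x w assume x: "x \<in> {0..sbar}" and w: "w \<in> {0..B}"
      show "play \<mu> V x w \<le> play \<mu> (finite_cost \<mu> n) x w + \<beta> ^ n * K"
        using Suc.IH[of "x - \<mu> x w"] policy_bounds[OF \<mu> x w] x by (simp add: play_def)
    qed
    then show ?case using sub[OF Suc.prems] by simp
  qed
  have "(\<lambda>n. finite_cost \<mu> n s + \<beta> ^ n * K) \<longlonglongrightarrow> policy_cost \<mu> s + 0 * K"
    using \<beta> by (intro tendsto_intros finite_cost_tendsto \<mu> LIMSEQ_realpow_zero) auto
  from LIMSEQ_le_const[OF this] bound[OF s] show ?thesis by auto
qed

lemma policy_cost_le:
  assumes \<mu>: "\<mu> \<in> policies sbar B" and V: "level_fn V"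
    and super: "\<And>s. s \<in> {0..sbar} \<Longrightarrow> expect (play \<mu> V) s \<le> V s" and s: "s \<in> {0..sbar}"
  shows "policy_cost \<mu> s \<le> V s"
proof -
  obtain K where K: "\<And>x. x \<in> {0..sbar} \<Longrightarrow> \<bar>V x\<bar> \<le> K" using V unfolding level_fn_def by blast
  have bound: "finite_cost \<mu> n s \<le> V s + \<beta> ^ n * K" if "s \<in> {0..sbar}" for n s
    using that
  proof (induction n arbitrary: s)
    case 0
    then show ?case using K[of s] by (simp add: abs_le_iff)
  next
    case (Suc n)
    have "expect (play \<mu> (finite_cost \<mu> n)) s \<le> expect (play \<mu> V) s + \<beta> * (\<beta> ^ n * K)"
    proof (intro expect_le stage_fn_play \<mu> V level_fn_finite_cost)
      fix x w assume x: "x \<in> {0..sbar}" and w: "w \<in> {0..B}"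
      show "play \<mu> (finite_cost \<mu> n) x w \<le> play \<mu> V x w + \<beta> ^ n * K"
        using Suc.IH[of "x - \<mu> x w"] policy_bounds[OF \<mu> x w] x by (simp add: play_def)
    qed
    then show ?case using super[OF Suc.prems] by simp
  qed
  have "(\<lambda>n. V s + \<beta> ^ n * K) \<longlonglongrightarrow> V s + 0 * K"
    using \<beta> by (intro tendsto_intros LIMSEQ_realpow_zero) auto
  from LIMSEQ_le[OF finite_cost_tendsto[OF \<mu>] this] bound[OF s] show ?thesis by auto
qed

lemma level_fn_cont:
  assumes V: "continuous_on {0..sbar} V"
  shows "level_fn V"
proof -
  have "continuous_on UNIV (\<lambda>s. V (clip sbar s))"
    by (rule continuous_on_compose2[OF V]) (use sbar clip_in in \<open>auto intro!: continuous_intros\<close>)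
  moreover have "compact (V ` {0..sbar})" by (rule compact_continuous_image[OF V]) simp
  then obtain K where "\<forall>y\<in>V ` {0..sbar}. norm y \<le> K"
    using compact_imp_bounded bounded_iff by metis
  ultimately show ?thesis unfolding level_fn_def by (auto intro: borel_measurable_continuous_onI)
qed

abbreviation shock_cost :: "(real \<Rightarrow> real) \<Rightarrow> real \<Rightarrow> real \<Rightarrow> real" where
  "shock_cost f \<equiv> kernel_problem.shock_cost sbar B g f"

abbreviation unmet :: "(real \<Rightarrow> real) \<Rightarrow> real \<Rightarrow> real \<Rightarrow> real" where
  "unmet f \<equiv> kernel_problem.unmet sbar B g f"

lemma kernel_problem:
  assumes "continuous_on {0..sbar} f" "convex_on {0..sbar} f"
  shows "kernel_problem sbar B g f"
  using assms sbar B g_cont g_convex by unfold_locales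

lemma stage_fn_shock_cost:
  assumes "continuous_on {0..sbar} f" "convex_on {0..sbar} f"
  shows "stage_fn (shock_cost f)"
  using kernel_problem.shock_cost_cont[OF kernel_problem[OF assms]] by (intro stage_fn_cont) simp

text \<open>Bounded continuous functions form a complete metric space. Only their values on \<open>{0..sbar}\<close> matter;
  the Bellman operator depends on nothing else.\<close>

definition candidates :: "(real \<Rightarrow>\<^sub>C real) set" where
  "candidates = {f. convex_on {0..sbar} (apply_bcontfun f) \<and> antimono_on {0..sbar} (apply_bcontfun f)}"

lemma candidates_kernel_problem:
  assumes "f \<in> candidates"
  shows "kernel_problem sbar B g (apply_bcontfun f)"
  using assms by (intro kernel_problem) (auto simp: candidates_def)

text \<open>Both defining conditions are inequalities between finitely many values, so they survive limits.\<close>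

lemma complete_candidates: "Topological_Spaces.complete candidates"
proof -
  have lim: "(\<lambda>n. apply_bcontfun (f n) x) \<longlonglongrightarrow> apply_bcontfun l x" if "f \<longlonglongrightarrow> l"
    for f :: "nat \<Rightarrow> real \<Rightarrow>\<^sub>C real" and l x
    using tendsto_uniform_limitI[OF tendsto_bcontfun_uniform_limit[OF that]] by simp
  have "closed candidates"
    unfolding closed_sequential_limits
  proof (intro allI impI, elim conjE)
    fix f :: "nat \<Rightarrow> real \<Rightarrow>\<^sub>C real" and l
    assume f: "\<forall>n. f n \<in> candidates" and l: "f \<longlonglongrightarrow> l"
    have "convex_on {0..sbar} (apply_bcontfun l)"
      unfolding convex_on_def
    proof (intro conjI ballI allI impI)
      fix x y u v :: real
      assume "x \<in> {0..sbar}" "y \<in> {0..sbar}" "0 \<le> u" "0 \<le> v" "u + v = 1"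
      then have le: "apply_bcontfun (f n) (u *\<^sub>R x + v *\<^sub>R y)
          \<le> u * apply_bcontfun (f n) x + v * apply_bcontfun (f n) y" for n
        using f unfolding candidates_def convex_on_def by blast
      show "apply_bcontfun l (u *\<^sub>R x + v *\<^sub>R y) \<le> u * apply_bcontfun l x + v * apply_bcontfun l y"
        by (rule LIMSEQ_le[OF lim[OF l] tendsto_add[OF tendsto_mult_left[OF lim[OF l]] tendsto_mult_left[OF lim[OF l]]]])
          (use le in blast)
    qed simp
    moreover have "antimono_on {0..sbar} (apply_bcontfun l)"
    proof (rule monotone_onI)
      fix x y assume "x \<in> {0..sbar}" "y \<in> {0..sbar}" "x \<le> y"
      then have le: "apply_bcontfun (f n) y \<le> apply_bcontfun (f n) x" for n
        using f unfolding candidates_def monotone_on_def by blast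
      show "apply_bcontfun l y \<le> apply_bcontfun l x"
        by (rule LIMSEQ_le[OF lim[OF l] lim[OF l]]) (use le in blast)
    qed
    ultimately show "l \<in> candidates" by (simp add: candidates_def)
  qed
  then show ?thesis by (simp add: complete_eq_closed)
qed

definition bellman :: "(real \<Rightarrow>\<^sub>C real) \<Rightarrow> (real \<Rightarrow>\<^sub>C real)" where
  "bellman f = Bcontfun (expect (shock_cost (apply_bcontfun f)))"

lemma bellman_apply:
  assumes "f \<in> candidates"
  shows "apply_bcontfun (bellman f) = expect (shock_cost (apply_bcontfun f))"
proof -
  interpret f: kernel_problem sbar B g "apply_bcontfun f" by (rule candidates_kernel_problem[OF assms])
  have st: "stage_fn (shock_cost f)" by (rule stage_fn_cont[OF f.shock_cost_cont])
  obtain K where "\<And>x w. x \<in> {0..sbar} \<Longrightarrow> w \<in> {0..B} \<Longrightarrow> \<bar>shock_cost f x w\<bar> \<le> K"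
    using st unfolding stage_fn_def by blast
  from expect_bounded[OF st this]
  have "bounded (range (expect (shock_cost f)))" unfolding bounded_iff by auto
  then show ?thesis
    using expect_cont[OF f.shock_cost_cont] by (simp add: bellman_def Bcontfun_inverse bcontfun_def)
qed

lemma bellman_candidates:
  assumes f: "f \<in> candidates"
  shows "bellman f \<in> candidates"
proof -
  interpret f: kernel_problem sbar B g "apply_bcontfun f" by (rule candidates_kernel_problem[OF f])
  have st: "stage_fn (shock_cost f)" by (rule stage_fn_cont[OF f.shock_cost_cont])
  have anti: "antimono_on {0..sbar} (\<lambda>x. shock_cost f x w)" if "w \<in> {0..B}" for w
  proof (rule monotone_onI)
    show "shock_cost f y w \<le> shock_cost f x w" if "x \<in> {0..sbar}" "y \<in> {0..sbar}" "x \<le> y" for x y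
      using f \<open>w \<in> {0..B}\<close> that by (intro f.shock_cost_antimono) (simp_all add: candidates_def)
  qed
  show ?thesis
    using expect_convex[OF st f.shock_cost_convex anti] expect_antimono[OF st anti]
    by (simp add: candidates_def bellman_apply[OF f])
qed

lemma bellman_contraction:
  assumes f: "f \<in> candidates" and h: "h \<in> candidates"
  shows "dist (bellman f) (bellman h) \<le> \<beta> * dist f h"
proof (rule dist_bound)
  fix s
  have st: "stage_fn (shock_cost (apply_bcontfun f))" if "f \<in> candidates" for f
    using that by (intro stage_fn_shock_cost) (auto simp: candidates_def)
  have "\<bar>apply_bcontfun f x - apply_bcontfun h x\<bar> \<le> dist f h" for x
    using dist_bounded[of f x h] by (simp add: dist_real_def)
  then have "\<bar>shock_cost f x w - shock_cost h x w\<bar> \<le> dist f h"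
    if "x \<in> {0..sbar}" "w \<in> {0..B}" for x w
    using that by (intro shock_cost_close candidates_kernel_problem f h)
  then show "dist (apply_bcontfun (bellman f) s) (apply_bcontfun (bellman h) s) \<le> \<beta> * dist f h"
    unfolding bellman_apply[OF f] bellman_apply[OF h] dist_real_def
    by (intro expect_close st f h)
qed

lemma bellman_solution:
  obtains V where "continuous_on {0..sbar} V" "convex_on {0..sbar} V"
    "\<And>s. V s = expect (shock_cost V) s"
proof -
  have "const_bcontfun 0 \<in> candidates"
    by (auto simp: candidates_def const_bcontfun.rep_eq convex_on_def monotone_on_def)
  then have "\<exists>!V\<in>candidates. bellman V = V"
    using \<beta> bellman_candidates bellman_contraction
    by (intro Banach_fix[OF complete_candidates, of \<beta>]) auto
  then obtain V where V: "V \<in> candidates" "bellman V = V" by blast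
  show ?thesis
  proof (rule that[of "apply_bcontfun V"])
    show "apply_bcontfun V s = expect (shock_cost V) s" for s
      using bellman_apply[OF V(1)] V(2) by (metis)
  qed (use V(1) in \<open>auto simp: candidates_def\<close>)
qed

definition kernel_policy :: "(real \<Rightarrow> real) \<Rightarrow> real \<Rightarrow> real \<Rightarrow> real" where
  "kernel_policy f s w = max 0 (w - cost_kernel sbar B g f (s - w))"

context
  fixes V
  assumes V_cont: "continuous_on {0..sbar} V" and V_convex: "convex_on {0..sbar} V"
    and V_eq: "\<And>s. s \<in> {0..sbar} \<Longrightarrow> V s = expect (shock_cost V) s"
begin

interpretation V: kernel_problem sbar B g V
  using V_cont V_convex by (rule kernel_problem)

lemma kernel_policy_unmet: "kernel_policy V s w = w - unmet V s w"
  by (simp add: kernel_policy_def V.unmet_def max_def min_def)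

lemma kernel_policy_in_policies: "kernel_policy V \<in> policies sbar B"
  unfolding policies_def mem_Collect_eq
proof
  have "continuous_on ({0..sbar} \<times> {0..B}) (\<lambda>z. snd z - (\<lambda>(s, w). V.unmet s w) z)"
    by (intro continuous_intros V.unmet_cont)
  then have "continuous_on ({0..sbar} \<times> {0..B}) (case_prod (kernel_policy V))"
    by (simp add: kernel_policy_unmet case_prod_beta)
  then show "case_prod (kernel_policy V) \<in> borel_measurable (restrict_space borel ({0..sbar} \<times> {0..B}))"
    by (rule borel_measurable_continuous_on_restrict)
  show "\<forall>s\<in>{0..sbar}. \<forall>w\<in>{0..B}. 0 \<le> kernel_policy V s w \<and> kernel_policy V s w \<le> min s w"
  proof (intro ballI)
    fix s w assume "s \<in> {0..sbar}" "w \<in> {0..B}"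
    from V.unmet_feasible[OF this] show "0 \<le> kernel_policy V s w \<and> kernel_policy V s w \<le> min s w"
      by (simp add: kernel_policy_unmet)
  qed
qed

lemma play_kernel_policy: "play (kernel_policy V) V = shock_cost V"
  by (intro ext) (simp add: play_def kernel_policy_unmet V.shock_cost_def algebra_simps)

lemma play_ge_shock_cost:
  assumes \<mu>: "\<mu> \<in> policies sbar B" and x: "x \<in> {0..sbar}" and w: "w \<in> {0..B}"
  shows "shock_cost V x w \<le> play \<mu> V x w"
  unfolding play_def using policy_bounds[OF \<mu> x w] by (intro V.shock_cost_le x w) auto

lemma play_eq_shock_costD:
  assumes \<mu>: "\<mu> \<in> policies sbar B" and x: "x \<in> {0..sbar}" and w: "w \<in> {0..B}"
    and eq: "play \<mu> V x w = shock_cost V x w"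
  shows "\<mu> x w = kernel_policy V x w"
proof (rule ccontr)
  assume "\<mu> x w \<noteq> kernel_policy V x w"
  then have "w - \<mu> x w \<noteq> unmet V x w" by (simp add: kernel_policy_unmet)
  then have "shock_cost V x w < g (w - \<mu> x w) + V (w - \<mu> x w + (x - w))"
    unfolding V.shock_cost_def using policy_bounds[OF \<mu> x w]
    by (intro V.unmet_strict_min x w) auto
  then show False using eq by (simp add: play_def)
qed

lemma level_fn_V: "level_fn V"
  by (rule level_fn_cont[OF V_cont])

lemma stage_fn_V: "stage_fn (shock_cost V)"
  using V_cont V_convex by (rule stage_fn_shock_cost)

lemma policy_cost_ge_V:
  assumes \<mu>: "\<mu> \<in> policies sbar B" and s: "s \<in> {0..sbar}"
  shows "V s \<le> policy_cost \<mu> s"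
proof (rule policy_cost_ge[OF \<mu> level_fn_V _ s])
  fix s assume s: "s \<in> {0..sbar}"
  have "expect (shock_cost V) s \<le> expect (play \<mu> V) s"
    by (intro expect_mono stage_fn_V stage_fn_play \<mu> level_fn_V play_ge_shock_cost)
  with V_eq[OF s] show "V s \<le> expect (play \<mu> V) s" by linarith
qed

lemma policy_cost_kernel_policy:
  assumes s: "s \<in> {0..sbar}"
  shows "policy_cost (kernel_policy V) s = V s"
proof (rule antisym)
  show "policy_cost (kernel_policy V) s \<le> V s"
    by (rule policy_cost_le[OF kernel_policy_in_policies level_fn_V _ s])
      (simp add: play_kernel_policy V_eq[symmetric])
  show "V s \<le> policy_cost (kernel_policy V) s"
    by (rule policy_cost_ge_V[OF kernel_policy_in_policies s])
qed

text \<open>By the fixed-point equation for its cost, one period under \<open>\<mu>\<close> followed by optimal play costs exactly the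
  minimum in expectation. The integrand is never below the minimum, hence equal to it
  almost everywhere, and the minimiser is unique.\<close>

lemma optimal_policy_cost_unique:
  assumes \<mu>: "\<mu> \<in> policies sbar B" and opt: "\<And>s. s \<in> {0..sbar} \<Longrightarrow> policy_cost \<mu> s = V s"
    and s: "s \<in> {0..sbar}"
  shows "AE \<tau> in interarrival_law. AE w in F. \<mu> (next_level s \<tau>) w = kernel_policy V (next_level s \<tau>) w"
proof -
  interpret E: prob_space interarrival_law by (rule prob_E)
  interpret F: prob_space F by (rule prob_F)
  interpret EF: pair_sigma_finite interarrival_law F ..
  have "expect (play \<mu> V) s = expect (play \<mu> (policy_cost \<mu>)) s"
  proof (rule expect_cong)
    fix x w assume x: "x \<in> {0..sbar}" and w: "w \<in> {0..B}"
    show "play \<mu> V x w = play \<mu> (policy_cost \<mu>) x w"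
      using policy_bounds[OF \<mu> x w] x opt[of "x - \<mu> x w"] by (simp add: play_def)
  qed
  also have "\<dots> = expect (shock_cost V) s"
    unfolding policy_cost_fixpoint[OF \<mu>, of s, symmetric] opt[OF s] by (rule V_eq[OF s])
  finally have eq: "expect (play \<mu> V) s = expect (shock_cost V) s" .
  have "AE z in period_law. play \<mu> V (next_level s (fst z)) (clip B (snd z))
      = shock_cost V (next_level s (fst z)) (clip B (snd z))"
    by (rule expect_eq_AE[OF stage_fn_play[OF \<mu> level_fn_V] stage_fn_V play_ge_shock_cost[OF \<mu>] eq])
  then have "AE z in period_law. \<mu> (next_level s (fst z)) (snd z) = kernel_policy V (next_level s (fst z)) (snd z)"
    using N_support
  proof eventually_elim
    case (elim z)
    then show ?case using play_eq_shock_costD[OF \<mu> next_level_in elim(2), of s "fst z"] by simp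
  qed
  from EF.AE_pair[OF this[unfolded period_law_def]] show ?thesis by simp
qed

end

end

section \<open>The random cost of a policy\<close>

text \<open>The law of an independent sequence is that of a first entry prepended to an independent copy of the
  sequence. For two independent sequences the order of integration is exchanged so that both first
  entries come before both tails.\<close>

lemma nn_integral_pair_sequence_space:
  fixes f :: "(nat \<Rightarrow> 'a) \<times> (nat \<Rightarrow> 'b) \<Rightarrow> ennreal"
  assumes A: "prob_space A" and D: "prob_space D"
    and f [measurable]: "f \<in> borel_measurable (PiM UNIV (\<lambda>_. A) \<Otimes>\<^sub>M PiM UNIV (\<lambda>_. D))"
  shows "(\<integral>\<^sup>+\<alpha>. \<integral>\<^sup>+\<delta>. f (\<alpha>, \<delta>) \<partial>PiM UNIV (\<lambda>_. D) \<partial>PiM UNIV (\<lambda>_. A))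
    = (\<integral>\<^sup>+a. \<integral>\<^sup>+d. \<integral>\<^sup>+\<alpha>. \<integral>\<^sup>+\<delta>. f (case_nat a \<alpha>, case_nat d \<delta>) \<partial>PiM UNIV (\<lambda>_. D) \<partial>PiM UNIV (\<lambda>_. A) \<partial>D \<partial>A)"
proof -
  interpret A: prob_space A by fact
  interpret D: prob_space D by fact
  interpret SA: sequence_space A ..
  interpret SD: sequence_space D ..
  interpret DA: pair_sigma_finite D SA.S ..
  have tail: "(\<integral>\<^sup>+\<delta>. h \<delta> \<partial>SD.S) = (\<integral>\<^sup>+d. \<integral>\<^sup>+\<delta>. h (case_nat d \<delta>) \<partial>SD.S \<partial>D)"
    if [measurable]: "h \<in> borel_measurable SD.S" for h :: "_ \<Rightarrow> ennreal"
  proof -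
    have "(\<integral>\<^sup>+\<delta>. h \<delta> \<partial>SD.S) = (\<integral>\<^sup>+\<delta>. h \<delta> \<partial>distr (D \<Otimes>\<^sub>M SD.S) SD.S (\<lambda>(s, \<omega>). case_nat s \<omega>))"
      by (simp only: SD.PiM_iter)
    also have "\<dots> = (\<integral>\<^sup>+x. h (case_nat (fst x) (snd x)) \<partial>(D \<Otimes>\<^sub>M SD.S))"
      by (subst nn_integral_distr) (auto simp: case_prod_beta)
    also have "\<dots> = (\<integral>\<^sup>+d. \<integral>\<^sup>+\<delta>. h (case_nat d \<delta>) \<partial>SD.S \<partial>D)"
      by (subst SD.nn_integral_fst[symmetric]) auto
    finally show ?thesis .
  qed
  have "(\<integral>\<^sup>+\<alpha>. \<integral>\<^sup>+\<delta>. f (\<alpha>, \<delta>) \<partial>SD.S \<partial>SA.S)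
      = (\<integral>\<^sup>+\<alpha>. \<integral>\<^sup>+\<delta>. f (\<alpha>, \<delta>) \<partial>SD.S \<partial>distr (A \<Otimes>\<^sub>M SA.S) SA.S (\<lambda>(s, \<omega>). case_nat s \<omega>))"
    by (simp only: SA.PiM_iter)
  also have "\<dots> = (\<integral>\<^sup>+x. \<integral>\<^sup>+\<delta>. f (case_nat (fst x) (snd x), \<delta>) \<partial>SD.S \<partial>(A \<Otimes>\<^sub>M SA.S))"
    by (subst nn_integral_distr) (auto simp: case_prod_beta)
  also have "\<dots> = (\<integral>\<^sup>+a. \<integral>\<^sup>+\<alpha>. \<integral>\<^sup>+\<delta>. f (case_nat a \<alpha>, \<delta>) \<partial>SD.S \<partial>SA.S \<partial>A)"
    by (subst SA.nn_integral_fst[symmetric]) auto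
  also have "\<dots> = (\<integral>\<^sup>+a. \<integral>\<^sup>+\<alpha>. \<integral>\<^sup>+d. \<integral>\<^sup>+\<delta>. f (case_nat a \<alpha>, case_nat d \<delta>) \<partial>SD.S \<partial>D \<partial>SA.S \<partial>A)"
    by (intro nn_integral_cong tail) measurable
  also have "\<dots> = (\<integral>\<^sup>+a. \<integral>\<^sup>+d. \<integral>\<^sup>+\<alpha>. \<integral>\<^sup>+\<delta>. f (case_nat a \<alpha>, case_nat d \<delta>) \<partial>SD.S \<partial>SA.S \<partial>D \<partial>A)"
    by (intro nn_integral_cong DA.Fubini') measurable
  finally show ?thesis .
qed

text \<open>After the first arrival the storage evolves as if restarted from the level reached there, on the
  remaining arrivals.\<close>

lemma level_after_shift:
  "level_after r sbar t w \<mu> s (Suc k)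
    = level_after r sbar (\<lambda>i. t (Suc i)) (\<lambda>i. w (Suc i)) \<mu> (level_after r sbar t w \<mu> s (Suc 0)) k"
  by (induction k) (simp_all add: Let_def)

context storage_problem
begin

text \<open>The cost of the first \<open>n\<close> arrivals on one sample path, as a function of the interarrival times and the
  shocks. The recursion strips the first period, matching both the decomposition of the sequence space
  and the recursion for the expected costs.\<close>

primrec path_cost ::
  "(real \<Rightarrow> real \<Rightarrow> real) \<Rightarrow> nat \<Rightarrow> real \<Rightarrow> (nat \<Rightarrow> real) \<Rightarrow> (nat \<Rightarrow> real) \<Rightarrow> real" where
  "path_cost \<mu> 0 = (\<lambda>s \<tau> w. 0)"
| "path_cost \<mu> (Suc n) = (\<lambda>s \<tau> w. exp (- \<theta> * \<tau> 0) *
    play \<mu> (\<lambda>y. path_cost \<mu> n y (\<lambda>i. \<tau> (Suc i)) (\<lambda>i. w (Suc i))) (next_level s (\<tau> 0)) (clip B (w 0)))"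

lemma path_cost_nonneg:
  assumes \<mu>: "\<mu> \<in> policies sbar B"
  shows "0 \<le> path_cost \<mu> n s \<tau> w"
proof (induction n arbitrary: s \<tau> w)
  case (Suc n)
  have w: "clip B (w 0) \<in> {0..B}" using B by (simp del: atLeastAtMost_iff)
  show ?case
    using policy_bounds[OF \<mu> next_level_in w, of s "\<tau> 0"] w Suc.IH
      g_range[of "clip B (w 0) - \<mu> (next_level s (\<tau> 0)) (clip B (w 0))"]
    by (simp add: play_def)
qed simp

abbreviation SE :: "(nat \<Rightarrow> real) measure" where "SE \<equiv> PiM UNIV (\<lambda>_. interarrival_law)"
abbreviation SF :: "(nat \<Rightarrow> real) measure" where "SF \<equiv> PiM UNIV (\<lambda>_. F)"

lemma space_E: "space interarrival_law = UNIV" and space_F: "space F = UNIV"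
  using sets_eq_imp_space_eq[OF sets_E] sets_eq_imp_space_eq[OF sets_F] by simp_all

lemma shift_measurable:
  "(\<lambda>\<tau> i. \<tau> (Suc i)) \<in> measurable SE SE" "(\<lambda>w i. w (Suc i)) \<in> measurable SF SF"
  by (rule measurable_PiM_single', simp_all add: space_PiM space_E space_F)+

lemma path_cost_measurable:
  assumes \<mu>: "\<mu> \<in> policies sbar B"
  shows "(\<lambda>x. path_cost \<mu> n (fst x) (fst (snd x)) (snd (snd x))) \<in> borel_measurable (borel \<Otimes>\<^sub>M (SE \<Otimes>\<^sub>M SF))"
proof (induction n)
  case (Suc n)
  note [measurable] = shift_measurable
  let ?M = "borel \<Otimes>\<^sub>M (SE \<Otimes>\<^sub>M SF) :: (real \<times> (nat \<Rightarrow> real) \<times> (nat \<Rightarrow> real)) measure"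
  have \<tau>0 [measurable]: "(\<lambda>x. fst (snd x) 0) \<in> borel_measurable ?M"
    using measurable_compose[OF measurable_compose[OF measurable_snd measurable_fst] measurable_component_singleton[of 0 UNIV "\<lambda>_. interarrival_law"]]
    by (simp add: measurable_cong_sets[OF refl sets_E])
  have w0 [measurable]: "(\<lambda>x. snd (snd x) 0) \<in> borel_measurable ?M"
    using measurable_compose[OF measurable_compose[OF measurable_snd measurable_snd] measurable_component_singleton[of 0 UNIV "\<lambda>_. F"]]
    by (simp add: measurable_cong_sets[OF refl sets_F])
  let ?x = "\<lambda>x :: real \<times> (nat \<Rightarrow> real) \<times> (nat \<Rightarrow> real). next_level (fst x) (fst (snd x) 0)"
    and ?w = "\<lambda>x :: real \<times> (nat \<Rightarrow> real) \<times> (nat \<Rightarrow> real). clip B (snd (snd x) 0)"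
  have [measurable]: "?x \<in> borel_measurable ?M" "?w \<in> borel_measurable ?M"
    unfolding next_level_def by measurable
  have [measurable]: "(\<lambda>x. \<mu> (?x x) (?w x)) \<in> borel_measurable ?M"
    using measurable_compose[OF _ policy_measurable[OF \<mu>], of "\<lambda>x. (fst x + r * fst (snd x) 0, snd (snd x) 0)" ?M]
    by (simp add: next_level_def)
  have "(\<lambda>x. g (clip B (?w x - \<mu> (?x x) (?w x)))) \<in> borel_measurable ?M"
    by (rule measurable_compose[OF _ g_measurable]) measurable
  also have "(\<lambda>x. g (clip B (?w x - \<mu> (?x x) (?w x)))) = (\<lambda>x. g (?w x - \<mu> (?x x) (?w x)))"
  proof
    fix x :: "real \<times> (nat \<Rightarrow> real) \<times> (nat \<Rightarrow> real)"
    have w: "?w x \<in> {0..B}" using B by (simp del: atLeastAtMost_iff)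
    from policy_bounds[OF \<mu> next_level_in w, of "fst x" "fst (snd x) 0"] w
    have "?w x - \<mu> (?x x) (?w x) \<in> {0..B}" by auto
    then show "g (clip B (?w x - \<mu> (?x x) (?w x))) = g (?w x - \<mu> (?x x) (?w x))" by (simp only: clip_id)
  qed
  finally have [measurable]: "(\<lambda>x. g (?w x - \<mu> (?x x) (?w x))) \<in> borel_measurable ?M" .
  have 1: "(\<lambda>x i. fst (snd x) (Suc i)) \<in> measurable ?M SE" "(\<lambda>x i. snd (snd x) (Suc i)) \<in> measurable ?M SF"
    by (rule measurable_compose[OF _ shift_measurable(1)], measurable)
  have "(\<lambda>x. ?x x - \<mu> (?x x) (?w x)) \<in> borel_measurable ?M" by measurable
  from measurable_Pair[OF this measurable_Pair[OF 1]]
  have "(\<lambda>x. (?x x - \<mu> (?x x) (?w x), (\<lambda>i. fst (snd x) (Suc i)), (\<lambda>i. snd (snd x) (Suc i)))) \<in> measurable ?M ?M" .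
  from measurable_compose[OF this Suc.IH]
  have [measurable]: "(\<lambda>x. path_cost \<mu> n (?x x - \<mu> (?x x) (?w x)) (\<lambda>i. fst (snd x) (Suc i)) (\<lambda>i. snd (snd x) (Suc i))) \<in> borel_measurable ?M"
    by simp
  show ?case unfolding path_cost.simps play_def by measurable
qed simp

lemma path_cost_measurable_from:
  assumes \<mu>: "\<mu> \<in> policies sbar B"
  shows "(\<lambda>x. path_cost \<mu> n s (fst x) (snd x)) \<in> borel_measurable (SE \<Otimes>\<^sub>M SF)"
  using measurable_compose[OF _ path_cost_measurable[OF \<mu>], of "\<lambda>x. (s, x)" "SE \<Otimes>\<^sub>M SF"] by simp

text \<open>Integrating out the tails first turns the remaining path cost into the expected cost of one
  arrival fewer, so one step of the induction is one application of the policy operator.\<close>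

lemma nn_integral_path_cost:
  assumes \<mu>: "\<mu> \<in> policies sbar B"
  shows "(\<integral>\<^sup>+\<tau>. \<integral>\<^sup>+w. ennreal (path_cost \<mu> n s \<tau> w) \<partial>SF \<partial>SE) = ennreal (finite_cost \<mu> n s)"
proof (induction n arbitrary: s)
  case 0
  show ?case by simp
next
  case (Suc n)
  interpret E: prob_space interarrival_law by (rule prob_E)
  interpret F: prob_space F by (rule prob_F)
  interpret SE: sequence_space interarrival_law ..
  interpret SF: sequence_space F ..
  let ?x = "\<lambda>a. next_level s a" and ?w = "\<lambda>b. clip B b"
  have inner: "(\<integral>\<^sup>+\<tau>. \<integral>\<^sup>+w. ennreal (path_cost \<mu> (Suc n) s (case_nat a \<tau>) (case_nat b w)) \<partial>SF \<partial>SE)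
    = ennreal (exp (- \<theta> * a) * play \<mu> (finite_cost \<mu> n) (?x a) (?w b))" for a b
  proof -
    let ?u = "\<mu> (?x a) (?w b)"
    have w: "?w b \<in> {0..B}" using B by (simp del: atLeastAtMost_iff)
    have g0: "0 \<le> g (?w b - ?u)"
      using policy_bounds[OF \<mu> next_level_in w, of s a] w by (intro g_range) auto
    note m = path_cost_measurable_from[OF \<mu>, of n "?x a - ?u"]
    have m1: "(\<lambda>w. ennreal (path_cost \<mu> n (?x a - ?u) \<tau> w)) \<in> borel_measurable SF" if "\<tau> \<in> space SE" for \<tau>
      using measurable_compose[OF measurable_Pair1'[OF that] m] by simp
    have m2: "(\<lambda>\<tau>. \<integral>\<^sup>+w. ennreal (path_cost \<mu> n (?x a - ?u) \<tau> w) \<partial>SF) \<in> borel_measurable SE"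
      using SF.borel_measurable_nn_integral_fst[of "\<lambda>x. ennreal (path_cost \<mu> n (?x a - ?u) (fst x) (snd x))" SE] m
      by simp
    have "(\<integral>\<^sup>+\<tau>. \<integral>\<^sup>+w. ennreal (path_cost \<mu> (Suc n) s (case_nat a \<tau>) (case_nat b w)) \<partial>SF \<partial>SE)
      = (\<integral>\<^sup>+\<tau>. \<integral>\<^sup>+w. ennreal (exp (- \<theta> * a)) * (ennreal (g (?w b - ?u)) + ennreal (path_cost \<mu> n (?x a - ?u) \<tau> w)) \<partial>SF \<partial>SE)"
      using g0 path_cost_nonneg[OF \<mu>]
      by (intro nn_integral_cong) (simp add: play_def ennreal_mult ennreal_plus)
    also have "\<dots> = (\<integral>\<^sup>+\<tau>. ennreal (exp (- \<theta> * a)) * (ennreal (g (?w b - ?u)) + (\<integral>\<^sup>+w. ennreal (path_cost \<mu> n (?x a - ?u) \<tau> w) \<partial>SF)) \<partial>SE)"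
      using m1 by (intro nn_integral_cong) (simp add: nn_integral_cmult nn_integral_add SF.emeasure_space_1)
    also have "\<dots> = ennreal (exp (- \<theta> * a)) * (ennreal (g (?w b - ?u)) + ennreal (finite_cost \<mu> n (?x a - ?u)))"
      using m2 by (simp add: nn_integral_cmult nn_integral_add SE.emeasure_space_1 Suc.IH)
    also have "\<dots> = ennreal (exp (- \<theta> * a) * play \<mu> (finite_cost \<mu> n) (?x a) (?w b))"
      using g0 finite_cost_nonneg_le[OF \<mu>]
      by (simp add: play_def ennreal_mult ennreal_plus)
    finally show ?thesis .
  qed
  note st = stage_fn_play[OF \<mu> level_fn_finite_cost[OF \<mu>], of n]
  have nonneg: "0 \<le> play \<mu> (finite_cost \<mu> n) (?x a) (?w b)" for a b
  proof -
    have w: "?w b \<in> {0..B}" using B by (simp del: atLeastAtMost_iff)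
    show ?thesis
      using policy_bounds[OF \<mu> next_level_in w, of s a] w finite_cost_nonneg_le[OF \<mu>]
        g_range[of "?w b - \<mu> (?x a) (?w b)"] by (simp add: play_def)
  qed
  have "(\<integral>\<^sup>+\<tau>. \<integral>\<^sup>+w. ennreal (path_cost \<mu> (Suc n) s \<tau> w) \<partial>SF \<partial>SE)
      = (\<integral>\<^sup>+a. \<integral>\<^sup>+b. ennreal (exp (- \<theta> * a) * play \<mu> (finite_cost \<mu> n) (?x a) (?w b)) \<partial>F \<partial>interarrival_law)"
    using nn_integral_pair_sequence_space[OF prob_E prob_F, of "\<lambda>x. ennreal (path_cost \<mu> (Suc n) s (fst x) (snd x))"]
      path_cost_measurable_from[OF \<mu>, of "Suc n" s]
    by (simp only: inner fst_conv snd_conv measurable_compose[OF _ measurable_ennreal])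
  also have "\<dots> = (\<integral>\<^sup>+z. ennreal (exp (- \<theta> * fst z) * play \<mu> (finite_cost \<mu> n) (?x (fst z)) (?w (snd z))) \<partial>period_law)"
    unfolding period_law_def
    by (subst F.nn_integral_fst[symmetric])
      (use borel_measurable_integrable[OF expect_integrable[OF st, of s]] in \<open>simp_all add: period_law_def\<close>)
  also have "\<dots> = ennreal (expect (play \<mu> (finite_cost \<mu> n)) s)"
    unfolding expect_def
    by (rule nn_integral_eq_integral[OF expect_integrable[OF st]]) (use nonneg in auto)
  finally show ?case by simp
qed

text \<open>Removing the first arrival shifts the origin of time, which is why the times are measured from
  \<open>t 0\<close> here.\<close>

lemma sum_eq_path_cost:
  assumes \<mu>: "\<mu> \<in> policies sbar B"
    and "\<And>k. t k < t (Suc k)" "\<And>k. w (Suc k) \<in> {0..B}" "s \<in> {0..sbar}"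
  shows "(\<Sum>k<n. exp (- \<theta> * (t (Suc k) - t 0)) * g (w (Suc k) - \<mu> (level_before r sbar t w \<mu> s k) (w (Suc k))))
    = path_cost \<mu> n s (\<lambda>k. t (Suc k) - t k) (\<lambda>k. w (Suc k))"
  using assms(2-)
proof (induction n arbitrary: t w s)
  case (Suc n)
  define x where "x = next_level s (t (Suc 0) - t 0)"
  have x: "x \<in> {0..sbar}" unfolding x_def by (rule next_level_in)
  have refill: "refill r sbar s (t (Suc 0) - t 0) = x"
    using Suc.prems(1)[of 0] Suc.prems(3) r sbar
    by (simp add: x_def next_level_def refill_def clip_def)
  define s' where "s' = x - \<mu> x (w (Suc 0))"
  have s': "s' \<in> {0..sbar}" using policy_bounds[OF \<mu> x Suc.prems(2), of 0] x by (simp add: s'_def)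
  have after: "level_after r sbar t w \<mu> s (Suc 0) = s'"
    by (simp add: Let_def refill s'_def)
  have before: "level_before r sbar t w \<mu> s (Suc k)
      = level_before r sbar (\<lambda>i. t (Suc i)) (\<lambda>i. w (Suc i)) \<mu> s' k" for k
    unfolding level_before_def level_after_shift[of r sbar t w \<mu> s k] after ..
  let ?G = "\<lambda>k. g (w (Suc (Suc k)) - \<mu> (level_before r sbar (\<lambda>i. t (Suc i)) (\<lambda>i. w (Suc i)) \<mu> s' k) (w (Suc (Suc k))))"
  have "(\<Sum>k<n. exp (- \<theta> * (t (Suc (Suc k)) - t 0)) * ?G k)
      = (\<Sum>k<n. exp (- \<theta> * (t (Suc 0) - t 0)) * (exp (- \<theta> * (t (Suc (Suc k)) - t (Suc 0))) * ?G k))"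
    by (intro sum.cong refl) (simp add: mult.assoc[symmetric] exp_add[symmetric] algebra_simps)
  also have "\<dots> = exp (- \<theta> * (t (Suc 0) - t 0)) *
      path_cost \<mu> n s' (\<lambda>k. t (Suc (Suc k)) - t (Suc k)) (\<lambda>k. w (Suc (Suc k)))"
    unfolding sum_distrib_left[symmetric]
    using Suc.IH[of "\<lambda>i. t (Suc i)" "\<lambda>i. w (Suc i)" s'] Suc.prems s' by simp
  finally have tail: "(\<Sum>k<n. exp (- \<theta> * (t (Suc (Suc k)) - t 0)) * ?G k) = exp (- \<theta> * (t (Suc 0) - t 0)) *
      path_cost \<mu> n s' (\<lambda>k. t (Suc (Suc k)) - t (Suc k)) (\<lambda>k. w (Suc (Suc k)))" .
  have "clip B (w (Suc 0)) = w (Suc 0)" using Suc.prems(2) by (rule clip_id)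
  moreover have "level_before r sbar t w \<mu> s 0 = x" by (simp add: level_before_def refill)
  ultimately show ?case
    unfolding sum.lessThan_Suc_shift before tail
    by (simp add: play_def x_def[symmetric] s'_def[symmetric] distrib_left del: level_after.simps)
qed simp

context
  fixes M :: "'a measure" and t W :: "nat \<Rightarrow> 'a \<Rightarrow> real"
  assumes model: "shock_model M Q B F t W"
begin

interpretation M: prob_space M
  using model by (simp add: shock_model_def)

abbreviation interarrival :: "'a \<Rightarrow> nat \<Rightarrow> real" where
  "interarrival \<omega> k \<equiv> t (Suc k) \<omega> - t k \<omega>"

abbreviation shocks :: "'a \<Rightarrow> nat \<Rightarrow> real" where
  "shocks \<omega> k \<equiv> W (Suc k) \<omega>"

lemma path_properties:
  assumes "\<omega> \<in> space M"
  shows "t 0 \<omega> = 0" "t k \<omega> < t (Suc k) \<omega>" "W (Suc k) \<omega> \<in> {0..B}"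
  using model assms by (auto simp: shock_model_def poisson_arrivals_def iid_shocks_def)

text \<open>Interarrival times are measurable functions of the arrival times, so the independence of arrival
  times and shocks passes to them; each of the two sequences is independent by assumption.\<close>

lemma law_of_paths:
  "distr M (PiM UNIV (\<lambda>_. borel) \<Otimes>\<^sub>M PiM UNIV (\<lambda>_. borel)) (\<lambda>\<omega>. (interarrival \<omega>, shocks \<omega>)) = SE \<Otimes>\<^sub>M SF"
  and interarrival_shocks_measurable:
  "(\<lambda>\<omega>. (interarrival \<omega>, shocks \<omega>)) \<in> measurable M (PiM UNIV (\<lambda>_. borel) \<Otimes>\<^sub>M PiM UNIV (\<lambda>_. borel))"
proof -
  let ?S = "PiM UNIV (\<lambda>_. borel) :: (nat \<Rightarrow> real) measure"
  have T: "M.indep_vars (\<lambda>_. borel) (\<lambda>k \<omega>. t (Suc k) \<omega> - t k \<omega>) UNIV"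
    and Td: "\<And>k. distributed M lborel (\<lambda>\<omega>. t (Suc k) \<omega> - t k \<omega>) (exponential_density Q)"
    and W: "M.indep_vars (\<lambda>_. borel) (\<lambda>k. W (Suc k)) UNIV"
    and Wd: "\<And>k. distr M borel (W (Suc k)) = F"
    and TW: "M.indep_var ?S (\<lambda>\<omega> k. t (Suc k) \<omega>) ?S (\<lambda>\<omega> k. W (Suc k) \<omega>)"
    using model by (auto simp: shock_model_def poisson_arrivals_def iid_shocks_def)
  have Te: "distr M borel (\<lambda>\<omega>. t (Suc k) \<omega> - t k \<omega>) = interarrival_law" for k
  proof -
    have "distr M borel (\<lambda>\<omega>. t (Suc k) \<omega> - t k \<omega>) = distr M lborel (\<lambda>\<omega>. t (Suc k) \<omega> - t k \<omega>)"
      by (rule distr_cong) simp_all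
    then show ?thesis unfolding interarrival_law_def using distributed_distr_eq_density[OF Td, of k] by simp
  qed
  have rvT: "(\<lambda>\<omega>. t (Suc k) \<omega> - t k \<omega>) \<in> borel_measurable M" for k
    using T by (simp add: M.indep_vars_def)
  have rvW: "W (Suc k) \<in> borel_measurable M" for k
    using W by (simp add: M.indep_vars_def)
  have lawT: "distr M ?S interarrival = SE"
    using M.indep_vars_iff_distr_eq_PiM[of UNIV "\<lambda>k \<omega>. t (Suc k) \<omega> - t k \<omega>" "\<lambda>_. borel"] T rvT
    by (simp add: Te restrict_UNIV)
  have lawW: "distr M ?S shocks = SF"
    using M.indep_vars_iff_distr_eq_PiM[of UNIV "\<lambda>k. W (Suc k)" "\<lambda>_. borel"] W rvW
    by (simp add: Wd restrict_UNIV)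
  define diffs :: "(nat \<Rightarrow> real) \<Rightarrow> nat \<Rightarrow> real" where
    "diffs = (\<lambda>f k. f k - (case k of 0 \<Rightarrow> 0 | Suc j \<Rightarrow> f j))"
  have comp: "(\<lambda>f. f k) \<in> borel_measurable ?S" for k
    using measurable_component_singleton[of k UNIV "\<lambda>_. borel"] by simp
  have "diffs \<in> measurable ?S ?S"
    unfolding diffs_def
  proof (rule measurable_PiM_single')
    fix k :: nat
    show "(\<lambda>f. f k - (case k of 0 \<Rightarrow> 0 | Suc j \<Rightarrow> f j)) \<in> borel_measurable ?S"
      by (cases k) (simp_all add: comp)
  qed (simp add: space_PiM)
  from M.indep_var_compose[OF TW this measurable_ident]
  have indep: "M.indep_var ?S (diffs \<circ> (\<lambda>\<omega> k. t (Suc k) \<omega>)) ?S shocks"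
    by (simp add: comp_def)
  have diffs: "(diffs \<circ> (\<lambda>\<omega> k. t (Suc k) \<omega>)) \<omega> = interarrival \<omega>" if "\<omega> \<in> space M" for \<omega>
    using path_properties(1)[OF that] by (auto simp: diffs_def fun_eq_iff split: nat.split)
  let ?D = "diffs \<circ> (\<lambda>\<omega> k. t (Suc k) \<omega>)"
  have 1: "?D \<in> measurable M ?S" "shocks \<in> measurable M ?S"
    "distr M ?S ?D \<Otimes>\<^sub>M distr M ?S shocks = distr M (?S \<Otimes>\<^sub>M ?S) (\<lambda>x. (?D x, shocks x))"
    using indep unfolding M.indep_var_distribution_eq by auto
  have "distr M ?S ?D = SE"
    unfolding lawT[symmetric] by (rule distr_cong[OF refl refl diffs])
  then have "SE \<Otimes>\<^sub>M SF = distr M (?S \<Otimes>\<^sub>M ?S) (\<lambda>x. (?D x, shocks x))"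
    using 1(3) lawW by simp
  also have "\<dots> = distr M (?S \<Otimes>\<^sub>M ?S) (\<lambda>\<omega>. (interarrival \<omega>, shocks \<omega>))"
    using diffs by (intro distr_cong) auto
  finally show "distr M (?S \<Otimes>\<^sub>M ?S) (\<lambda>\<omega>. (interarrival \<omega>, shocks \<omega>)) = SE \<Otimes>\<^sub>M SF" ..
  have "interarrival \<in> measurable M ?S"
    using 1(1) measurable_cong[of M ?D interarrival ?S, OF diffs] by blast
  then show "(\<lambda>\<omega>. (interarrival \<omega>, shocks \<omega>)) \<in> measurable M (?S \<Otimes>\<^sub>M ?S)"
    using 1(2) by (rule measurable_Pair)
qed

lemma path_cost_random:
  assumes \<mu>: "\<mu> \<in> policies sbar B"
  shows "(\<lambda>\<omega>. path_cost \<mu> n s (interarrival \<omega>) (shocks \<omega>)) \<in> borel_measurable M"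
    and "(\<integral>\<^sup>+\<omega>. ennreal (path_cost \<mu> n s (interarrival \<omega>) (shocks \<omega>)) \<partial>M) = ennreal (finite_cost \<mu> n s)"
proof -
  interpret E: prob_space interarrival_law by (rule prob_E)
  interpret F: prob_space F by (rule prob_F)
  interpret SE: sequence_space interarrival_law ..
  interpret SF: sequence_space F ..
  let ?S = "PiM UNIV (\<lambda>_. borel) :: (nat \<Rightarrow> real) measure"
  have "sets (SE \<Otimes>\<^sub>M SF) = sets (?S \<Otimes>\<^sub>M ?S)"
    by (intro sets_pair_measure_cong sets_PiM_cong sets_E sets_F refl)
  from measurable_cong_sets[OF this refl]
  have m: "(\<lambda>x. path_cost \<mu> n s (fst x) (snd x)) \<in> borel_measurable (?S \<Otimes>\<^sub>M ?S)"
    using path_cost_measurable_from[OF \<mu>, of n s] by blast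
  from measurable_compose[OF interarrival_shocks_measurable m]
  show "(\<lambda>\<omega>. path_cost \<mu> n s (interarrival \<omega>) (shocks \<omega>)) \<in> borel_measurable M" by simp
  have "(\<integral>\<^sup>+\<omega>. ennreal (path_cost \<mu> n s (interarrival \<omega>) (shocks \<omega>)) \<partial>M)
      = (\<integral>\<^sup>+x. ennreal (path_cost \<mu> n s (fst x) (snd x)) \<partial>(SE \<Otimes>\<^sub>M SF))"
    unfolding law_of_paths[symmetric]
    using m by (subst nn_integral_distr[OF interarrival_shocks_measurable]) simp_all
  also have "\<dots> = (\<integral>\<^sup>+\<tau>. \<integral>\<^sup>+w. ennreal (path_cost \<mu> n s \<tau> w) \<partial>SF \<partial>SE)"
    by (subst SF.nn_integral_fst[symmetric])
      (use measurable_compose[OF path_cost_measurable_from[OF \<mu>] measurable_ennreal] in simp_all)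
  finally show "(\<integral>\<^sup>+\<omega>. ennreal (path_cost \<mu> n s (interarrival \<omega>) (shocks \<omega>)) \<partial>M) = ennreal (finite_cost \<mu> n s)"
    by (simp add: nn_integral_path_cost[OF \<mu>])
qed

text \<open>Monotone convergence in the number of arrivals. The partial sums have bounded expectations, hence
  the series converges on almost every path; elsewhere the infinite sum has a default value,
  which does not affect the integral.\<close>

lemma cost_eq_policy_cost:
  assumes \<mu>: "\<mu> \<in> policies sbar B" and s: "s \<in> {0..sbar}"
  shows "cost M r \<theta> sbar t W g \<mu> s = policy_cost \<mu> s"
proof -
  define c where "c = (\<lambda>k \<omega>. exp (- \<theta> * t (Suc k) \<omega>) *
    g (W (Suc k) \<omega> - \<mu> (level_before r sbar (\<lambda>i. t i \<omega>) (\<lambda>i. W i \<omega>) \<mu> s k) (W (Suc k) \<omega>)))"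
  define P where "P = (\<lambda>n \<omega>. path_cost \<mu> n s (interarrival \<omega>) (shocks \<omega>))"
  have sum: "(\<Sum>k<n. c k \<omega>) = P n \<omega>" if "\<omega> \<in> space M" for n \<omega>
    using sum_eq_path_cost[OF \<mu> _ _ s, of "\<lambda>i. t i \<omega>" "\<lambda>i. W i \<omega>" n] path_properties[OF that]
    by (simp add: c_def P_def)
  have P_meas [measurable]: "P n \<in> borel_measurable M" for n
    unfolding P_def by (rule path_cost_random[OF \<mu>])
  have P_nonneg: "0 \<le> P n \<omega>" for n \<omega> unfolding P_def by (rule path_cost_nonneg[OF \<mu>])
  have P_nn: "(\<integral>\<^sup>+\<omega>. ennreal (P n \<omega>) \<partial>M) = ennreal (finite_cost \<mu> n s)" for n
    unfolding P_def by (rule path_cost_random[OF \<mu>])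
  have level: "level_before r sbar (\<lambda>i. t i \<omega>) (\<lambda>i. W i \<omega>) \<mu> s k \<in> {0..sbar} \<and>
      level_after r sbar (\<lambda>i. t i \<omega>) (\<lambda>i. W i \<omega>) \<mu> s k \<in> {0..sbar}" if \<omega>: "\<omega> \<in> space M" for k \<omega>
  proof (induction k)
    case 0
    then show ?case using s path_properties(2)[OF \<omega>, of 0] r sbar
      by (auto simp: level_before_def refill_def)
  next
    case (Suc k)
    let ?b = "level_before r sbar (\<lambda>i. t i \<omega>) (\<lambda>i. W i \<omega>) \<mu> s k"
    have "level_after r sbar (\<lambda>i. t i \<omega>) (\<lambda>i. W i \<omega>) \<mu> s (Suc k) = ?b - \<mu> ?b (W (Suc k) \<omega>)"
      by (simp add: level_before_def Let_def)
    moreover have "?b - \<mu> ?b (W (Suc k) \<omega>) \<in> {0..sbar}"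
      using policy_bounds[OF \<mu> conjunct1[OF Suc] path_properties(3)[OF \<omega>], of k] Suc by auto
    ultimately have "level_after r sbar (\<lambda>i. t i \<omega>) (\<lambda>i. W i \<omega>) \<mu> s (Suc k) \<in> {0..sbar}" by simp
    then show ?case using path_properties(2)[OF \<omega>, of "Suc k"] r sbar
      by (auto simp: level_before_def refill_def)
  qed
  have c_nonneg: "0 \<le> c k \<omega>" if \<omega>: "\<omega> \<in> space M" for k \<omega>
    using policy_bounds[OF \<mu> conjunct1[OF level[OF \<omega>]] path_properties(3)[OF \<omega>], of k k] path_properties(3)[OF \<omega>, of k]
    unfolding c_def by (intro mult_nonneg_nonneg g_range) auto
  have P_mono: "P n \<omega> \<le> P (Suc n) \<omega>" if "\<omega> \<in> space M" for n \<omega>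
    using c_nonneg[OF that] by (simp flip: sum[OF that])
  have "(\<integral>\<^sup>+\<omega>. (SUP n. ennreal (P n \<omega>)) \<partial>M) = (SUP n. \<integral>\<^sup>+\<omega>. ennreal (P n \<omega>) \<partial>M)"
    by (rule nn_integral_monotone_convergence_SUP_AE) (use P_mono in \<open>auto intro!: ennreal_leI\<close>)
  also have "\<dots> \<le> ennreal cost_bound"
    unfolding P_nn using finite_cost_nonneg_le[OF \<mu>] by (intro SUP_least ennreal_leI) auto
  finally have "(\<integral>\<^sup>+\<omega>. (SUP n. ennreal (P n \<omega>)) \<partial>M) \<noteq> \<infinity>"
    by (auto simp: top_unique)
  then have "AE \<omega> in M. (SUP n. ennreal (P n \<omega>)) \<noteq> \<infinity>"
    by (intro nn_integral_PInf_AE) auto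
  then have summable: "AE \<omega> in M. summable (\<lambda>k. c k \<omega>)"
  proof (rule AE_mp, intro AE_I2 impI)
    fix \<omega> assume \<omega>: "\<omega> \<in> space M" and fin: "(SUP n. ennreal (P n \<omega>)) \<noteq> \<infinity>"
    define b where "b = enn2real (SUP n. ennreal (P n \<omega>))"
    have b: "(SUP n. ennreal (P n \<omega>)) = ennreal b" unfolding b_def by (rule ennreal_enn2real[symmetric]) (use fin in \<open>simp only: less_top infinity_ennreal_def\<close>)
    have "P n \<omega> \<le> b" for n
    proof -
      have "ennreal (P n \<omega>) \<le> ennreal b" unfolding b[symmetric] by (rule SUP_upper) simp
      then show ?thesis using P_nonneg by (simp add: ennreal_le_iff b_def)
    qed
    then show "summable (\<lambda>k. c k \<omega>)"
      using c_nonneg[OF \<omega>] by (intro summableI_nonneg_bounded[of _ b]) (auto simp: sum[OF \<omega>])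
  qed
  have P_int: "integrable M (P n)" "integral\<^sup>L M (P n) = finite_cost \<mu> n s" for n
    using P_nn[of n] P_nonneg finite_cost_nonneg_le[OF \<mu>, of n s]
    by (auto intro!: integrableI_nonneg simp: integral_eq_nn_integral)
  have c_meas: "c k \<in> borel_measurable M" for k
  proof -
    have "c k \<omega> = P (Suc k) \<omega> - P k \<omega>" if "\<omega> \<in> space M" for \<omega>
      by (simp flip: sum[OF that])
    moreover have "(\<lambda>\<omega>. P (Suc k) \<omega> - P k \<omega>) \<in> borel_measurable M" by measurable
    ultimately show ?thesis by (simp cong: measurable_cong)
  qed
  have "integral\<^sup>L M (\<lambda>\<omega>. \<Sum>k. c k \<omega>) = policy_cost \<mu> s"
  proof (rule integral_monotone_convergence[where f=P])
    show "AE \<omega> in M. (\<lambda>n. P n \<omega>) \<longlonglongrightarrow> (\<Sum>k. c k \<omega>)"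
      using summable
    proof (rule AE_mp, intro AE_I2 impI)
      fix \<omega> assume "\<omega> \<in> space M" "summable (\<lambda>k. c k \<omega>)"
      then show "(\<lambda>n. P n \<omega>) \<longlonglongrightarrow> (\<Sum>k. c k \<omega>)"
        using summable_LIMSEQ[of "\<lambda>k. c k \<omega>"] by (simp add: sum)
    qed
    show "AE \<omega> in M. mono (\<lambda>n. P n \<omega>)"
      using P_mono by (intro AE_I2 mono_iff_le_Suc[THEN iffD2]) auto
    show "(\<lambda>n. integral\<^sup>L M (P n)) \<longlonglongrightarrow> policy_cost \<mu> s"
      unfolding P_int by (rule finite_cost_tendsto[OF \<mu>])
    show "(\<lambda>\<omega>. \<Sum>k. c k \<omega>) \<in> borel_measurable M"
      using c_meas by (intro borel_measurable_suminf)
  qed (rule P_int)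
  then show ?thesis unfolding cost_def c_def .
qed

end

end

section \<open>The differential equation of the value function\<close>

context storage_problem
begin

definition shock_mean :: "(real \<Rightarrow> real \<Rightarrow> real) \<Rightarrow> real \<Rightarrow> real" where
  "shock_mean k x = (\<integral>w. k x (clip B w) \<partial>F)"

lemma shock_integrable:
  assumes k: "stage_fn k" and x: "x \<in> {0..sbar}"
  shows "integrable F (\<lambda>w. k x (clip B w))"
proof -
  interpret F: prob_space F by (rule prob_F)
  obtain K where K: "\<And>x w. x \<in> {0..sbar} \<Longrightarrow> w \<in> {0..B} \<Longrightarrow> \<bar>k x w\<bar> \<le> K"
    using k unfolding stage_fn_def by blast
  have "(\<lambda>z. k (clip sbar (fst z)) (clip B (snd z))) \<in> borel_measurable (borel \<Otimes>\<^sub>M borel)"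
    using k by (simp add: stage_fn_def)
  from measurable_compose[OF _ this, of "\<lambda>w. (x, w)" F]
  have m: "(\<lambda>w. k x (clip B w)) \<in> borel_measurable F" by (simp add: clip_id[OF x])
  show ?thesis
    by (rule F.integrable_const_bound[OF AE_I2 m, of K])
      (use K[OF x clip_in[of B]] B in \<open>simp del: atLeastAtMost_iff\<close>)
qed

lemma expect_shock_mean:
  assumes k: "stage_fn k"
  shows "expect k s = (\<integral>\<tau>. exp (- \<theta> * \<tau>) * shock_mean k (next_level s \<tau>) \<partial>interarrival_law)"
    and "integrable interarrival_law (\<lambda>\<tau>. exp (- \<theta> * \<tau>) * shock_mean k (next_level s \<tau>))"
proof -
  interpret E: prob_space interarrival_law by (rule prob_E)
  interpret F: prob_space F by (rule prob_F)
  interpret EF: pair_sigma_finite interarrival_law F ..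
  note int = expect_integrable[OF k, of s, unfolded period_law_def]
  show "expect k s = (\<integral>\<tau>. exp (- \<theta> * \<tau>) * shock_mean k (next_level s \<tau>) \<partial>interarrival_law)"
    unfolding expect_def period_law_def EF.integral_fst'[OF int, symmetric] by (simp add: shock_mean_def)
  show "integrable interarrival_law (\<lambda>\<tau>. exp (- \<theta> * \<tau>) * shock_mean k (next_level s \<tau>))"
    using EF.integrable_fst'[OF int] by (simp add: shock_mean_def)
qed

lemma shock_mean_cont:
  assumes k: "continuous_on ({0..sbar} \<times> {0..B}) (\<lambda>(x, w). k x w)"
  shows "continuous_on UNIV (\<lambda>x. shock_mean k (clip sbar x))"
proof (rule continuous_on_sequentiallyI)
  interpret F: prob_space F by (rule prob_F)
  note st = stage_fn_cont[OF k]
  then obtain K where K: "\<And>x w. x \<in> {0..sbar} \<Longrightarrow> w \<in> {0..B} \<Longrightarrow> \<bar>k x w\<bar> \<le> K"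
    unfolding stage_fn_def by blast
  have cs: "clip sbar x \<in> {0..sbar}" and cB: "clip B x \<in> {0..B}" for x
    using sbar B by (simp_all del: atLeastAtMost_iff)
  fix u :: "nat \<Rightarrow> real" and a assume u: "u \<longlonglongrightarrow> a"
  show "(\<lambda>n. shock_mean k (clip sbar (u n))) \<longlonglongrightarrow> shock_mean k (clip sbar a)"
    unfolding shock_mean_def
  proof (rule integral_dominated_convergence[where w="\<lambda>_. K"])
    have "(\<lambda>n. k (clip sbar (u n)) (clip B w)) \<longlonglongrightarrow> k (clip sbar a) (clip B w)" for w
    proof -
      have "continuous_on UNIV (\<lambda>x. (clip sbar x, clip B w))" by (intro continuous_intros)
      then have "continuous_on UNIV (\<lambda>x. (\<lambda>(x, w). k x w) (clip sbar x, clip B w))"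
        by (rule continuous_on_compose2[OF k]) (use cs cB in \<open>auto simp del: atLeastAtMost_iff\<close>)
      from continuous_on_tendsto_compose[OF this u] show ?thesis by simp
    qed
    then show "AE w in F. (\<lambda>n. k (clip sbar (u n)) (clip B w)) \<longlonglongrightarrow> k (clip sbar a) (clip B w)" by simp
    show "AE w in F. norm (k (clip sbar (u n)) (clip B w)) \<le> K" for n
      using K[OF cs cB] by simp
  qed (use shock_integrable[OF st cs] in \<open>simp_all add: borel_measurable_integrable\<close>)
qed

text \<open>Substituting the level \<open>y = s + r * \<tau>\<close> that would be reached without a capacity for the waiting time
  \<open>\<tau>\<close> moves the dependence on \<open>s\<close> from the integrand into the lower bound of the integral and an
  exponential factor.\<close>

lemma expect_integral_form:
  assumes k: "stage_fn k"
  defines "\<kappa> \<equiv> \<lambda>y. Q / r * (exp (- ((Q + \<theta>) / r) * y) * shock_mean k (clip sbar y))"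
  shows "expect k s = exp ((Q + \<theta>) / r * s) * (LINT y:{s..}|lborel. \<kappa> y)"
    and "set_integrable lborel {s..} \<kappa>"
proof -
  define f where "f = (\<lambda>\<tau>. exponential_density Q \<tau> * (exp (- \<theta> * \<tau>) * shock_mean k (next_level s \<tau>)))"
  let ?e = "exp ((Q + \<theta>) / r * s)"
  have m: "(\<lambda>\<tau>. exp (- \<theta> * \<tau>) * shock_mean k (next_level s \<tau>)) \<in> borel_measurable lborel"
    using borel_measurable_integrable[OF expect_shock_mean(2)[OF k]] by (simp add: interarrival_law_def)
  have f_int: "integrable lborel f"
    using expect_shock_mean(2)[OF k, of s] m Q unfolding interarrival_law_def f_def
    by (subst (asm) integrable_density) (auto simp: exponential_density_nonneg)
  have exp_f: "expect k s = integral\<^sup>L lborel f"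
    using m Q unfolding expect_shock_mean(1)[OF k] interarrival_law_def f_def
    by (subst integral_density) (auto simp: exponential_density_nonneg)
  have f_eq: "f (- s / r + 1 / r * y) = r * ?e * (indicator {s..} y *\<^sub>R \<kappa> y)" for y
  proof (cases "s \<le> y")
    case True
    have e: "exp (- (y / r - s / r) * Q) * exp (- \<theta> * (y / r - s / r)) = ?e * exp (- ((Q + \<theta>) / r) * y)"
      unfolding exp_add[symmetric] using r by (simp add: divide_simps) (simp add: algebra_simps)
    have "next_level s (y / r - s / r) = clip sbar y" using r by (simp add: next_level_def right_diff_distrib)
    then have "f (y / r - s / r) = Q * (exp (- (y / r - s / r) * Q) * exp (- \<theta> * (y / r - s / r))) * shock_mean k (clip sbar y)"
      using True r divide_right_mono[OF True, of r] by (simp add: f_def exponential_density_def)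
    then show ?thesis unfolding e using True r by (simp add: \<kappa>_def)
  next
    case False
    then have "y / r - s / r < 0" using r by (simp add: divide_strict_right_mono)
    then show ?thesis using False by (simp add: f_def exponential_density_def)
  qed
  have "integrable lborel (\<lambda>y. f (- s / r + 1 / r * y))"
    using r by (intro lborel_integrable_real_affine f_int) simp
  then have "integrable lborel (\<lambda>y. indicator {s..} y *\<^sub>R \<kappa> y)"
    unfolding f_eq integrable_mult_right_iff using r by simp
  then show "set_integrable lborel {s..} \<kappa>" by (simp add: set_integrable_def)
  have "integral\<^sup>L lborel f = \<bar>1 / r\<bar> *\<^sub>R (\<integral>y. f (- s / r + 1 / r * y) \<partial>lborel)"
    using r by (intro lborel_integral_real_affine) simp
  also have "\<dots> = ?e * (LINT y:{s..}|lborel. \<kappa> y)"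
    unfolding f_eq set_lebesgue_integral_def using r by simp
  finally show "expect k s = ?e * (LINT y:{s..}|lborel. \<kappa> y)" using exp_f by simp
qed

text \<open>Differentiating the integral form. Writing the tail integral as a constant minus an integral over
  \<open>{0..s}\<close> makes the fundamental theorem of calculus available up to both ends of the interval.\<close>

lemma expect_derivative:
  assumes k: "continuous_on ({0..sbar} \<times> {0..B}) (\<lambda>(x, w). k x w)" and s: "s \<in> {0..sbar}"
  shows "(expect k has_real_derivative ((Q + \<theta>) / r * expect k s - Q / r * shock_mean k s)) (at s within {0..sbar})"
proof -
  note st = stage_fn_cont[OF k]
  define l where "l = (Q + \<theta>) / r"
  define \<kappa> where "\<kappa> = (\<lambda>y. Q / r * (exp (- l * y) * shock_mean k (clip sbar y)))"
  note form = expect_integral_form[OF st, folded l_def, folded \<kappa>_def]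
  have \<kappa>_cont: "continuous_on S \<kappa>" for S
    unfolding \<kappa>_def by (intro continuous_intros continuous_on_subset[OF shock_mean_cont[OF k]]) simp
  define A where "A = (LINT y:{0..}|lborel. \<kappa> y)"
  have tail: "(LINT y:{x..}|lborel. \<kappa> y) = A - integral {0..x} \<kappa>" if x: "0 \<le> x" for x
  proof -
    have "{0..} = {0..x} \<union> {x<..}" using x by auto
    moreover have i1: "set_integrable lborel {0..x} \<kappa>"
      by (rule set_integrable_subset[OF form(2)[of 0]]) auto
    moreover have "set_integrable lborel {x<..} \<kappa>"
      by (rule set_integrable_subset[OF form(2)[of x]]) auto
    ultimately have "A = (LINT y:{0..x}|lborel. \<kappa> y) + (LINT y:{x<..}|lborel. \<kappa> y)"
      unfolding A_def by (simp only:) (intro set_integral_Un, auto)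
    moreover have "(LINT y:{x<..}|lborel. \<kappa> y) = (LINT y:{x..}|lborel. \<kappa> y)"
      unfolding set_lebesgue_integral_def
    proof (rule integral_cong_AE)
      have "AE y in lborel. y \<noteq> x" by (rule AE_lborel_singleton)
      then show "AE y in lborel. indicator {x<..} y *\<^sub>R \<kappa> y = indicator {x..} y *\<^sub>R \<kappa> y"
        by eventually_elim (auto simp: indicator_def)
    qed (use borel_measurable_continuous_onI[OF \<kappa>_cont] in simp_all)
    ultimately show ?thesis using set_borel_integral_eq_integral(2)[OF i1] by simp
  qed
  have eq: "expect k x = exp (l * x) * (A - integral {0..x} \<kappa>)" if "0 \<le> x" for x
    unfolding form(1)[of x] tail[OF that] ..
  have "((\<lambda>x. integral {0..x} \<kappa>) has_real_derivative \<kappa> s) (at s within {0..sbar})"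
    by (rule integral_has_real_derivative[OF \<kappa>_cont s])
  then have "((\<lambda>x. exp (l * x) * (A - integral {0..x} \<kappa>)) has_real_derivative
      (l * (exp (l * s) * (A - integral {0..s} \<kappa>)) - exp (l * s) * \<kappa> s)) (at s within {0..sbar})"
    by (auto intro!: derivative_eq_intros simp: algebra_simps)
  also have "l * (exp (l * s) * (A - integral {0..s} \<kappa>)) - exp (l * s) * \<kappa> s = l * expect k s - Q / r * shock_mean k s"
  proof -
    have "exp (l * s) * \<kappa> s = Q / r * (exp (l * s) * exp (- l * s)) * shock_mean k s"
      unfolding \<kappa>_def clip_id[OF s] by simp
    also have "exp (l * s) * exp (- l * s) = 1" unfolding exp_add[symmetric] by simp
    finally show ?thesis using eq[of s] s by simp
  qed
  finally show ?thesis unfolding l_def[symmetric]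
    by (rule has_field_derivative_transform_within[of _ _ _ _ 1]) (use s eq in auto)
qed

subsection \<open>Strict convexity of the value function\<close>

context
  fixes V V' :: "real \<Rightarrow> real"
  assumes V_cont: "continuous_on {0..sbar} V" and V_convex: "convex_on {0..sbar} V"
    and V_nonneg: "\<And>s. s \<in> {0..sbar} \<Longrightarrow> 0 \<le> V s"
    and V_eq: "\<And>s. s \<in> {0..sbar} \<Longrightarrow> V s = expect (shock_cost V) s"
    and V_deriv: "\<And>s. s \<in> {0..sbar} \<Longrightarrow> (V has_real_derivative V' s) (at s within {0..sbar})"
    and V'_cont: "continuous_on {0..sbar} V'"
begin

interpretation V: kernel_problem sbar B g V
  using V_cont V_convex by (rule kernel_problem)

text \<open>The differential equation holds up to both ends of the interval, where one-sided derivatives are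
  still unique. The conditions at the two ends are the facts about \<open>V'\<close> that the break-points need.\<close>

lemma V'_eq:
  assumes s: "s \<in> {0..sbar}"
  shows "r * V' s = (Q + \<theta>) * V s - Q * shock_mean (shock_cost V) s"
proof -
  have "(V has_real_derivative ((Q + \<theta>) / r * V s - Q / r * shock_mean (shock_cost V) s)) (at s within {0..sbar})"
    unfolding V_eq[OF s]
    by (rule has_field_derivative_transform_within[OF expect_derivative[OF V.shock_cost_cont s], of 1])
      (use s V_eq in auto)
  from has_real_derivative_unique_within_interval[OF V_deriv[OF s] this sbar s]
  show ?thesis using r by (simp add: right_diff_distrib)
qed

lemma V'_mono:
  assumes "x \<in> {0..sbar}" "y \<in> {0..sbar}" "x \<le> y"
  shows "V' x \<le> V' y"
  by (rule convex_on_deriv_mono[OF V_convex V_deriv assms])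

text \<open>A full storage stays full until the next arrival, so \<open>V sbar\<close> is the discounted mean cost at level
  \<open>sbar\<close>, and the right-hand side of the differential equation vanishes.\<close>

lemma V'_sbar: "V' sbar = 0"
proof -
  have sb: "sbar \<in> {0..sbar}" using sbar by simp
  have st: "stage_fn (shock_cost V)" using V_cont V_convex by (rule stage_fn_shock_cost)
  have "V sbar = (\<integral>\<tau>. exp (- \<theta> * \<tau>) * shock_mean (shock_cost V) sbar \<partial>interarrival_law)"
    unfolding V_eq[OF sb] expect_shock_mean(1)[OF st]
  proof (rule integral_cong_AE)
    show "AE \<tau> in interarrival_law. exp (- \<theta> * \<tau>) * shock_mean (shock_cost V) (next_level sbar \<tau>)
        = exp (- \<theta> * \<tau>) * shock_mean (shock_cost V) sbar"
      using E_pos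
    proof eventually_elim
      case (elim \<tau>)
      then have "next_level sbar \<tau> = sbar" using r sbar by (simp add: next_level_def clip_def)
      then show ?case by simp
    qed
  qed (use borel_measurable_integrable[OF expect_shock_mean(2)[OF st]] in simp_all)
  also have "\<dots> = \<beta> * shock_mean (shock_cost V) sbar" using discount_E by simp
  finally have "(Q + \<theta>) * V sbar = Q * shock_mean (shock_cost V) sbar"
    using Q \<theta> by (simp add: \<beta>_def)
  then show ?thesis using V'_eq[OF sb] r by simp
qed

lemma V'_nonpos:
  assumes "s \<in> {0..sbar}"
  shows "V' s \<le> 0"
  using V'_mono[OF assms, of sbar] V'_sbar assms sbar by simp

text \<open>An empty storage can serve nothing, which gives the mean cost at level \<open>0\<close> in closed form.\<close>

lemma V'_0_ge: "- V' 0 \<le> Q / r * (\<integral>w. g (clip B w) \<partial>F)"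
proof -
  interpret F: prob_space F by (rule prob_F)
  have z: "0 \<in> {0..sbar}" using sbar by simp
  have eq: "shock_cost V 0 w = g w + V 0" if w: "w \<in> {0..B}" for w
    using V.unmet_feasible[OF z w] by (simp add: V.shock_cost_def)
  have cB: "clip B x \<in> {0..B}" for x using B by (simp del: atLeastAtMost_iff)
  have st: "stage_fn (shock_cost V)" using V_cont V_convex by (rule stage_fn_shock_cost)
  have int: "integrable F (\<lambda>w. g (clip B w))"
    using Bochner_Integration.integrable_diff[OF shock_integrable[OF st z] F.integrable_const[of "V 0"]]
    by (simp add: eq[OF cB])
  have "shock_mean (shock_cost V) 0 = (\<integral>w. g (clip B w) \<partial>F) + V 0"
    unfolding shock_mean_def eq[OF cB] using int by (simp add: F.prob_space)
  then have "r * V' 0 = \<theta> * V 0 - Q * (\<integral>w. g (clip B w) \<partial>F)"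
    using V'_eq[OF z] by (simp add: algebra_simps)
  moreover have "0 \<le> \<theta> * V 0" using \<theta> V_nonneg[OF z] by simp
  ultimately show ?thesis using r by (simp add: field_simps)
qed

text \<open>If \<open>V\<close> has constant slope \<open>c\<close> on \<open>{a..b}\<close>, the differential equation makes the mean minimal cost affine
  there. The convexity gap at the midpoint has mean zero for the random shock, so it vanishes for
  almost every shock, and the equality case carries the flat piece to an interval shifted down by the
  amount served. The slopes of the shifted pieces have mean \<open>(1 + \<theta> / Q) * c\<close>.\<close>

lemma flat_step:
  assumes ab: "0 \<le> a" "a < b" "b \<le> sbar" and c: "V' a = c" "V' b = c"
  shows "\<exists>m. integrable F m \<and> (\<integral>w. m w \<partial>F) = (1 + \<theta> / Q) * c \<and>
    (AE w in F. \<exists>u. 0 \<le> u \<and> u \<le> a \<and> V' (a - u) = m w \<and> V' (b - u) = m w \<and> unmet V b (clip B w) = clip B w - u)"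
proof -
  define s where "s = (a + b) / 2"
  have a: "a \<in> {0..sbar}" and b: "b \<in> {0..sbar}" and s: "s \<in> {0..sbar}" and sab: "s \<in> {a..b}"
    using ab by (auto simp: s_def)
  have aff: "V' x = c" "V x = V a + c * (x - a)" if "x \<in> {a..b}" for x
    using deriv_const_imp_affine[OF V_convex V_deriv ab(1,3) c that] by blast+
  let ?h = "\<lambda>x w. shock_cost V x (clip B w)"
  have st: "stage_fn (shock_cost V)" using V_cont V_convex by (rule stage_fn_shock_cost)
  note int = shock_integrable[OF st]
  have cB: "clip B x \<in> {0..B}" for x using B by (simp del: atLeastAtMost_iff)
  have H: "shock_mean (shock_cost V) x = ((Q + \<theta>) * V x - r * c) / Q" if "x \<in> {a..b}" for x
    using V'_eq[of x] aff(1)[OF that] that ab Q by (simp add: field_simps)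
  have gap: "(\<integral>w. ?h a w + ?h b w - 2 * ?h s w \<partial>F) = 0"
  proof -
    have "(\<integral>w. ?h a w + ?h b w - 2 * ?h s w \<partial>F)
        = shock_mean (shock_cost V) a + shock_mean (shock_cost V) b - 2 * shock_mean (shock_cost V) s"
      unfolding shock_mean_def using int[OF a] int[OF b] int[OF s] by simp
    also have "\<dots> = 0"
    proof -
      have "V b = V a + c * (b - a)" "V s = V a + c * ((b - a) / 2)"
        using ab aff(2)[of b] aff(2)[OF sab] by (simp_all add: s_def field_simps)
      then have "V a + V b = 2 * V s" by simp
      then have "(Q + \<theta>) * V a + (Q + \<theta>) * V b = 2 * ((Q + \<theta>) * V s)"
        by (simp flip: distrib_left)
      then have "((Q + \<theta>) * V a - r * c) + ((Q + \<theta>) * V b - r * c) = 2 * ((Q + \<theta>) * V s - r * c)"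
        by (simp add: algebra_simps)
      then show ?thesis using ab sab by (simp add: H flip: add_divide_distrib)
    qed
    finally show ?thesis .
  qed
  have gap_nonneg: "0 \<le> ?h a w + ?h b w - 2 * ?h s w" for w
    using convex_onD[OF V.shock_cost_convex[OF cB[of w]], of "1/2" a b] a b
    by (simp add: s_def field_simps)
  have "AE w in F. ?h a w + ?h b w - 2 * ?h s w = 0"
    using integral_nonneg_eq_0_iff_AE[of F "\<lambda>w. ?h a w + ?h b w - 2 * ?h s w"] gap gap_nonneg int[OF a] int[OF b] int[OF s]
    by simp
  then have AE: "AE w in F. \<exists>u. 0 \<le> u \<and> u \<le> a \<and> V' (a - u) = (?h b w - ?h a w) / (b - a) \<and>
      V' (b - u) = (?h b w - ?h a w) / (b - a) \<and> unmet V b (clip B w) = clip B w - u"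
  proof eventually_elim
    case (elim w)
    let ?w = "clip B w"
    have "2 * shock_cost V ((a + b) / 2) ?w \<ge> shock_cost V a ?w + shock_cost V b ?w"
      using elim by (simp add: s_def)
    note mid = V.shock_cost_midpoint_eqD[OF cB a b this]
    define u where "u = ?w - unmet V a ?w"
    have u: "0 \<le> u" "u \<le> a" using V.unmet_feasible[OF a cB[of w]] by (auto simp: u_def)
    have arg: "unmet V a ?w + (x - ?w) = x - u" for x by (simp add: u_def)
    have uab: "0 \<le> a - u" "a - u < b - u" "b - u \<le> sbar" using u ab by auto
    have half: "(a + b) / 2 - u = (a - u + (b - u)) / 2" by (simp add: field_simps)
    have "V ((a - u + (b - u)) / 2) = (V (a - u) + V (b - u)) / 2"
      using mid(3) unfolding arg half .
    from convex_on_midpoint_chord_deriv[OF V_convex V_deriv uab this] mid(2)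
    have "V' (a - u) = (?h b w - ?h a w) / (b - a)" "V' (b - u) = (?h b w - ?h a w) / (b - a)"
      unfolding arg by simp_all
    then show ?case using u mid(1) by (intro exI[of _ u]) (simp add: u_def)
  qed
  have "integrable F (\<lambda>w. (?h b w - ?h a w) / (b - a))" using int[OF a] int[OF b] by simp
  moreover have "(\<integral>w. (?h b w - ?h a w) / (b - a) \<partial>F) = (1 + \<theta> / Q) * c"
  proof -
    have "(\<integral>w. (?h b w - ?h a w) / (b - a) \<partial>F)
        = (shock_mean (shock_cost V) b - shock_mean (shock_cost V) a) / (b - a)"
      unfolding shock_mean_def using int[OF a] int[OF b] by simp
    also have "\<dots> = (Q + \<theta>) * (c * (b - a)) / Q / (b - a)"
    proof -
      have d: "V b - V a = c * (b - a)" using ab aff(2)[of b] by simp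
      have "shock_mean (shock_cost V) b - shock_mean (shock_cost V) a = (Q + \<theta>) * (V b - V a) / Q"
        using ab by (simp add: H diff_divide_distrib right_diff_distrib)
      then show ?thesis unfolding d by simp
    qed
    also have "\<dots> = (1 + \<theta> / Q) * c" using ab Q by (simp add: field_simps)
    finally show ?thesis .
  qed
  ultimately show ?thesis using AE by blast
qed

text \<open>For \<open>c < 0\<close> the mean of the slopes is below \<open>c\<close>, so some shifted piece has a smaller slope. As
  \<open>V'\<close> is nondecreasing, that piece lies at least its own length further down, and the argument applies
  to it again.\<close>

lemma no_descending_flat:
  assumes "0 \<le> a" "0 < L" "a + L \<le> sbar" "V' a = c" "V' (a + L) = c" "c < 0"
  shows "real n * L \<le> a"
  using assms
proof (induction n arbitrary: a c)
  case (Suc n)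
  interpret F: prob_space F by (rule prob_F)
  have aL: "a < a + L" using Suc.prems(2) by simp
  obtain m where m: "integrable F m" "(\<integral>w. m w \<partial>F) = (1 + \<theta> / Q) * c"
    and AE: "AE w in F. \<exists>u. 0 \<le> u \<and> u \<le> a \<and> V' (a - u) = m w \<and> V' (a + L - u) = m w \<and> unmet V (a + L) (clip B w) = clip B w - u"
    using flat_step[OF Suc.prems(1) aL Suc.prems(3,4,5)] by (elim exE conjE)
  have "(1 + \<theta> / Q) * c < 1 * c"
    using Suc.prems \<theta> Q by (intro mult_strict_right_mono_neg) auto
  have "\<exists>u c'. 0 \<le> u \<and> u \<le> a \<and> V' (a - u) = c' \<and> V' (a + L - u) = c' \<and> c' < c"
  proof (rule ccontr)
    assume none: "\<not> ?thesis"
    from AE have "AE w in F. c \<le> m w"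
    proof eventually_elim
      case (elim w)
      then show ?case using none not_less by blast
    qed
    then have "c \<le> (\<integral>w. m w \<partial>F)"
      using m(1) by (intro F.integral_ge_const)
    then show False using m(2) \<open>(1 + \<theta> / Q) * c < 1 * c\<close> by simp
  qed
  then obtain u c' where u: "0 \<le> u" "u \<le> a" "V' (a - u) = c'" "V' (a + L - u) = c'" "c' < c" by blast
  \<comment> \<open>a smaller shift would leave \<open>a + L - u\<close> above \<open>a\<close>, where \<open>V'\<close> is at least \<open>c\<close>\<close>
  have "L \<le> u"
  proof (rule ccontr)
    assume "\<not> L \<le> u"
    then have "V' a \<le> V' (a + L - u)" using u Suc.prems by (intro V'_mono) auto
    then show False using u Suc.prems by simp
  qed
  moreover have "real n * L \<le> a - u"
    using u Suc.prems by (intro Suc.IH[of "a - u" c']) (auto simp: algebra_simps)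
  ultimately show ?case by (simp add: algebra_simps)
qed simp

text \<open>Take the lowest point \<open>a\<close> where \<open>V'\<close> vanishes. The flat pieces obtained from \<open>{a..sbar}\<close> have slopes
  with mean zero, and slopes are nonpositive, so almost all of them are zero. By minimality of \<open>a\<close> the
  pieces are not shifted: almost surely nothing is served from a full storage. But down to level
  \<open>a\<close> serving is free, so this is optimal only for shocks of size zero.\<close>

lemma V'_neg:
  assumes g_pos: "0 < (\<integral>w. g (clip B w) \<partial>F)" and s: "s \<in> {0..sbar}" "s < sbar"
  shows "V' s < 0"
proof (rule ccontr)
  interpret F: prob_space F by (rule prob_F)
  assume "\<not> V' s < 0"
  then have s0: "V' s = 0" using V'_nonpos[OF s(1)] by linarith
  define Z where "Z = {x \<in> {0..sbar}. V' x = 0}"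
  have "closed Z" unfolding Z_def
    by (rule continuous_closed_preimage_constant[OF V'_cont]) simp
  then have "compact Z"
    unfolding compact_eq_bounded_closed
    by (intro conjI bounded_subset[of "{0..sbar}" Z]) (auto simp: Z_def)
  moreover have sZ: "s \<in> Z" using s(1) s0 unfolding Z_def by blast
  then have "Z \<noteq> {}" by blast
  ultimately have "\<exists>a\<in>Z. \<forall>x\<in>Z. a \<le> x" by (rule compact_attains_inf)
  then obtain a where a: "a \<in> Z" "\<And>x. x \<in> Z \<Longrightarrow> a \<le> x" by blast
  have as: "0 \<le> a" "a < sbar" "V' a = 0"
    using a(1) a(2)[OF sZ] s(2) by (auto simp: Z_def)
  have asb: "V' a = 0" "V' sbar = 0" using as V'_sbar by simp_all
  have aff: "V x = V a + 0 * (x - a)" if "x \<in> {a..sbar}" for x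
    by (rule deriv_const_imp_affine(2)[OF V_convex V_deriv as(1) order_refl asb that])
  obtain m where m: "integrable F m" "(\<integral>w. m w \<partial>F) = 0"
    and AE: "AE w in F. \<exists>u. 0 \<le> u \<and> u \<le> a \<and> V' (a - u) = m w \<and> V' (sbar - u) = m w \<and> unmet V sbar (clip B w) = clip B w - u"
    using flat_step[OF as(1,2) order_refl asb] by auto
  have "AE w in F. 0 \<le> - m w"
    using AE
  proof eventually_elim
    case (elim w)
    then obtain u where "0 \<le> u" "u \<le> a" "V' (a - u) = m w" by blast
    with V'_nonpos[of "a - u"] as show ?case by simp
  qed
  moreover have "(\<integral>w. - m w \<partial>F) = 0" using m by simp
  ultimately have m0: "AE w in F. - m w = 0"
    using integral_nonneg_eq_0_iff_AE[of F "\<lambda>w. - m w"] m(1) by simp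
  have "AE w in F. g (clip B w) = 0"
    using AE m0
  proof eventually_elim
    case (elim w)
    let ?w = "clip B w"
    have w: "?w \<in> {0..B}" using B by (simp del: atLeastAtMost_iff)
    obtain u where u: "0 \<le> u" "u \<le> a" "V' (a - u) = 0" "unmet V sbar ?w = ?w - u"
      using elim by (metis neg_equal_0_iff_equal)
    have "a \<le> a - u" using u as by (intro a(2)) (auto simp: Z_def)
    then have unm: "unmet V sbar ?w = ?w" using u by simp
    have "?w = 0"
    proof (rule ccontr)
      assume "?w \<noteq> 0"
      \<comment> \<open>serve as much as keeps the level at or above \<open>a\<close>, where \<open>V\<close> is constant\<close>
      define y where "y = max 0 (?w - (sbar - a))"
      have y: "0 \<le> y" "y < ?w" "?w - sbar \<le> y" "y + (sbar - ?w) \<in> {a..sbar}"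
        using w \<open>?w \<noteq> 0\<close> as by (auto simp: y_def)
      have "g ?w + V (?w + (sbar - ?w)) < g y + V (y + (sbar - ?w))"
        using V.unmet_strict_min[of sbar ?w y] w y sbar by (simp add: unm)
      moreover have "V (?w + (sbar - ?w)) = V (y + (sbar - ?w))"
        using aff[of sbar] aff[OF y(4)] as by simp
      moreover have "g y < g ?w" using g_mono w y by (auto simp: strict_mono_on_def)
      ultimately show False by simp
    qed
    then show ?case by (simp add: g_zero)
  qed
  then have "(\<integral>w. g (clip B w) \<partial>F) = 0" by (rule integral_eq_zero_AE)
  then show False using g_pos by simp
qed

text \<open>A flat piece of negative slope at height \<open>a\<close> with length \<open>b - a\<close> could be moved down only finitely often
  before leaving \<open>{0..sbar}\<close>.\<close>

lemma V'_inj: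
  assumes g_pos: "0 < (\<integral>w. g (clip B w) \<partial>F)"
  shows "inj_on V' {0..sbar}"
proof -
  have "V' a \<noteq> V' b" if ab: "a \<in> {0..sbar}" "b \<in> {0..sbar}" "a < b" for a b
  proof
    assume eq: "V' a = V' b"
    have neg: "V' a < 0" using ab by (intro V'_neg[OF g_pos]) auto
    obtain n where n: "a < real n * (b - a)"
      using reals_Archimedean3[of "b - a"] ab by auto
    have "real n * (b - a) \<le> a"
      using no_descending_flat[of a "b - a" "V' a" n] ab eq neg by simp
    with n show False by simp
  qed
  then show ?thesis by (intro linorder_inj_onI) auto
qed

end

end

section \<open>Break-points of the kernel\<close>

text \<open>Adding the two tangent inequalities shows that a point where no feasible direction has a negative
  slope is a minimiser.\<close>

lemma kernel_first_order:
  fixes g g' f f' :: "real \<Rightarrow> real"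
  assumes \<phi>: "kernel_function sbar B g f \<phi>" and p: "p \<in> {-B..sbar}"
    and g: "convex_on {0..B} g" and f: "convex_on {0..sbar} f"
    and g': "\<And>x. x \<in> {0..B} \<Longrightarrow> (g has_real_derivative g' x) (at x within {0..B})"
    and f': "\<And>x. x \<in> {0..sbar} \<Longrightarrow> (f has_real_derivative f' x) (at x within {0..sbar})"
    and x: "0 \<le> x" "- p \<le> x" "x \<le> B" "x + p \<le> sbar"
    and slope: "\<And>z. 0 \<le> z \<Longrightarrow> - p \<le> z \<Longrightarrow> 0 \<le> (g' x + f' (x + p)) * (z - x)"
  shows "\<phi> p = x"
proof (rule ccontr)
  assume "\<phi> p \<noteq> x"
  note feas = kernel_feasible[OF \<phi> p]
  have less: "g (\<phi> p) + f (\<phi> p + p) < g x + f (x + p)"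
    using \<open>\<phi> p \<noteq> x\<close> by (intro kernel_strict_min[OF \<phi> p x]) simp
  have in1: "x \<in> {0..B}" "\<phi> p \<in> {0..B}" and in2: "x + p \<in> {0..sbar}" "\<phi> p + p \<in> {0..sbar}"
    using x feas by auto
  have "g' x * (\<phi> p - x) \<le> g (\<phi> p) - g x"
    by (rule convex_on_tangent_le[OF g g'[OF in1(1)] in1])
  moreover have "f' (x + p) * (\<phi> p + p - (x + p)) \<le> f (\<phi> p + p) - f (x + p)"
    by (rule convex_on_tangent_le[OF f f'[OF in2(1)] in2])
  moreover have "0 \<le> (g' x + f' (x + p)) * (\<phi> p - x)"
    using feas by (intro slope) simp_all
  ultimately show False using less by (simp add: algebra_simps)
qed

text \<open>For \<open>p \<le> b\<^sub>0\<close> the unmet demand is so large that its marginal cost \<open>g' (- p)\<close> outweighs the value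
  \<open>- C' 0\<close> of the last unit in storage, so the storage is emptied; for \<open>p \<ge> b\<^sub>1\<close> so much would be left
  after full service that serving everything pays. In both cases the minimiser is the left end of the
  feasible interval. In between the slope of the objective is nonpositive at the left end and
  nonnegative at the right end, because \<open>C' sbar = 0\<close> and \<open>- C' 0 \<le> g' B\<close>, so it has a zero.\<close>

lemma kernel_structure:
  fixes g g' C C' :: "real \<Rightarrow> real"
  assumes sbar: "0 < sbar" and B: "0 < B"
    and \<phi>: "kernel_function sbar B g C \<phi>"
    and g_convex: "strictly_convex_on {0..B} g"
    and g_deriv: "\<And>x. x \<in> {0..B} \<Longrightarrow> (g has_real_derivative g' x) (at x within {0..B})"
    and g'_cont: "continuous_on {0..B} g'"
    and C_convex: "convex_on {0..sbar} C"
    and C_deriv: "\<And>s. s \<in> {0..sbar} \<Longrightarrow> (C has_real_derivative C' s) (at s within {0..sbar})"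
    and C'_cont: "continuous_on {0..sbar} C'"
    and C'_inj: "inj_on C' {0..sbar}" and C'_sbar: "C' sbar = 0"
    and g'_0: "0 \<le> g' 0" and G: "- C' 0 \<le> G" "G \<le> g' B"
  shows
    "(g' 0 \<le> - C' 0 \<longrightarrow>
        (let g'inv = the_inv_into {0..B} g';
             C'inv = the_inv_into {0..sbar} C';
             b\<^sub>0 = - g'inv (- C' 0);
             b\<^sub>1 = C'inv (- g' 0)
         in inj_on g' {0..B} \<and> inj_on C' {0..sbar} \<and>
            - C' 0 \<in> g' ` {0..B} \<and> G \<in> g' ` {0..B} \<and> - g' 0 \<in> C' ` {0..sbar} \<and>
            b\<^sub>0 \<ge> - g'inv G \<and> - g'inv G \<ge> - B \<and> b\<^sub>0 \<le> b\<^sub>1 \<and> b\<^sub>1 \<le> sbar \<and>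
            (\<forall>p\<in>{-B..b\<^sub>0}. \<phi> p = - p) \<and>
            (\<forall>p\<in>{b\<^sub>0..b\<^sub>1}.
               {x \<in> {0..B}. x + p \<in> {0..sbar} \<and> g' x + C' (x + p) = 0} = {\<phi> p}) \<and>
            (\<forall>p\<in>{b\<^sub>1..sbar}. \<phi> p = 0))) \<and>
      (- C' 0 < g' 0 \<longrightarrow> (\<forall>p\<in>{-B..sbar}. \<phi> p = max 0 (- p)))"
proof -
  have g_conv: "convex_on {0..B} g" by (rule strictly_convex_on_imp_convex_on[OF g_convex])
  have g'_less: "g' x < g' y" if "x \<in> {0..B}" "y \<in> {0..B}" "x < y" for x y
    by (rule strictly_convex_on_deriv_strict_mono[OF g_convex g_deriv that])
  have g'_le: "g' x \<le> g' y" if "x \<in> {0..B}" "y \<in> {0..B}" "x \<le> y" for x y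
    using g'_less[OF that(1,2)] that(3) by (cases "x = y") auto
  have C'_le: "C' x \<le> C' y" if "x \<in> {0..sbar}" "y \<in> {0..sbar}" "x \<le> y" for x y
    by (rule convex_on_deriv_mono[OF C_convex C_deriv that])
  have first_order: "\<phi> p = x"
    if "p \<in> {-B..sbar}" "0 \<le> x" "- p \<le> x" "x \<le> B" "x + p \<le> sbar"
      and "\<And>z. 0 \<le> z \<Longrightarrow> - p \<le> z \<Longrightarrow> 0 \<le> (g' x + C' (x + p)) * (z - x)" for p x
    by (rule kernel_first_order[OF \<phi> that(1) g_conv C_convex g_deriv C_deriv that(2-)])
  have g'_inj: "inj_on g' {0..B}"
    by (rule linorder_inj_onI) (use g'_less in force)+
  have large: "\<phi> p = max 0 (- p)" if p: "p \<in> {-B..sbar}" and less: "- C' 0 < g' 0" for p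
  proof (rule first_order[OF p])
    show "0 \<le> (g' (max 0 (- p)) + C' (max 0 (- p) + p)) * (z - max 0 (- p))" if "0 \<le> z" "- p \<le> z" for z
    proof (intro mult_nonneg_nonneg)
      have "g' 0 \<le> g' (max 0 (- p))" "C' 0 \<le> C' (max 0 (- p) + p)"
        using p B sbar by (auto intro!: g'_le C'_le simp: max_def)
      then show "0 \<le> g' (max 0 (- p)) + C' (max 0 (- p) + p)" using less by simp
    qed (use that in auto)
  qed (use p B sbar in \<open>auto simp: max_def\<close>)
  have small: ?thesis if le: "g' 0 \<le> - C' 0"
  proof -
    have ivt: "y \<in> f ` {0..e}" if "f 0 \<le> y" "y \<le> f e" "0 \<le> e" "continuous_on {0..e} f"
      for f :: "real \<Rightarrow> real" and y e
    proof -
      have "\<exists>x\<ge>0. x \<le> e \<and> f x = y" by (rule IVT'[OF that])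
      then show ?thesis by auto
    qed
    have B0: "0 \<le> B" and s0: "0 \<le> sbar" using B sbar by simp_all
    have im1: "- C' 0 \<in> g' ` {0..B}" by (rule ivt[OF le _ B0 g'_cont]) (use G in linarith)
    have im2: "G \<in> g' ` {0..B}" by (rule ivt[OF _ G(2) B0 g'_cont]) (use G le in linarith)
    have im3: "- g' 0 \<in> C' ` {0..sbar}"
      by (rule ivt[OF _ _ s0 C'_cont]) (use le g'_0 C'_sbar in linarith)+
    define u where "u = the_inv_into {0..B} g' (- C' 0)"
    define v where "v = the_inv_into {0..B} g' G"
    define b where "b = the_inv_into {0..sbar} C' (- g' 0)"
    have u: "u \<in> {0..B}" "g' u = - C' 0"
      unfolding u_def by (rule the_inv_into_into[OF g'_inj im1 order_refl], rule f_the_inv_into_f[OF g'_inj im1])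
    have v: "v \<in> {0..B}" "g' v = G"
      unfolding v_def by (rule the_inv_into_into[OF g'_inj im2 order_refl], rule f_the_inv_into_f[OF g'_inj im2])
    have b: "b \<in> {0..sbar}" "C' b = - g' 0"
      unfolding b_def by (rule the_inv_into_into[OF C'_inj im3 order_refl], rule f_the_inv_into_f[OF C'_inj im3])
    have uv: "u \<le> v" using g'_less[OF v(1) u(1)] u v G by (cases "v < u") auto
    have low: "\<phi> p = - p" if p: "p \<in> {-B..-u}" for p
    proof (rule first_order)
      show "p \<in> {-B..sbar}" using p u sbar by auto
      show "0 \<le> (g' (- p) + C' (- p + p)) * (z - - p)" if "0 \<le> z" "- p \<le> z" for z
      proof (intro mult_nonneg_nonneg)
        have "g' u \<le> g' (- p)" using p u by (intro g'_le) auto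
        then show "0 \<le> g' (- p) + C' (- p + p)" using u by simp
      qed (use that in simp)
    qed (use p u sbar in auto)
    have high: "\<phi> p = 0" if p: "p \<in> {b..sbar}" for p
    proof (rule first_order)
      show "p \<in> {-B..sbar}" using p b B by auto
      show "0 \<le> (g' 0 + C' (0 + p)) * (z - 0)" if "0 \<le> z" "- p \<le> z" for z
      proof (intro mult_nonneg_nonneg)
        have "C' b \<le> C' p" using p b by (intro C'_le) auto
        then show "0 \<le> g' 0 + C' (0 + p)" using b by simp
      qed (use that in simp)
    qed (use p b B in auto)
    have mid: "{x \<in> {0..B}. x + p \<in> {0..sbar} \<and> g' x + C' (x + p) = 0} = {\<phi> p}" if p: "p \<in> {-u..b}" for p
    proof -
      have p': "p \<in> {-B..sbar}" using p u b by auto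
      have root: "\<phi> p = x" if "x \<in> {0..B}" "x + p \<in> {0..sbar}" "g' x + C' (x + p) = 0" for x
        by (rule first_order) (use that p' in auto)
      define lo hi where "lo = max 0 (- p)" and "hi = min B (sbar - p)"
      have rng: "x \<in> {0..B}" "x + p \<in> {0..sbar}" if "x \<in> {lo..hi}" for x
        using that by (auto simp: lo_def hi_def)
      have lohi: "lo \<le> hi" using p' B sbar by (auto simp: lo_def hi_def)
      have "continuous_on {lo..hi} (\<lambda>x. g' x + C' (x + p))"
      proof (intro continuous_on_add)
        show "continuous_on {lo..hi} g'" by (rule continuous_on_subset[OF g'_cont]) (use rng in blast)
        show "continuous_on {lo..hi} (\<lambda>x. C' (x + p))"
        proof (rule continuous_on_compose2[OF C'_cont])
          show "continuous_on {lo..hi} (\<lambda>x. x + p)" by (intro continuous_intros)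
        qed (use rng in blast)
      qed
      moreover have "g' lo + C' (lo + p) \<le> 0"
      proof (cases "p \<le> 0")
        case True
        have "g' (- p) \<le> g' u" using p u True by (intro g'_le) auto
        then show ?thesis using True u by (simp add: lo_def)
      next
        case False
        have "C' p \<le> C' b" using p b False by (intro C'_le) auto
        then show ?thesis using False b by (simp add: lo_def)
      qed
      moreover have "0 \<le> g' hi + C' (hi + p)"
      proof (cases "sbar - p \<le> B")
        case True
        have "g' 0 \<le> g' (sbar - p)" using p' True B by (intro g'_le) auto
        then show ?thesis using True C'_sbar g'_0 by (simp add: hi_def)
      next
        case False
        have "C' 0 \<le> C' (B + p)" using p' False sbar by (intro C'_le) auto
        then show ?thesis using False G by (simp add: hi_def)
      qed
      ultimately obtain x where x: "lo \<le> x" "x \<le> hi" "g' x + C' (x + p) = 0"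
        using IVT'[of "\<lambda>x. g' x + C' (x + p)" lo 0 hi] lohi by auto
      then have "x \<in> {0..B}" "x + p \<in> {0..sbar}" using rng[of x] by auto
      with x(3) root show ?thesis by blast
    qed
    show ?thesis
      using le g'_inj C'_inj im1 im2 im3 uv u(1) v(1) b(1) low high mid B
      unfolding Let_def u_def[symmetric] v_def[symmetric] b_def[symmetric] by auto
  qed
  show ?thesis
  proof (cases "g' 0 \<le> - C' 0")
    case True
    then show ?thesis by (rule small)
  next
    case False
    then show ?thesis using large by auto
  qed
qed

lemma shock_law:
  assumes "shock_model M Q B F t W"
  shows "prob_space F" "sets F = sets borel" "AE w in F. w \<in> {0..B}"
proof -
  interpret M: prob_space M using assms by (simp add: shock_model_def)
  have W: "\<And>\<omega>. \<omega> \<in> space M \<Longrightarrow> W (Suc 0) \<omega> \<in> {0..B}" and F: "distr M borel (W (Suc 0)) = F"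
    and rv: "M.indep_vars (\<lambda>_. borel) (\<lambda>k. W (Suc k)) UNIV"
    using assms by (auto simp: shock_model_def iid_shocks_def)
  have m: "W (Suc 0) \<in> borel_measurable M"
    using rv by (simp add: M.indep_vars_def)
  show "prob_space F" unfolding F[symmetric] by (rule M.prob_space_distr[OF m])
  show "sets F = sets borel" unfolding F[symmetric] by simp
  show "AE w in F. w \<in> {0..B}"
    unfolding F[symmetric] by (subst AE_distr_iff[OF m]) (use W in auto)
qed

section \<open>The optimal policy\<close>

theorem theorem5:
  fixes M :: "'a measure" and f\<^sub>W :: "real measure"
    and t W :: "nat \<Rightarrow> 'a \<Rightarrow> real"
    and r Q \<theta> sbar B :: real
    and g g' C C' :: "real \<Rightarrow> real"
  assumes "r > 0" "Q > 0" "\<theta> > 0" "sbar > 0" "B > 0"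
    and model: "shock_model M Q B f\<^sub>W t W"
    and g_bounded: "bounded (g ` {0..B})"
    and g_mono: "strict_mono_on {0..B} g"
    and g_deriv: "\<And>x. x \<in> {0..B} \<Longrightarrow> (g has_real_derivative g' x) (at x within {0..B})"
    and g'_cont: "continuous_on {0..B} g'"
    and g_zero: "g 0 = 0"
    and g_pos: "(LINT w:{0..B}|f\<^sub>W. g w) > 0"
    and g_convex: "strictly_convex_on {0..B} g"
    and C: "C = value_function M r \<theta> sbar B t W g"
    and C_deriv: "\<And>s. s \<in> {0..sbar} \<Longrightarrow> (C has_real_derivative C' s) (at s within {0..sbar})"
    and C'_cont: "continuous_on {0..sbar} C'"
  shows
    "(\<exists>!\<phi>. kernel_function sbar B g C \<phi> \<and>
        optimal_policy M r \<theta> sbar B t W g (\<lambda>s w. max 0 (w - \<phi> (s - w))) \<and>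
        (\<forall>\<mu>. optimal_policy M r \<theta> sbar B t W g \<mu> \<longrightarrow>
          (AE s in lborel. s \<in> {0..sbar} \<longrightarrow> (AE w in f\<^sub>W. \<mu> s w = max 0 (w - \<phi> (s - w)))) \<and>
          (AE w in f\<^sub>W. \<mu> sbar w = max 0 (w - \<phi> (sbar - w))))) \<and>
     (\<forall>\<phi>. kernel_function sbar B g C \<phi> \<longrightarrow> Q * (LINT w|f\<^sub>W. w) \<le> r \<longrightarrow>
        (g' 0 \<le> - C' 0 \<longrightarrow>
          (let g'inv = the_inv_into {0..B} g';
               C'inv = the_inv_into {0..sbar} C';
               G = Q / r * (LINT w:{0..B}|f\<^sub>W. g w);
               b\<^sub>0 = - g'inv (- C' 0);
               b\<^sub>1 = C'inv (- g' 0)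
           in inj_on g' {0..B} \<and> inj_on C' {0..sbar} \<and>
              - C' 0 \<in> g' ` {0..B} \<and> G \<in> g' ` {0..B} \<and> - g' 0 \<in> C' ` {0..sbar} \<and>
              b\<^sub>0 \<ge> - g'inv G \<and> - g'inv G \<ge> - B \<and> b\<^sub>0 \<le> b\<^sub>1 \<and> b\<^sub>1 \<le> sbar \<and>
              (\<forall>p\<in>{-B..b\<^sub>0}. \<phi> p = - p) \<and>
              (\<forall>p\<in>{b\<^sub>0..b\<^sub>1}.
                 {x \<in> {0..B}. x + p \<in> {0..sbar} \<and> g' x + C' (x + p) = 0} = {\<phi> p}) \<and>
              (\<forall>p\<in>{b\<^sub>1..sbar}. \<phi> p = 0))) \<and>
        (- C' 0 < g' 0 \<longrightarrow> (\<forall>p\<in>{-B..sbar}. \<phi> p = max 0 (- p))))"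
proof -
  note pos = assms(1-5)
  interpret F: prob_space f\<^sub>W by (rule shock_law(1)[OF model])
  interpret S: storage_problem r Q \<theta> sbar B g f\<^sub>W
  proof
    show "continuous_on {0..B} g" using g_deriv by (rule DERIV_continuous_on)
  qed (fact pos g_mono g_zero g_convex shock_law[OF model])+
  obtain V where V: "continuous_on {0..sbar} V" "convex_on {0..sbar} V"
    and V_eq: "\<And>s. V s = S.expect (S.shock_cost V) s"
    using S.bellman_solution by metis
  note V3 = V V_eq
  let ?\<mu> = "S.kernel_policy V"
  let ?J = "cost M r \<theta> sbar t W g"
  have pol: "?\<mu> \<in> policies sbar B" by (rule S.kernel_policy_in_policies[OF V3])
  have J: "?J \<mu> s = S.policy_cost \<mu> s" if "\<mu> \<in> policies sbar B" "s \<in> {0..sbar}" for \<mu> s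
    by (rule S.cost_eq_policy_cost[OF model that])
  have J_ge: "V s \<le> ?J \<mu> s" if "\<mu> \<in> policies sbar B" "s \<in> {0..sbar}" for \<mu> s
    unfolding J[OF that] by (rule S.policy_cost_ge_V[OF V3 that])
  have J_opt: "?J ?\<mu> s = V s" if "s \<in> {0..sbar}" for s
    unfolding J[OF pol that] by (rule S.policy_cost_kernel_policy[OF V3 that])
  have CV: "C s = V s" if s: "s \<in> {0..sbar}" for s
    unfolding C value_function_def J_opt[OF s, symmetric]
    by (rule cInf_eq_minimum[OF imageI[OF pol]]) (use J_ge[OF _ s] J_opt[OF s] in auto)
  interpret kernel_problem sbar B g V by (rule S.kernel_problem[OF V])
  have kernel_C: "kernel_function sbar B g C = kernel_function sbar B g V"
    by (rule kernel_function_cong) (rule CV)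
  have sb: "0 \<in> {0..sbar}" "sbar \<in> {0..sbar}" using pos by auto
  have optimal_iff: "optimal_policy M r \<theta> sbar B t W g \<mu> \<longleftrightarrow>
      \<mu> \<in> policies sbar B \<and> (\<forall>s\<in>{0..sbar}. ?J \<mu> s = V s)" for \<mu>
  proof
    assume opt: "optimal_policy M r \<theta> sbar B t W g \<mu>"
    then have \<mu>: "\<mu> \<in> policies sbar B" using sb unfolding optimal_policy_def is_arg_min_linorder by blast
    have "?J \<mu> s = V s" if s: "s \<in> {0..sbar}" for s
    proof (rule antisym)
      show "?J \<mu> s \<le> V s"
        using opt s pol J_opt[OF s] unfolding optimal_policy_def is_arg_min_linorder by metis
    qed (rule J_ge[OF \<mu> s])
    then show "\<mu> \<in> policies sbar B \<and> (\<forall>s\<in>{0..sbar}. ?J \<mu> s = V s)" using \<mu> by blast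
  next
    assume "\<mu> \<in> policies sbar B \<and> (\<forall>s\<in>{0..sbar}. ?J \<mu> s = V s)"
    then show "optimal_policy M r \<theta> sbar B t W g \<mu>"
      using J_ge unfolding optimal_policy_def is_arg_min_linorder by metis
  qed
  have AE_policy: "(AE s in lborel. s \<in> {0..sbar} \<longrightarrow> (AE w in f\<^sub>W. \<mu> s w = ?\<mu> s w)) \<and>
      (AE w in f\<^sub>W. \<mu> sbar w = ?\<mu> sbar w)"
    if opt: "optimal_policy M r \<theta> sbar B t W g \<mu>" for \<mu>
  proof
    have \<mu>: "\<mu> \<in> policies sbar B" and eq: "\<And>s. s \<in> {0..sbar} \<Longrightarrow> S.policy_cost \<mu> s = V s"
      using opt J unfolding optimal_iff by auto
    have AE: "AE \<tau> in S.interarrival_law. AE w in f\<^sub>W. \<mu> (S.next_level s \<tau>) w = ?\<mu> (S.next_level s \<tau>) w" if "s \<in> {0..sbar}" for s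
      by (rule S.optimal_policy_cost_unique[OF V3 \<mu> eq that])
    let ?P = "\<lambda>s. AE w in f\<^sub>W. \<mu> s w = ?\<mu> s w"
    have "AE \<tau> in lborel. 0 < ennreal (exponential_density Q \<tau>) \<longrightarrow> ?P (S.next_level 0 \<tau>)"
      using AE[OF sb(1)] unfolding S.interarrival_law_def by (subst (asm) AE_density) auto
    \<comment> \<open>from an empty storage the level \<open>s\<close> is reached after the waiting time \<open>s / r\<close>, and this linear map pulls null sets back to null sets\<close>
    then have "AE \<tau> in density (distr lborel borel (\<lambda>x. 0 + 1 / r * x)) (\<lambda>_. ennreal \<bar>1 / r\<bar>).
        0 < ennreal (exponential_density Q \<tau>) \<longrightarrow> ?P (S.next_level 0 \<tau>)"
      using pos by (subst lborel_real_affine[symmetric]) auto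
    then have "AE \<tau> in distr lborel borel (\<lambda>x. 0 + 1 / r * x).
        0 < ennreal (exponential_density Q \<tau>) \<longrightarrow> ?P (S.next_level 0 \<tau>)"
      using pos by (subst (asm) AE_density) auto
    then have "AE x in lborel. 0 < ennreal (exponential_density Q (0 + 1 / r * x)) \<longrightarrow> ?P (S.next_level 0 (0 + 1 / r * x))"
      by (rule AE_distrD[rotated]) simp
    then show "AE s in lborel. s \<in> {0..sbar} \<longrightarrow> ?P s"
    proof eventually_elim
      case (elim s)
      show ?case
      proof
        assume s: "s \<in> {0..sbar}"
        then have "S.next_level 0 (0 + 1 / r * s) = s" using pos by (simp add: S.next_level_def clip_def)
        moreover have "0 < ennreal (exponential_density Q (0 + 1 / r * s))"
          using s pos divide_nonneg_pos[of s r] by (simp add: exponential_density_def not_less)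
        ultimately show "?P s" using elim by simp
      qed
    qed
    interpret E: prob_space S.interarrival_law by (rule S.prob_E)
    have "AE \<tau> in S.interarrival_law. ?P sbar"
      using AE[OF sb(2)] S.E_pos
    proof eventually_elim
      case (elim \<tau>)
      have "S.next_level sbar \<tau> = sbar" using elim(2) pos by (simp add: S.next_level_def clip_def)
      then show ?case using elim(1) by simp
    qed
    then show "?P sbar" by simp
  qed
  let ?\<phi> = "cost_kernel sbar B g V"
  have policy_eq: "(\<lambda>s w. max 0 (w - ?\<phi> (s - w))) = ?\<mu>"
    by (intro ext) (simp add: S.kernel_policy_def)
  have part1: "\<exists>!\<phi>. kernel_function sbar B g C \<phi> \<and>
        optimal_policy M r \<theta> sbar B t W g (\<lambda>s w. max 0 (w - \<phi> (s - w))) \<and>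
        (\<forall>\<mu>. optimal_policy M r \<theta> sbar B t W g \<mu> \<longrightarrow>
          (AE s in lborel. s \<in> {0..sbar} \<longrightarrow> (AE w in f\<^sub>W. \<mu> s w = max 0 (w - \<phi> (s - w)))) \<and>
          (AE w in f\<^sub>W. \<mu> sbar w = max 0 (w - \<phi> (sbar - w))))"
  proof (rule ex1I[of _ ?\<phi>])
    have 1: "kernel_function sbar B g C ?\<phi>"
      unfolding kernel_C by (rule kernel_function_cost_kernel)
    have 2: "optimal_policy M r \<theta> sbar B t W g (\<lambda>s w. max 0 (w - ?\<phi> (s - w)))"
      unfolding policy_eq optimal_iff using pol J_opt by blast
    have 3: "\<forall>\<mu>. optimal_policy M r \<theta> sbar B t W g \<mu> \<longrightarrow>
          (AE s in lborel. s \<in> {0..sbar} \<longrightarrow> (AE w in f\<^sub>W. \<mu> s w = max 0 (w - ?\<phi> (s - w)))) \<and>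
          (AE w in f\<^sub>W. \<mu> sbar w = max 0 (w - ?\<phi> (sbar - w)))"
      by (intro allI impI) (rule AE_policy[unfolded S.kernel_policy_def])
    show "kernel_function sbar B g C ?\<phi> \<and>
        optimal_policy M r \<theta> sbar B t W g (\<lambda>s w. max 0 (w - ?\<phi> (s - w))) \<and>
        (\<forall>\<mu>. optimal_policy M r \<theta> sbar B t W g \<mu> \<longrightarrow>
          (AE s in lborel. s \<in> {0..sbar} \<longrightarrow> (AE w in f\<^sub>W. \<mu> s w = max 0 (w - ?\<phi> (s - w)))) \<and>
          (AE w in f\<^sub>W. \<mu> sbar w = max 0 (w - ?\<phi> (sbar - w))))"
      by (intro conjI 1 2 3)
  next
    fix \<psi>
    assume "kernel_function sbar B g C \<psi> \<and>
        optimal_policy M r \<theta> sbar B t W g (\<lambda>s w. max 0 (w - \<psi> (s - w))) \<and>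
        (\<forall>\<mu>. optimal_policy M r \<theta> sbar B t W g \<mu> \<longrightarrow>
          (AE s in lborel. s \<in> {0..sbar} \<longrightarrow> (AE w in f\<^sub>W. \<mu> s w = max 0 (w - \<psi> (s - w)))) \<and>
          (AE w in f\<^sub>W. \<mu> sbar w = max 0 (w - \<psi> (sbar - w))))"
    then have "kernel_function sbar B g V \<psi>" unfolding kernel_C by (rule conjunct1)
    then show "\<psi> = ?\<phi>" by (rule kernel_function_unique[OF _ kernel_function_cost_kernel])
  qed
  have V_deriv: "(V has_real_derivative C' s) (at s within {0..sbar})" if s: "s \<in> {0..sbar}" for s
    by (rule has_field_derivative_transform_within[OF C_deriv[OF s], of 1]) (use s CV in simp_all)
  have V_nonneg: "0 \<le> V s" if s: "s \<in> {0..sbar}" for s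
    using S.policy_cost_nonneg[OF pol, of s] J[OF pol s] J_opt[OF s] by simp
  note V_facts = V V_nonneg V_eq V_deriv C'_cont
  have clip_AE: "AE w in f\<^sub>W. w \<in> {0..B}" by (rule shock_law(3)[OF model])
  have meas [measurable]: "(\<lambda>w. g (clip B w)) \<in> borel_measurable f\<^sub>W"
    using S.g_measurable measurable_cong_sets[OF shock_law(2)[OF model] refl] by blast
  have ident [measurable]: "(\<lambda>w. w) \<in> borel_measurable f\<^sub>W"
    by (rule measurable_ident_sets[OF shock_law(2)[OF model]])
  have cB: "clip B w \<in> {0..B}" for w using pos by (simp del: atLeastAtMost_iff)
  have int_w: "integrable f\<^sub>W (\<lambda>w. w)"
    by (rule F.integrable_const_bound[of _ B, OF _ ident]) (use clip_AE in eventually_elim, simp)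
  have int_g: "integrable f\<^sub>W (\<lambda>w. g (clip B w))"
    by (rule F.integrable_const_bound[of _ "g B", OF AE_I2 meas]) (use S.g_range[OF cB] in simp)
  have mean_g: "(LINT w:{0..B}|f\<^sub>W. g w) = (\<integral>w. g (clip B w) \<partial>f\<^sub>W)"
  proof -
    have "(LINT w:{0..B}|f\<^sub>W. g w) = (LINT w:{0..B}|f\<^sub>W. g (clip B w))"
      unfolding set_lebesgue_integral_def
      by (rule Bochner_Integration.integral_cong) (auto simp: indicator_def)
    also have "\<dots> = (\<integral>w. g (clip B w) \<partial>f\<^sub>W)"
      unfolding set_lebesgue_integral_def
    proof (rule integral_cong_AE)
      show "AE w in f\<^sub>W. indicator {0..B} w *\<^sub>R g (clip B w) = g (clip B w)"
        using clip_AE by eventually_elim simp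
      have "(\<lambda>w. indicator {0..B} w :: real) \<in> borel_measurable f\<^sub>W"
        using measurable_cong_sets[OF shock_law(2)[OF model] refl] by (intro borel_measurable_indicator) (simp add: shock_law(2)[OF model])
      then show "(\<lambda>w. indicator {0..B} w *\<^sub>R g (clip B w)) \<in> borel_measurable f\<^sub>W"
        using meas by (intro borel_measurable_scaleR)
    qed (rule meas)
    finally show ?thesis .
  qed
  have mean_pos: "0 < (\<integral>w. g (clip B w) \<partial>f\<^sub>W)" using g_pos mean_g by simp
  have g_conv: "convex_on {0..B} g" by (rule strictly_convex_on_imp_convex_on[OF g_convex])
  have g'_pos: "0 < g' x" if x: "x \<in> {0..B}" "0 < x" for x
  proof -
    have z: "0 \<in> {0..B}" using pos by simp
    have "g' x * (0 - x) \<le> g 0 - g x" by (rule convex_on_tangent_le[OF g_conv g_deriv[OF x(1)] x(1) z])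
    moreover have "g 0 < g x" using g_mono x z by (auto simp: strict_mono_on_def)
    ultimately have "0 < g' x * x" by simp
    then show ?thesis using x(2) by (simp add: zero_less_mult_iff)
  qed
  have g'_0: "0 \<le> g' 0"
  proof (rule ccontr)
    assume neg: "\<not> 0 \<le> g' 0"
    have "\<exists>d>0. \<forall>x\<in>{0..B}. dist x 0 < d \<longrightarrow> dist (g' x) (g' 0) < - g' 0"
      using g'_cont[unfolded continuous_on_iff, rule_format, of 0 "- g' 0"] pos neg by simp
    then obtain d where d: "0 < d" "\<And>x. x \<in> {0..B} \<Longrightarrow> dist x 0 < d \<Longrightarrow> dist (g' x) (g' 0) < - g' 0" by blast
    \<comment> \<open>\<open>g'\<close> is positive on \<open>{0<..B}\<close>, so continuity forbids a negative value at \<open>0\<close>\<close>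
    let ?x = "min B (d / 2)"
    have x: "?x \<in> {0..B}" "0 < ?x" "dist ?x 0 < d" using pos d(1) by (auto simp: dist_real_def)
    show False using d(2)[OF x(1,3)] g'_pos[OF x(1,2)] by (simp add: dist_real_def)
  qed
  have part2: "(g' 0 \<le> - C' 0 \<longrightarrow>
        (let g'inv = the_inv_into {0..B} g';
             C'inv = the_inv_into {0..sbar} C';
             G = Q / r * (LINT w:{0..B}|f\<^sub>W. g w);
             b\<^sub>0 = - g'inv (- C' 0);
             b\<^sub>1 = C'inv (- g' 0)
         in inj_on g' {0..B} \<and> inj_on C' {0..sbar} \<and>
            - C' 0 \<in> g' ` {0..B} \<and> G \<in> g' ` {0..B} \<and> - g' 0 \<in> C' ` {0..sbar} \<and>
            b\<^sub>0 \<ge> - g'inv G \<and> - g'inv G \<ge> - B \<and> b\<^sub>0 \<le> b\<^sub>1 \<and> b\<^sub>1 \<le> sbar \<and>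
            (\<forall>p\<in>{-B..b\<^sub>0}. \<phi> p = - p) \<and>
            (\<forall>p\<in>{b\<^sub>0..b\<^sub>1}.
               {x \<in> {0..B}. x + p \<in> {0..sbar} \<and> g' x + C' (x + p) = 0} = {\<phi> p}) \<and>
            (\<forall>p\<in>{b\<^sub>1..sbar}. \<phi> p = 0))) \<and>
      (- C' 0 < g' 0 \<longrightarrow> (\<forall>p\<in>{-B..sbar}. \<phi> p = max 0 (- p)))"
    if \<phi>: "kernel_function sbar B g C \<phi>" and le: "Q * (LINT w|f\<^sub>W. w) \<le> r" for \<phi>
  proof -
    let ?G = "Q / r * (LINT w:{0..B}|f\<^sub>W. g w)"
    have "(\<integral>w. g (clip B w) \<partial>f\<^sub>W) \<le> (\<integral>w. g' B * w \<partial>f\<^sub>W)"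
    proof (rule integral_mono_AE)
      show "AE w in f\<^sub>W. g (clip B w) \<le> g' B * w"
        using clip_AE
      proof eventually_elim
        case (elim w)
        have z: "0 \<in> {0..B}" "B \<in> {0..B}" using pos by auto
        have "g' w * (0 - w) \<le> g 0 - g w" by (rule convex_on_tangent_le[OF g_conv g_deriv[OF elim] elim z(1)])
        moreover have "g' w \<le> g' B" by (rule convex_on_deriv_mono[OF g_conv g_deriv elim z(2)]) (use elim in simp_all)
        then have "g' w * w \<le> g' B * w" using elim by (intro mult_right_mono) auto
        ultimately show ?case using elim g_zero by simp
      qed
    qed (use int_w int_g in auto)
    then have "?G \<le> Q / r * (g' B * (LINT w|f\<^sub>W. w))"
      unfolding mean_g using pos by (intro mult_left_mono) auto
    also have "\<dots> = g' B * (Q * (LINT w|f\<^sub>W. w) / r)" by simp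
    also have "\<dots> \<le> g' B * 1"
      using le pos g'_pos[of B] by (intro mult_left_mono) auto
    finally have G_le: "?G \<le> g' B" by simp
    have G_ge: "- C' 0 \<le> ?G" unfolding mean_g by (rule S.V'_0_ge[OF V_facts])
    have \<phi>V: "kernel_function sbar B g V \<phi>" using \<phi> unfolding kernel_C .
    show ?thesis
      using kernel_structure[OF pos(4,5) \<phi>V g_convex g_deriv g'_cont V(2) V_deriv C'_cont
          S.V'_inj[OF V_facts mean_pos] S.V'_sbar[OF V_facts] g'_0 G_ge G_le]
      unfolding Let_def by blast
  qed
  show ?thesis
    by (rule conjI[OF part1]) (intro allI impI, rule part2)
qed

end
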